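(* Let $g \geq 2$. There exists a proper normal subgroup of $\mathrm{Mod}(S_g)$ that is not contained in any proper level $m$ congruence subgroup of $\mathrm{Mod}(S_g)$.
   Context: $S_g$ is the closed, connected, orientable surface of genus $g$ and $\mathrm{Mod}(S_g)$ is its mapping class group (isotopy classes of orientation-preserving homeomorphisms). The level $m$ congruence subgroup $\mathrm{Mod}(S_g)[m]$ is the kernel of the action of $\mathrm{Mod}(S_g)$ on $H_1(S_g;\mathbb{Z}/m\mathbb{Z})$. *)

theory Defs
  imports "HOL-Homology.Homology" "HOL-Algebra.Bij"
begin

section \<open>The closed connected orientable surface of genus $g$\<close>

text \<open>
  The surface is the quotient of the closed unit disc, regarded as a polygon with \<open>4 * g\<close>
  boundary edges, by the edge word \<open>a\<^sub>1 b\<^sub>1 a\<^sub>1\<inverse> b\<^sub>1\<inverse> \<dots> a\<^sub>g b\<^sub>g a\<^sub>g\<inverse> b\<^sub>g\<inverse>\<close>.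
  Edge number \<open>j\<close> is the arc on which the parameter below runs through \<open>{j..j + 1}\<close>;
  the inverse letters are why the second parameter decreases in \<open>s\<close>.
\<close>

definition rim_point :: "nat \<Rightarrow> real \<Rightarrow> complex" where
  "rim_point g t = cis (2 * pi * t / real (4 * g))"

definition edge_pairing :: "nat \<Rightarrow> (complex \<times> complex) set" where
  "edge_pairing g =
     {(rim_point g (4 * real i + s), rim_point g (4 * real i + 3 - s)) | i s. i < g \<and> s \<in> {0..1}} \<union>
     {(rim_point g (4 * real i + 1 + s), rim_point g (4 * real i + 4 - s)) | i s. i < g \<and> s \<in> {0..1}}"

definition glued :: "nat \<Rightarrow> (complex \<times> complex) set" where
  "glued g = (edge_pairing g \<union> (edge_pairing g)\<inverse>)\<^sup>*"

text \<open>For \<open>g \<ge> 1\<close>, a space is a genus \<open>g\<close> surface iff it is homeomorphic to the polygon quotient.\<close>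

definition genus_surface :: "nat \<Rightarrow> 'a topology \<Rightarrow> bool" where
  "genus_surface g X \<longleftrightarrow>
     (\<exists>q. quotient_map (top_of_set (cball (0::complex) 1)) X q \<and>
          (\<forall>x\<in>cball 0 1. \<forall>y\<in>cball 0 1. q x = q y \<longleftrightarrow> (x, y) \<in> glued g))"

lemma genus_surface_exists: "\<exists>X :: complex set topology. genus_surface g X"
proof -
  let ?D = "cball (0::complex) 1"
  let ?q = "\<lambda>x. glued g `` {x}"
  let ?P = "\<lambda>U. U \<subseteq> ?q ` ?D \<and> openin (top_of_set ?D) {x \<in> ?D. ?q x \<in> U}"
  have ist: "istopology ?P"
    unfolding istopology_def
  proof (intro conjI allI impI)
    fix S T assume S: "?P S" and T: "?P T"
    have "{x \<in> ?D. ?q x \<in> S \<inter> T} = {x \<in> ?D. ?q x \<in> S} \<inter> {x \<in> ?D. ?q x \<in> T}" by blast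
    moreover have "openin (top_of_set ?D) ({x \<in> ?D. ?q x \<in> S} \<inter> {x \<in> ?D. ?q x \<in> T})"
      using S T by (intro openin_Int) blast+
    ultimately show "openin (top_of_set ?D) {x \<in> ?D. ?q x \<in> S \<inter> T}" by (simp only:)
    show "S \<inter> T \<subseteq> ?q ` ?D" using S by blast
  next
    fix K assume K: "\<forall>S\<in>K. ?P S"
    have "{x \<in> ?D. ?q x \<in> \<Union>K} = \<Union>((\<lambda>S. {x \<in> ?D. ?q x \<in> S}) ` K)" by blast
    moreover have "openin (top_of_set ?D) (\<Union>((\<lambda>S. {x \<in> ?D. ?q x \<in> S}) ` K))"
      using K by (intro openin_Union) blast
    ultimately show "openin (top_of_set ?D) {x \<in> ?D. ?q x \<in> \<Union>K}" by (simp only:)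
    show "\<Union>K \<subseteq> ?q ` ?D" using K by blast
  qed
  have op: "openin (topology ?P) = ?P" by (rule topology_inverse'[OF ist])
  have "?P (?q ` ?D)"
  proof -
    have "{x \<in> ?D. ?q x \<in> ?q ` ?D} = ?D" by blast
    then show ?thesis by (simp only: openin_subtopology_self order_refl simp_thms)
  qed
  then have ts: "topspace (topology ?P) = ?q ` ?D"
    unfolding topspace_def op by blast
  have eqv: "sym (glued g)" "trans (glued g)" "refl (glued g)"
    unfolding glued_def by (auto intro: sym_rtrancl trans_rtrancl refl_rtrancl sym_Un_converse)
  have "quotient_map (top_of_set ?D) (topology ?P) ?q"
    unfolding quotient_map_def ts op by simp
  moreover have "?q x = ?q y \<longleftrightarrow> (x, y) \<in> glued g" for x y
    using eqv eq_equiv_class_iff[of UNIV "glued g" x y] by (simp add: equiv_def)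
  ultimately have "genus_surface g (topology ?P)" unfolding genus_surface_def by blast
  then show ?thesis by blast
qed


section \<open>The mapping class group\<close>

text \<open>
  On a closed connected orientable surface the group \<open>H\<^sub>2(X; \<int>)\<close> is infinite cyclic and generated
  by a fundamental class, so preserving the orientation means acting trivially on \<open>H\<^sub>2\<close>.
\<close>

definition orientation_preserving :: "'a topology \<Rightarrow> ('a \<Rightarrow> 'a) \<Rightarrow> bool" where
  "orientation_preserving X f \<longleftrightarrow>
     (\<forall>z \<in> carrier (homology_group 2 X). hom_induced 2 X {} X {} f z = z)"

text \<open>Maps are taken extensional, so that each homeomorphism is represented by one function.\<close>

definition homeos :: "'a topology \<Rightarrow> ('a \<Rightarrow> 'a) set" where
  "homeos X = {f \<in> extensional (topspace X). homeomorphic_map X X f \<and> orientation_preserving X f}"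

definition isotopy :: "'a topology \<Rightarrow> (('a \<Rightarrow> 'a) \<times> ('a \<Rightarrow> 'a)) set" where
  "isotopy X = {(f, g). f \<in> homeos X \<and> g \<in> homeos X \<and>
                        homotopic_with (homeomorphic_map X X) X X f g}"

definition mapping_class_group :: "'a topology \<Rightarrow> ('a \<Rightarrow> 'a) set monoid" where
  "mapping_class_group X =
     \<lparr>carrier = homeos X // isotopy X,
      mult = \<lambda>A B. (\<Union>f\<in>A. \<Union>g\<in>B. isotopy X `` {compose (topspace X) f g}),
      one = isotopy X `` {\<lambda>x\<in>topspace X. x}\<rparr>"

lemma homeos_id: "(\<lambda>x\<in>topspace X. x) \<in> homeos X"
proof -
  have "homeomorphic_map X X (\<lambda>x\<in>topspace X. x)"
    using homeomorphic_map_eq[of X X id] by simp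
  moreover from this have "orientation_preserving X (\<lambda>x\<in>topspace X. x)"
    unfolding orientation_preserving_def
    by (intro ballI hom_induced_id_gen homeomorphic_imp_continuous_map) simp_all
  ultimately show ?thesis by (simp add: homeos_def)
qed

lemma homeos_imp_continuous: "f \<in> homeos X \<Longrightarrow> continuous_map X X f"
  by (simp add: homeos_def homeomorphic_imp_continuous_map)

lemma homeos_acts_trivially:
  "f \<in> homeos X \<Longrightarrow> z \<in> carrier (homology_group 2 X) \<Longrightarrow> hom_induced 2 X {} X {} f z = z"
  unfolding homeos_def orientation_preserving_def by blast

lemma homeos_in_topspace: "f \<in> homeos X \<Longrightarrow> x \<in> topspace X \<Longrightarrow> f x \<in> topspace X"
  using homeos_imp_continuous continuous_map_image_subset_topspace by blast

lemma homeomorphic_map_compose_restrict: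
  assumes "homeomorphic_map X X f" "homeomorphic_map X X g"
  shows "homeomorphic_map X X (compose (topspace X) f g)"
  using homeomorphic_map_eq[OF homeomorphic_map_compose[OF assms(2,1)]]
  by (simp add: compose_def)

lemma homeos_compose:
  assumes f: "f \<in> homeos X" and g: "g \<in> homeos X"
  shows "compose (topspace X) f g \<in> homeos X"
proof -
  have "hom_induced 2 X {} X {} (compose (topspace X) f g) z = z"
    if z: "z \<in> carrier (homology_group 2 X)" for z
  proof -
    have "hom_induced 2 X {} X {} (compose (topspace X) f g) = hom_induced 2 X {} X {} (f \<circ> g)"
      by (rule hom_induced_eq) (simp add: compose_def)
    also have "\<dots> = hom_induced 2 X {} X {} f \<circ> hom_induced 2 X {} X {} g"
      using f g by (intro hom_induced_compose_empty homeos_imp_continuous)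
    finally show ?thesis
      using homeos_acts_trivially[OF f z] homeos_acts_trivially[OF g z] by (metis comp_apply)
  qed
  then have "orientation_preserving X (compose (topspace X) f g)"
    unfolding orientation_preserving_def by blast
  then show ?thesis
    using f g homeomorphic_map_compose_restrict[of X f g] unfolding homeos_def
    by (simp only: mem_Collect_eq compose_extensional simp_thms)
qed

lemma homeos_inverse:
  assumes f: "f \<in> homeos X"
  obtains f' where "f' \<in> homeos X" "compose (topspace X) f' f = (\<lambda>x\<in>topspace X. x)"
proof -
  have "homeomorphic_map X X f" using f by (simp add: homeos_def)
  then obtain h where h: "homeomorphic_maps X X f h"
    using homeomorphic_map_maps by blast
  define f' where "f' = restrict h (topspace X)"
  have hc: "homeomorphic_map X X h" using h homeomorphic_maps_sym homeomorphic_maps_map by blast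
  then have hm: "homeomorphic_map X X f'"
    by (rule homeomorphic_map_eq) (simp add: f'_def)
  have id: "f' (f x) = x" if "x \<in> topspace X" for x
    using h that homeos_in_topspace[OF f] by (simp add: f'_def homeomorphic_maps_def)
  have "hom_induced 2 X {} X {} f' z = z" if z: "z \<in> carrier (homology_group 2 X)" for z
  proof -
    have "hom_induced 2 X {} X {} f' z = hom_induced 2 X {} X {} f' (hom_induced 2 X {} X {} f z)"
      using homeos_acts_trivially[OF f z] by metis
    also have "\<dots> = hom_induced 2 X {} X {} (f' \<circ> f) z"
      using hom_induced_compose_empty[OF homeos_imp_continuous[OF f]
          homeomorphic_imp_continuous_map[OF hm]] by simp
    also have "\<dots> = z"
      using id z continuous_map_compose[OF homeos_imp_continuous[OF f]
          homeomorphic_imp_continuous_map[OF hm]]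
      by (intro hom_induced_id_gen) auto
    finally show ?thesis .
  qed
  then have "orientation_preserving X f'"
    unfolding orientation_preserving_def by blast
  moreover have "f' \<in> extensional (topspace X)" by (simp add: f'_def)
  ultimately have "f' \<in> homeos X"
    using hm unfolding homeos_def by blast
  moreover have "compose (topspace X) f' f = (\<lambda>x\<in>topspace X. x)"
    using id by (auto simp: compose_def)
  ultimately show ?thesis by (rule that)
qed

lemma equiv_isotopy: "equiv (homeos X) (isotopy X)"
proof (rule equivI)
  show "isotopy X \<subseteq> homeos X \<times> homeos X" by (auto simp: isotopy_def)
  show "refl_on (homeos X) (isotopy X)"
    by (auto simp: refl_on_def isotopy_def homeos_imp_continuous homeos_def)
  show "sym (isotopy X)"
    by (auto simp: sym_def isotopy_def intro: homotopic_with_symD)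
  show "trans (isotopy X)"
    by (auto simp: trans_def isotopy_def intro: homotopic_with_trans)
qed

lemma isotopy_compose:
  assumes f: "(f, f') \<in> isotopy X" and g: "(g, g') \<in> isotopy X"
  shows "(compose (topspace X) f g, compose (topspace X) f' g') \<in> isotopy X"
proof -
  let ?P = "homeomorphic_map X X"
  have H: "f \<in> homeos X" "f' \<in> homeos X" "g \<in> homeos X" "g' \<in> homeos X"
    using f g by (auto simp: isotopy_def)
  have r: "homotopic_with ?P X X (compose (topspace X) a b) (a \<circ> b)"
    if "a \<in> homeos X" "b \<in> homeos X" for a b
    using that homeos_compose[OF that]
    by (intro homotopic_with_equal)
      (auto simp: homeos_def compose_def homeomorphic_imp_continuous_map intro: homeomorphic_map_compose)
  have 1: "homotopic_with ?P X X (f \<circ> g) (f \<circ> g')"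
    using g H by (intro homotopic_with_compose_continuous_map_left[where p = ?P])
      (auto simp: isotopy_def homeos_def homeomorphic_imp_continuous_map intro: homeomorphic_map_compose)
  have 2: "homotopic_with ?P X X (f \<circ> g') (f' \<circ> g')"
    using f H by (intro homotopic_with_compose_continuous_map_right[where p = ?P])
      (auto simp: isotopy_def homeos_def homeomorphic_imp_continuous_map intro: homeomorphic_map_compose)
  have "homotopic_with ?P X X (compose (topspace X) f g) (compose (topspace X) f' g')"
    using r[of f g] r[of f' g'] 1 2 H by (meson homotopic_with_trans homotopic_with_symD)
  then show ?thesis
    using H by (simp add: isotopy_def homeos_compose)
qed

lemma mapping_class_mult:
  assumes "f \<in> homeos X" "g \<in> homeos X"
  shows "isotopy X `` {f} \<otimes>\<^bsub>mapping_class_group X\<^esub> isotopy X `` {g}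
         = isotopy X `` {compose (topspace X) f g}"
proof -
  have "isotopy X `` {compose (topspace X) f' g'} = isotopy X `` {compose (topspace X) f g}"
    if "f' \<in> isotopy X `` {f}" "g' \<in> isotopy X `` {g}" for f' g'
    using that isotopy_compose[of f f' X g g'] equiv_class_eq[OF equiv_isotopy] by fastforce
  moreover have "f \<in> isotopy X `` {f}" "g \<in> isotopy X `` {g}"
    using assms equiv_class_self[OF equiv_isotopy] by auto
  ultimately have "(\<Union>f'\<in>isotopy X `` {f}. \<Union>g'\<in>isotopy X `` {g}.
                     isotopy X `` {compose (topspace X) f' g'})
                   = isotopy X `` {compose (topspace X) f g}" by blast
  then show ?thesis unfolding mapping_class_group_def by (simp only: monoid.simps)
qed

lemma group_mapping_class_group: "group (mapping_class_group X)"
proof (rule groupI)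
  let ?M = "mapping_class_group X" and ?c = "\<lambda>f. isotopy X `` {f}"
  have carr: "A \<in> carrier ?M \<longleftrightarrow> (\<exists>f\<in>homeos X. A = ?c f)" for A
    by (auto simp: mapping_class_group_def quotient_def)
  have one: "\<one>\<^bsub>?M\<^esub> = ?c (\<lambda>x\<in>topspace X. x)" by (simp add: mapping_class_group_def)
  show "\<one>\<^bsub>?M\<^esub> \<in> carrier ?M" using carr one homeos_id by blast
  fix A assume "A \<in> carrier ?M"
  then obtain f where f: "f \<in> homeos X" "A = ?c f" using carr by blast
  have "compose (topspace X) (\<lambda>x\<in>topspace X. x) f = f"
    using f(1) by (intro extensionalityI[of _ "topspace X"])
      (auto simp: homeos_def compose_def homeos_in_topspace[OF f(1)])
  then show "\<one>\<^bsub>?M\<^esub> \<otimes>\<^bsub>?M\<^esub> A = A" by (simp add: one f mapping_class_mult homeos_id)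
  obtain f' where "f' \<in> homeos X" "compose (topspace X) f' f = (\<lambda>x\<in>topspace X. x)"
    using homeos_inverse[OF f(1)] .
  then show "\<exists>B\<in>carrier ?M. B \<otimes>\<^bsub>?M\<^esub> A = \<one>\<^bsub>?M\<^esub>"
    using carr one f by (metis mapping_class_mult)
  fix B assume "B \<in> carrier ?M"
  then obtain g where g: "g \<in> homeos X" "B = ?c g" using carr by blast
  show "A \<otimes>\<^bsub>?M\<^esub> B \<in> carrier ?M" using carr f g by (metis mapping_class_mult homeos_compose)
  fix C assume "C \<in> carrier ?M"
  then obtain h where h: "h \<in> homeos X" "C = ?c h" using carr by blast
  have "compose (topspace X) (compose (topspace X) f g) h
      = compose (topspace X) f (compose (topspace X) g h)"
    using homeos_in_topspace[OF h(1)] by (auto simp: compose_def)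
  then show "A \<otimes>\<^bsub>?M\<^esub> B \<otimes>\<^bsub>?M\<^esub> C = A \<otimes>\<^bsub>?M\<^esub> (B \<otimes>\<^bsub>?M\<^esub> C)"
    by (simp add: f g h mapping_class_mult homeos_compose)
qed


section \<open>Homology with coefficients in \<open>\<int>/m\<int>\<close>\<close>

text \<open>
  The homology of the complex \<open>C\<^sub>*(X) \<otimes> \<int>/m\<int> = C\<^sub>*(X) / m C\<^sub>*(X)\<close>. As the library does for relative
  homology, which is the homology of \<open>C\<^sub>*(X) / C\<^sub>*(S)\<close>, cycles and boundaries of the quotient complex
  are represented by their preimages in the integral chain group.
\<close>

definition mod_cycle :: "nat \<Rightarrow> nat \<Rightarrow> 'a topology \<Rightarrow> 'a chain \<Rightarrow> bool" where
  "mod_cycle m p X c \<longleftrightarrow> singular_chain p X c \<and>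
     (\<exists>d. singular_chain (p - 1) X d \<and> chain_boundary p c = frag_cmul (int m) d)"

definition mod_boundary :: "nat \<Rightarrow> nat \<Rightarrow> 'a topology \<Rightarrow> 'a chain \<Rightarrow> bool" where
  "mod_boundary m p X c \<longleftrightarrow>
     (\<exists>d e. singular_chain (Suc p) X d \<and> singular_chain p X e \<and>
            c = chain_boundary (Suc p) d + frag_cmul (int m) e)"

definition mod_cycle_group :: "nat \<Rightarrow> nat \<Rightarrow> 'a topology \<Rightarrow> 'a chain monoid" where
  "mod_cycle_group m p X = subgroup_generated (chain_group p X) (Collect (mod_cycle m p X))"

definition homology_mod :: "nat \<Rightarrow> nat \<Rightarrow> 'a topology \<Rightarrow> 'a chain set monoid" where
  "homology_mod m p X = mod_cycle_group m p X Mod Collect (mod_boundary m p X)"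

text \<open>The union is over equal cosets: it avoids choosing a representative of the class \<open>z\<close>.\<close>

definition hom_induced_mod ::
  "nat \<Rightarrow> nat \<Rightarrow> 'a topology \<Rightarrow> 'b topology \<Rightarrow> ('a \<Rightarrow> 'b) \<Rightarrow> 'a chain set \<Rightarrow> 'b chain set" where
  "hom_induced_mod m p X Y f =
     (\<lambda>z \<in> carrier (homology_mod m p X).
        \<Union>c\<in>z. Collect (mod_boundary m p Y) #>\<^bsub>mod_cycle_group m p Y\<^esub> chain_map p f c)"


section \<open>Congruence subgroups\<close>

text \<open>Isotopic maps induce the same map on homology, so the union is again over equal cosets.\<close>

definition homology_action ::
  "nat \<Rightarrow> 'a topology \<Rightarrow> ('a \<Rightarrow> 'a) set \<Rightarrow> 'a chain set \<Rightarrow> 'a chain set" where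
  "homology_action m X \<Phi> =
     (\<lambda>z \<in> carrier (homology_mod m 1 X). \<Union>f\<in>\<Phi>. hom_induced_mod m 1 X X f z)"

definition congruence_subgroup :: "nat \<Rightarrow> 'a topology \<Rightarrow> ('a \<Rightarrow> 'a) set set" where
  "congruence_subgroup m X =
     kernel (mapping_class_group X) (AutoGroup (homology_mod m 1 X)) (homology_action m X)"

end

theory Submission
  imports Defs "HOL-Analysis.Further_Topology" "HOL-Analysis.Abstract_Topological_Spaces"
begin

text \<open>
  Take the mapping classes that act on \<open>H\<^sub>1(X; \<int>/3)\<close> as \<open>1\<close> or \<open>-1\<close>. They form a normal subgroup. On a handle
  with letters \<open>a\<close>, \<open>b\<close> the map \<open>F\<close> with \<open>a \<mapsto> b a\<close>, \<open>b \<mapsto> a\<close> inverts the commutator, so it is realised, in all handles at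
  once and up to a permutation of them, by a Dehn twist followed by a reflection of the polygon. Its square acts on
  \<open>H\<^sub>1(X; \<int>)\<close> through the matrix \<open>P = ((2, 1), (1, 1))\<close>, which satisfies \<open>P\<^sup>2 = 3 P - 1\<close>. Hence \<open>F\<^sup>2\<close> is not in the
  subgroup while \<open>F\<^sup>4\<close> is, and \<open>F\<^sup>4\<close> acts trivially modulo \<open>m\<close> only for \<open>m = 1\<close>, because \<open>P\<^sup>2 - 1\<close> has an entry \<open>1\<close>.
  The square \<open>F\<^sup>2\<close> preserves the orientation because it is the identity near the centre of the polygon, whose
  complement has no second homology. Classes in \<open>H\<^sub>1(X; \<int>)\<close> are distinguished by the winding numbers of
  \<open>2 * g\<close> circle-valued maps, by a Mayer-Vietoris argument on chains.
\<close>
section \<open>Real-valued cochains\<close>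

text \<open>Neither generators of the mapping class group nor its image in the symplectic group are
  presupposed, so a single explicit homeomorphism has to yield both properness and the escape from
  every level. The modulus 3 is the trace of \<open>P\<close>: a matrix of determinant 1 and trace
  \<open>t\<close> satisfies \<open>P^2 = t P - 1\<close>, which is the scalar -1 modulo
  \<open>t\<close>. Scalars commute with every automorphism, hence normality. The construction is
  carried out in all handles because -1 on one handle and 1 on the others would not be a scalar. The
  reflection enters because \<open>P\<close> is the square of the Fibonacci matrix ((1, 1), (1, 0)),
  whose determinant is -1; accordingly only the square is asked to preserve the orientation. Of the
  first homology two facts enter: a cycle whose winding numbers all vanish bounds, which turns the
  matrix identity into a statement on homology, and one loop has known winding numbers, which
  refutes that a map acts by a sign or trivially. The surface is only given as a quotient, so every
  map and every homotopy is written on a rectangle of polar coordinates and then descended.\<close>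

definition chain_eval :: "('b \<Rightarrow> real) \<Rightarrow> ('b \<Rightarrow>\<^sub>0 int) \<Rightarrow> real" where
  "chain_eval w c = (\<Sum>\<sigma>\<in>Poly_Mapping.keys c. of_int (Poly_Mapping.lookup c \<sigma>) * w \<sigma>)"

lemma chain_eval_superset:
  assumes "finite S" "Poly_Mapping.keys c \<subseteq> S"
  shows "chain_eval w c = (\<Sum>\<sigma>\<in>S. of_int (Poly_Mapping.lookup c \<sigma>) * w \<sigma>)"
  unfolding chain_eval_def using assms
  by (intro sum.mono_neutral_left) (auto simp: in_keys_iff)

lemma chain_eval_add: "chain_eval w (a + b) = chain_eval w a + chain_eval w b"
proof -
  let ?S = "Poly_Mapping.keys a \<union> Poly_Mapping.keys b"
  have "chain_eval w (a + b) = (\<Sum>\<sigma>\<in>?S. of_int (Poly_Mapping.lookup (a + b) \<sigma>) * w \<sigma>)"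
    using keys_add[of a b] by (intro chain_eval_superset) auto
  also have "\<dots> = (\<Sum>\<sigma>\<in>?S. of_int (Poly_Mapping.lookup a \<sigma>) * w \<sigma>)
                 + (\<Sum>\<sigma>\<in>?S. of_int (Poly_Mapping.lookup b \<sigma>) * w \<sigma>)"
    by (simp add: lookup_add distrib_right sum.distrib)
  also have "\<dots> = chain_eval w a + chain_eval w b"
    by (simp add: chain_eval_superset[of ?S])
  finally show ?thesis .
qed

lemma chain_eval_cmul: "chain_eval w (frag_cmul k c) = of_int k * chain_eval w c"
  using chain_eval_superset[of "Poly_Mapping.keys c" "frag_cmul k c" w] keys_cmul[of k c]
  by (simp add: chain_eval_def sum_distrib_left mult.assoc)

lemma chain_eval_minus: "chain_eval w (- c) = - chain_eval w c"
  using chain_eval_cmul[of w "-1" c] by simp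

lemma chain_eval_diff: "chain_eval w (a - b) = chain_eval w a - chain_eval w b"
  using chain_eval_add[of w a "- b"] by (simp add: chain_eval_minus)

lemma chain_eval_0 [simp]: "chain_eval w 0 = 0"
  by (simp add: chain_eval_def)

lemma chain_eval_of [simp]: "chain_eval w (frag_of \<sigma>) = w \<sigma>"
  by (simp add: chain_eval_def)

lemma chain_eval_cong:
  "(\<And>\<sigma>. \<sigma> \<in> Poly_Mapping.keys c \<Longrightarrow> w \<sigma> = w' \<sigma>) \<Longrightarrow> chain_eval w c = chain_eval w' c"
  by (simp add: chain_eval_def)

lemma chain_eval_plus: "chain_eval (\<lambda>\<sigma>. w \<sigma> + w' \<sigma>) c = chain_eval w c + chain_eval w' c"
  by (simp add: chain_eval_def distrib_left sum.distrib)

lemma chain_eval_times: "chain_eval (\<lambda>\<sigma>. a * w \<sigma>) c = a * chain_eval w c"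
  by (simp add: chain_eval_def sum_distrib_left algebra_simps)

lemma chain_eval_uminus: "chain_eval (\<lambda>\<sigma>. - w \<sigma>) c = - chain_eval w c"
  using chain_eval_times[of "-1" w c] by simp

lemma chain_eval_minus_fun: "chain_eval (\<lambda>\<sigma>. w \<sigma> - w' \<sigma>) c = chain_eval w c - chain_eval w' c"
  using chain_eval_plus[of w "\<lambda>\<sigma>. - w' \<sigma>" c] by (simp add: chain_eval_uminus)

lemma chain_eval_chain_map:
  "chain_eval w (chain_map p f c) = chain_eval (\<lambda>\<sigma>. w (simplex_map p f \<sigma>)) c"
proof -
  have "Poly_Mapping.keys c \<subseteq> UNIV" by simp
  then show ?thesis
    by (induction c rule: frag_induction) (simp_all add: chain_map_diff chain_eval_diff)
qed

lemma singular_chain_induct [consumes 1, case_names zero simplex diff]: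
  assumes "singular_chain p X c" "P 0"
    and "\<And>\<sigma>. singular_simplex p X \<sigma> \<Longrightarrow> P (frag_of \<sigma>)"
    and "\<And>a b. P a \<Longrightarrow> P b \<Longrightarrow> P (a - b)"
  shows "P c"
  using assms unfolding singular_chain_def
  by (metis (mono_tags, lifting) frag_induction mem_Collect_eq)

section \<open>Low-dimensional simplices\<close>

definition edge_vec :: "real \<Rightarrow> nat \<Rightarrow> real" where
  "edge_vec s = (\<lambda>i. if i = 0 then 1 - s else if i = 1 then s else 0)"

text \<open>The value at vertex 0, a point of the standard simplex of every dimension. For a
  0-simplex this is all there is; for a constant simplex it recovers the constant.\<close>

definition base_val :: "((nat \<Rightarrow> real) \<Rightarrow> 'a) \<Rightarrow> 'a" where
  "base_val \<tau> = \<tau> (\<lambda>i. if i = 0 then 1 else 0)"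

definition simplex_path :: "((nat \<Rightarrow> real) \<Rightarrow> 'a) \<Rightarrow> real \<Rightarrow> 'a" where
  "simplex_path \<sigma> s = \<sigma> (edge_vec s)"

lemma edge_vec_simplex: "s \<in> {0..1} \<Longrightarrow> edge_vec s \<in> standard_simplex 1"
  by (auto simp: standard_simplex_def edge_vec_def)

lemma simplical_face_edge:
  "simplical_face 0 (\<lambda>i::nat. if i = 0 then 1 else (0::real)) = edge_vec 1"
  "simplical_face 1 (\<lambda>i::nat. if i = 0 then 1 else (0::real)) = edge_vec 0"
  by (auto simp: simplical_face_def edge_vec_def fun_eq_iff)

lemma base_val_face:
  "base_val (singular_face 1 0 \<sigma>) = simplex_path \<sigma> 1"
  "base_val (singular_face 1 1 \<sigma>) = simplex_path \<sigma> 0"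
  using simplical_face_edge
  by (simp_all add: base_val_def singular_face_def simplex_path_def standard_simplex_0)

lemma chain_boundary_1_of:
  "chain_boundary 1 (frag_of \<sigma>) = frag_of (singular_face 1 0 \<sigma>) - frag_of (singular_face 1 1 \<sigma>)"
  by (simp add: chain_boundary_of)

lemma chain_boundary_2_of:
  "chain_boundary 2 (frag_of \<sigma>) =
     frag_of (singular_face 2 0 \<sigma>) - frag_of (singular_face 2 1 \<sigma>) + frag_of (singular_face 2 2 \<sigma>)"
  by (simp add: chain_boundary_of numeral_2_eq_2)

lemma chain_eval_boundary_1_of:
  "chain_eval (\<lambda>\<tau>. w (base_val \<tau>)) (chain_boundary 1 (frag_of \<sigma>))
     = w (simplex_path \<sigma> 1) - w (simplex_path \<sigma> 0)"
  unfolding chain_boundary_1_of chain_eval_diff chain_eval_of base_val_face ..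

lemma simplex_path_map:
  "s \<in> {0..1} \<Longrightarrow> simplex_path (simplex_map 1 f \<sigma>) s = f (simplex_path \<sigma> s)"
  using edge_vec_simplex[of s] by (simp add: simplex_path_def simplex_map_def)

lemma continuous_map_edge_vec:
  "continuous_map (top_of_set {0..1}) (subtopology (powertop_real UNIV) (standard_simplex 1)) edge_vec"
proof -
  have "continuous_map (top_of_set {0..1}) euclideanreal (\<lambda>s. edge_vec s i)" for i
    unfolding edge_vec_def by (cases "i = 0"; cases "i = 1") (auto intro!: continuous_intros)
  then have "continuous_map (top_of_set {0..1}) (powertop_real UNIV) edge_vec"
    by (simp add: continuous_map_componentwise_UNIV)
  then show ?thesis
    using edge_vec_simplex by (auto simp: continuous_map_in_subtopology)
qed

lemma simplex_path_continuous:
  assumes "singular_simplex 1 X \<sigma>"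
  shows "continuous_map (top_of_set {0..1}) X (simplex_path \<sigma>)"
  using continuous_map_compose[OF continuous_map_edge_vec, of X \<sigma>] assms
  by (simp add: singular_simplex_def o_def simplex_path_def[abs_def])

lemma simplex_path_in:
  assumes "singular_simplex 1 X \<sigma>" "s \<in> {0..1}"
  shows "simplex_path \<sigma> s \<in> topspace X"
  using continuous_map_image_subset_topspace[OF simplex_path_continuous[OF assms(1)]] assms(2) by auto

definition path_simplex :: "(real \<Rightarrow> 'a) \<Rightarrow> (nat \<Rightarrow> real) \<Rightarrow> 'a" where
  "path_simplex \<gamma> = restrict (\<lambda>x. \<gamma> (x 1)) (standard_simplex 1)"

lemma simplex_path_path_simplex: "s \<in> {0..1} \<Longrightarrow> simplex_path (path_simplex \<gamma>) s = \<gamma> s"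
  using edge_vec_simplex[of s] by (simp add: simplex_path_def path_simplex_def edge_vec_def)

lemma singular_simplex_path_simplex:
  assumes "pathin X \<gamma>"
  shows "singular_simplex 1 X (path_simplex \<gamma>)"
proof -
  have "continuous_map (subtopology (powertop_real UNIV) (standard_simplex 1)) (top_of_set {0..1}) (\<lambda>x. x 1)"
    by (auto simp: continuous_map_in_subtopology standard_simplex_def
        intro!: continuous_map_from_subtopology continuous_map_product_projection)
  from continuous_map_compose[OF this] assms
  have "continuous_map (subtopology (powertop_real UNIV) (standard_simplex 1)) X (\<lambda>x. \<gamma> (x 1))"
    by (auto simp: pathin_def o_def)
  then show ?thesis
    unfolding singular_simplex_def path_simplex_def
    by (auto intro: continuous_map_eq)
qed

definition const_simplex :: "nat \<Rightarrow> 'a \<Rightarrow> (nat \<Rightarrow> real) \<Rightarrow> 'a" where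
  "const_simplex p x = restrict (\<lambda>_. x) (standard_simplex p)"

lemma singular_simplex_const: "x \<in> topspace X \<Longrightarrow> singular_simplex p X (const_simplex p x)"
  by (auto simp: singular_simplex_def const_simplex_def intro: continuous_map_eq[of _ _ "\<lambda>_. x"])

lemma singular_face_const:
  assumes "1 \<le> p" "k \<le> p"
  shows "singular_face p k (const_simplex p x) = const_simplex (p - 1) x"
  using assms simplical_face_in_standard_simplex[of p k]
  by (auto simp: singular_face_def const_simplex_def fun_eq_iff)

lemma zero_simplex_eq_const:
  assumes "singular_simplex 0 X \<tau>"
  shows "\<tau> = const_simplex 0 (base_val \<tau>)" "base_val \<tau> \<in> topspace X"
proof -
  have "\<tau> \<in> extensional (standard_simplex 0)" using assms by (simp add: singular_simplex_def)
  then show "\<tau> = const_simplex 0 (base_val \<tau>)"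
    by (intro extensionalityI[of _ "standard_simplex 0"])
      (simp_all add: const_simplex_def base_val_def standard_simplex_0)
  show "base_val \<tau> \<in> topspace X"
    using assms by (auto simp: singular_simplex_def base_val_def standard_simplex_0 continuous_map)
qed

lemma face_path_simplex:
  "singular_face 1 0 (path_simplex \<gamma>) = const_simplex 0 (\<gamma> 1)"
  "singular_face 1 1 (path_simplex \<gamma>) = const_simplex 0 (\<gamma> 0)"
proof -
  have "singular_face 1 k f = const_simplex 0 (f (simplical_face k (\<lambda>i. if i = 0 then 1 else 0)))"
    for f :: "(nat \<Rightarrow> real) \<Rightarrow> 'a" and k
    by (rule extensionalityI[of _ "standard_simplex 0"])
      (simp_all add: singular_face_def const_simplex_def standard_simplex_0)
  then show "singular_face 1 0 (path_simplex \<gamma>) = const_simplex 0 (\<gamma> 1)"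
    "singular_face 1 1 (path_simplex \<gamma>) = const_simplex 0 (\<gamma> 0)"
    using simplex_path_path_simplex[of 1 \<gamma>] simplex_path_path_simplex[of 0 \<gamma>]
    by (simp_all only: simplical_face_edge simplex_path_def) simp_all
qed

section \<open>Cutting cycles along open covers\<close>

lemma homologous_rel_iterated_subdivision:
  assumes "singular_relcycle p X S c"
  shows "homologous_rel p X S c ((singular_subdivision p ^^ n) c)"
proof (induction n)
  case (Suc n)
  then show ?case
    by simp (metis homologous_rel_eq assms homologous_rel_singular_subdivision homologous_rel_singular_relcycle)
qed simp

text \<open>Small simplices: iterated subdivision does not change the class of a cycle. The
  splitting comes from excision in \<open>A \<union> B\<close>, the excised set being the part
  outside \<open>A\<close>; this part is closed because \<open>A\<close> is open, and
  \<open>B\<close> is its own interior.\<close>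

lemma cycle_split_open_cover:
  assumes A: "openin X A" and B: "openin X B"
    and c: "singular_relcycle p (subtopology X (A \<union> B)) {} c"
  obtains c1 c2 where "singular_chain p (subtopology X A) c1" "singular_chain p (subtopology X B) c2"
    "homologous_rel p (subtopology X (A \<union> B)) {} c (c1 + c2)"
proof -
  let ?Y = "subtopology X (A \<union> B)"
  have tY: "topspace ?Y = A \<union> B"
    using openin_subset[OF A] openin_subset[OF B] by auto
  have A': "openin ?Y A" and B': "openin ?Y B"
    using openin_subtopology_Int[OF A, of "A \<union> B"] openin_subtopology_Int[OF B, of "A \<union> B"]
    by (simp_all add: Int_absorb2)
  have cl: "?Y closure_of ((A \<union> B) - A) = (A \<union> B) - A"
    using closedin_diff[OF closedin_topspace A'] unfolding tY by (rule closure_of_closedin)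
  have it: "?Y interior_of B = B" using B' by (rule interior_of_openin)
  have ch: "singular_chain p (subtopology ?Y (A \<union> B)) c"
    using c by (simp add: singular_cycle subtopology_subtopology)
  obtain n d e where *: "singular_chain p (subtopology ?Y ((A \<union> B) - ((A \<union> B) - A))) d"
      "singular_chain p (subtopology ?Y B) e" "(singular_subdivision p ^^ n) c = d + e"
  proof (rule excised_chain_exists[OF _ _ ch])
    show "?Y closure_of ((A \<union> B) - A) \<subseteq> ?Y interior_of B" unfolding cl it by blast
    show "B \<subseteq> A \<union> B" by blast
  qed
  have eqs: "(A \<union> B) \<inter> ((A \<union> B) - ((A \<union> B) - A)) = A" "(A \<union> B) \<inter> B = B" by auto
  show ?thesis
  proof
    show "singular_chain p (subtopology X A) d" "singular_chain p (subtopology X B) e"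
      using *(1,2) by (simp_all only: subtopology_subtopology eqs)
    show "homologous_rel p ?Y {} c (d + e)"
      using homologous_rel_iterated_subdivision[OF c, of n] *(3) by simp
  qed
qed

lemma singular_chain_Int:
  "singular_chain p (subtopology X A) c \<Longrightarrow> singular_chain p (subtopology X B) c
     \<Longrightarrow> singular_chain p (subtopology X (A \<inter> B)) c"
  by (auto simp: singular_chain_subtopology)

section \<open>Spaces that retract onto a discrete set\<close>

lemma homotopic_chain_maps:
  assumes "homotopic_with (\<lambda>_. True) X Y f h" "singular_relcycle p X {} c"
  shows "homologous_rel p Y {} (chain_map p f c) (chain_map p h c)"
proof (rule homotopic_imp_homologous_rel_chain_maps[OF _ assms(2)])
  show "homotopic_with (\<lambda>h. h \<in> {} \<rightarrow> {}) X Y f h"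
    using assms(1) by simp
qed

text \<open>A standard simplex is connected, so a continuous map into a discrete space is constant
  on it. Giving the target the discrete topology expresses that \<open>r\<close> is locally
  constant.\<close>

lemma simplex_map_discrete:
  assumes r: "continuous_map Z (discrete_topology UNIV) r" and s: "singular_simplex p Z \<sigma>"
  shows "\<exists>x. simplex_map p r \<sigma> = const_simplex p x \<and> (r ` topspace Z \<subseteq> topspace Z \<longrightarrow> x \<in> topspace Z)"
proof -
  let ?T = "subtopology (powertop_real UNIV) (standard_simplex p)"
  have s': "continuous_map ?T Z \<sigma>" using s by (simp add: singular_simplex_def)
  have cont: "continuous_map ?T (discrete_topology UNIV) (r \<circ> \<sigma>)"
    using s' r by (rule continuous_map_compose)
  have "connectedin ?T (standard_simplex p)"
    using connectedin_standard_simplex by (simp add: connectedin_subtopology)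
  then have "connectedin (discrete_topology UNIV) ((r \<circ> \<sigma>) ` standard_simplex p)"
    by (rule connectedin_continuous_map_image[OF cont])
  moreover obtain v where v: "v \<in> standard_simplex p" using nonempty_standard_simplex by blast
  ultimately have eq: "(r \<circ> \<sigma>) ` standard_simplex p = {r (\<sigma> v)}"
    by (auto simp: connectedin_discrete_topology)
  have "r (\<sigma> u) = r (\<sigma> v)" if "u \<in> standard_simplex p" for u
    using eq that by (metis comp_apply image_eqI singletonD)
  then have "simplex_map p r \<sigma> = const_simplex p (r (\<sigma> v))"
    by (auto simp: simplex_map_def const_simplex_def fun_eq_iff)
  moreover have "\<sigma> v \<in> topspace Z"
    using s' v by (auto simp: continuous_map)
  ultimately show ?thesis by blast
qed

text \<open>On constant simplices this inverts the boundary map from dimension 2 to dimension 1: two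
  of the three equal faces of a constant 2-simplex cancel.\<close>

definition degenerate :: "'a chain \<Rightarrow> 'a chain" where
  "degenerate = frag_extend (\<lambda>\<sigma>. frag_of (const_simplex 2 (base_val \<sigma>)))"

lemma base_val_const: "base_val (const_simplex p x) = x"
  by (simp add: base_val_def const_simplex_def)

lemma chain_boundary_2_const:
  "chain_boundary 2 (frag_of (const_simplex 2 x)) = frag_of (const_simplex 1 x)"
  by (simp add: chain_boundary_2_of singular_face_const)

text \<open>The cycle is homologous to its image under \<open>r\<close>, which consists of constant
  simplices. In dimension 1 these bound the constant 2-simplices at the same points. In dimension 2
  a chain of constant simplices is recovered from its boundary, so a cycle of this kind is the zero
  chain.\<close>

lemma discrete_retract_acyclic:
  assumes hom: "homotopic_with (\<lambda>_. True) Z Z id r"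
    and r: "continuous_map Z (discrete_topology UNIV) r"
    and p: "p = 1 \<or> p = 2" and c: "singular_relcycle p Z {} c"
  shows "singular_relboundary p Z {} c"
proof -
  let ?c = "chain_map p r c"
  have rZ: "continuous_map Z Z r" using hom homotopic_with_imp_continuous_maps by blast
  then have rZ': "r ` topspace Z \<subseteq> topspace Z" by (auto simp: continuous_map)
  have chc: "singular_chain p Z c" using c by (simp add: singular_cycle)
  have "homologous_rel p Z {} (chain_map p id c) ?c"
    by (rule homotopic_chain_maps[OF hom c])
  then have hr: "homologous_rel p Z {} c ?c"
    using chain_map_id_gen[OF chc, of id] by simp
  have cyc: "singular_relcycle p Z {} ?c"
    using singular_relcycle_chain_map[OF c rZ] by simp
  have "singular_relboundary p Z {} ?c"
    using p
  proof
    assume p1: "p = 1"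
    have "chain_boundary 2 (degenerate (chain_map 1 r c)) = chain_map 1 r c \<and>
          singular_chain 2 Z (degenerate (chain_map 1 r c))"
      using chc unfolding p1
    proof (induction c rule: singular_chain_induct)
      case (simplex \<sigma>)
      then obtain x where x: "simplex_map 1 r \<sigma> = const_simplex 1 x" "x \<in> topspace Z"
        using simplex_map_discrete[OF r simplex] rZ' by blast
      then show ?case
        by (simp add: degenerate_def base_val_const chain_boundary_2_const singular_chain_of
            singular_simplex_const)
    next
      case (diff a b)
      then show ?case
        by (simp add: degenerate_def chain_map_diff frag_extend_diff chain_boundary_diff singular_chain_diff)
    qed (simp add: degenerate_def)
    then show ?thesis
      unfolding p1 singular_boundary by (metis Suc_1 One_nat_def)
  next
    assume p2: "p = 2"
    have "degenerate (chain_boundary 2 (chain_map 2 r c)) = chain_map 2 r c"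
      using chc unfolding p2
    proof (induction c rule: singular_chain_induct)
      case (simplex \<sigma>)
      then obtain x where x: "simplex_map 2 r \<sigma> = const_simplex 2 x"
        using simplex_map_discrete[OF r simplex] by blast
      then show ?case
        by (simp add: chain_boundary_2_const degenerate_def base_val_const)
    next
      case (diff a b)
      then show ?case
        by (simp add: degenerate_def chain_map_diff frag_extend_diff chain_boundary_diff)
    qed (simp add: degenerate_def)
    moreover have "chain_boundary 2 (chain_map 2 r c) = 0"
      using cyc p2 by (simp add: singular_cycle)
    ultimately show ?thesis
      by (metis p2 singular_relboundary_0 degenerate_def frag_extend_0)
  qed
  then show ?thesis
    using hr by (metis homologous_rel_def singular_relboundary_add diff_add_cancel)
qed

text \<open>Each point of the chain is joined to its image by a path, and these paths make up
  \<open>d\<close>.\<close>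

lemma zero_chain_retract:
  assumes conn: "\<And>x. x \<in> topspace Z \<Longrightarrow> path_component_of Z (r x) x"
    and b: "singular_chain 0 Z b"
  shows "\<exists>d. singular_chain 1 Z d \<and> chain_boundary 1 d = b - chain_map 0 r b"
  using b
proof (induction b rule: singular_chain_induct)
  case zero
  show ?case by (rule exI[of _ 0]) simp
next
  case (simplex \<tau>)
  let ?x = "base_val \<tau>"
  note \<tau> = zero_simplex_eq_const[OF simplex]
  obtain \<gamma> where \<gamma>: "pathin Z \<gamma>" "\<gamma> 0 = r ?x" "\<gamma> 1 = ?x"
    using conn[OF \<tau>(2)] by (auto simp: path_component_of_def)
  have m: "simplex_map 0 r \<tau> = const_simplex 0 (r ?x)"
    by (subst \<tau>(1)) (auto simp: simplex_map_def const_simplex_def fun_eq_iff)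
  have "chain_boundary 1 (frag_of (path_simplex \<gamma>)) = frag_of \<tau> - chain_map 0 r (frag_of \<tau>)"
    using \<tau>(1) by (simp only: chain_boundary_1_of face_path_simplex \<gamma> chain_map_of m)
  then show ?case
    using singular_simplex_path_simplex[OF \<gamma>(1)] by (metis singular_chain_of)
next
  case (diff a b)
  then obtain d d' where "singular_chain 1 Z d" "chain_boundary 1 d = a - chain_map 0 r a"
    "singular_chain 1 Z d'" "chain_boundary 1 d' = b - chain_map 0 r b" by blast
  then show ?case
    by (intro exI[of _ "d - d'"]) (simp add: singular_chain_diff chain_boundary_diff chain_map_diff)
qed

lemma homotopic_id_path_component:
  assumes "homotopic_with (\<lambda>_. True) Z Z id r" "x \<in> topspace Z"
  shows "path_component_of Z (r x) x"
proof -
  obtain h where h: "continuous_map (prod_topology (top_of_set {0..1::real}) Z) Z h"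
      "\<And>x. h (0, x) = x" "\<And>x. h (1, x) = r x"
    using assms(1) by (auto simp: homotopic_with_def)
  have "continuous_map (top_of_set {0..1}) (prod_topology (top_of_set {0..1::real}) Z) (\<lambda>u. (u, x))"
    using assms(2) by (simp add: continuous_map_pairedI)
  then have "pathin Z (\<lambda>u. h (u, x))"
    using continuous_map_compose[OF _ h(1)] by (auto simp: pathin_def o_def)
  then have "path_component_of Z x (r x)"
    using h unfolding path_component_of_def by metis
  then show ?thesis by (rule path_component_of_sym)
qed

text \<open>The coefficient of the point \<open>y\<close> in the image is the total coefficient of
  the fibre of \<open>r\<close> over \<open>y\<close>, which is what the indicator cochain of the
  fibre measures.\<close>

lemma zero_chain_map_eq_0:
  assumes b: "singular_chain 0 Z b"
    and z: "\<And>y. chain_eval (\<lambda>\<tau>. if r (base_val \<tau>) = y then 1 else 0) b = 0"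
  shows "chain_map 0 r b = 0"
proof -
  let ?k = "\<lambda>y. const_simplex 0 y"
  have inj: "?k x = ?k y \<longleftrightarrow> x = y" for x y :: 'b
    by (metis base_val_const)
  have look: "real_of_int (Poly_Mapping.lookup (chain_map 0 r b) (?k y))
      = chain_eval (\<lambda>\<tau>. if r (base_val \<tau>) = y then 1 else 0) b
      \<and> Poly_Mapping.keys (chain_map 0 r b) \<subseteq> range ?k" for y
    using b
  proof (induction b rule: singular_chain_induct)
    case (simplex \<tau>)
    have m: "simplex_map 0 r \<tau> = ?k (r (base_val \<tau>))"
      by (subst zero_simplex_eq_const(1)[OF simplex]) (auto simp: simplex_map_def const_simplex_def fun_eq_iff)
    show ?case by (auto simp: m inj)
  next
    case (diff a b)
    then show ?case
      using keys_diff[of "chain_map 0 r a" "chain_map 0 r b"]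
      by (auto simp: chain_map_diff chain_eval_diff lookup_minus)
  qed simp
  have "real_of_int (Poly_Mapping.lookup (chain_map 0 r b) (?k y)) = 0" for y
    using conjunct1[OF look[of y]] z[of y] by (rule trans)
  then have "Poly_Mapping.lookup (chain_map 0 r b) (?k y) = 0" for y
    by (simp only: of_int_eq_0_iff)
  then have "?k y \<notin> Poly_Mapping.keys (chain_map 0 r b)" for y
    by (simp add: in_keys_iff)
  then have "Poly_Mapping.keys (chain_map 0 r b) = {}"
    using conjunct2[OF look] by blast
  then show ?thesis by (simp only: keys_eq_empty)
qed

text \<open>Paths inside \<open>S\<close> push the boundary to a single point. Its image there is
  zero because the coefficients of a boundary add up to zero; the chain \<open>c\<close> itself may
  leave \<open>S\<close>.\<close>

lemma zero_chain_bounds_path_connected: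
  assumes Z: "path_connected_space (subtopology X S)" and S: "S \<subseteq> topspace X"
    and c: "singular_chain 1 X c" and b: "singular_chain 0 (subtopology X S) (chain_boundary 1 c)"
  shows "\<exists>d. singular_chain 1 (subtopology X S) d \<and> chain_boundary 1 d = chain_boundary 1 c"
proof (cases "S = {}")
  case True
  then have "chain_boundary 1 c = 0" using b by (simp add: singular_chain_empty)
  then show ?thesis by (metis chain_boundary_0 singular_chain_0)
next
  case False
  then obtain p where p: "p \<in> S" by blast
  have "\<exists>d. singular_chain 1 (subtopology X S) d \<and>
         chain_boundary 1 d = chain_boundary 1 c - chain_map 0 (\<lambda>_. p) (chain_boundary 1 c)"
    using Z S p by (intro zero_chain_retract b)
      (auto simp: path_connected_space_iff_path_component)
  moreover have "chain_map 0 (\<lambda>_. p) (chain_boundary 1 c) = 0"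
    using c
  proof (induction c rule: singular_chain_induct)
    case (simplex \<sigma>)
    have "simplex_map 0 (\<lambda>_. p) \<tau> = const_simplex 0 p" for \<tau> :: "(nat \<Rightarrow> real) \<Rightarrow> 'a"
      by (auto simp: simplex_map_def const_simplex_def fun_eq_iff)
    then show ?case by (simp only: chain_boundary_1_of chain_map_diff chain_map_of) simp
  qed (simp_all add: chain_boundary_diff chain_map_diff)
  ultimately show ?thesis by simp
qed

section \<open>Winding numbers as cocycles\<close>

definition circle_valued :: "'a topology \<Rightarrow> ('a \<Rightarrow> complex) \<Rightarrow> bool" where
  "circle_valued X \<alpha> \<longleftrightarrow> continuous_map X euclidean \<alpha> \<and> (\<forall>x\<in>topspace X. norm (\<alpha> x) = 1)"

definition angle_lift :: "('a \<Rightarrow> complex) \<Rightarrow> (real \<Rightarrow> 'a) \<Rightarrow> (real \<Rightarrow> real) \<Rightarrow> bool" where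
  "angle_lift \<alpha> \<gamma> l \<longleftrightarrow> continuous_on {0..1} l \<and> (\<forall>s\<in>{0..1}. \<alpha> (\<gamma> s) = cis (2 * pi * l s))"

text \<open>The total change of angle along a 1-simplex, counted in full turns. Two lifts differ by
  an integer constant, so the description is unique as soon as a lift exists.\<close>

definition wind :: "('a \<Rightarrow> complex) \<Rightarrow> ((nat \<Rightarrow> real) \<Rightarrow> 'a) \<Rightarrow> real" where
  "wind \<alpha> \<sigma> = (THE d. \<exists>l. angle_lift \<alpha> (simplex_path \<sigma>) l \<and> d = l 1 - l 0)"

lemma cis_eq_imp_int_diff:
  assumes "cis (2 * pi * a) = cis (2 * pi * b)"
  shows "a - b \<in> \<int>"
proof -
  have "cis (2 * pi * (a - b)) = 1"
    using assms by (simp add: algebra_simps flip: cis_divide)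
  then have "cos (2 * pi * (a - b)) = 1" by (simp add: complex_eq_iff)
  then obtain n :: int where "2 * pi * (a - b) = of_int n * 2 * pi"
    using cos_one_2pi_int by auto
  then have "a - b = of_int n" by simp
  then show ?thesis by simp
qed

lemma int_valued_constant:
  fixes h :: "real \<Rightarrow> real"
  assumes "continuous_on {0..1} h" "\<And>s. s \<in> {0..1} \<Longrightarrow> h s \<in> \<int>"
  shows "h 1 = h 0"
proof -
  have "h constant_on {0..1}"
  proof (rule continuous_discrete_range_constant[OF _ assms(1)])
    show "\<exists>e>0. \<forall>y. y \<in> {0..1} \<and> h y \<noteq> h x \<longrightarrow> e \<le> norm (h y - h x)" if "x \<in> {0..1}" for x
    proof (intro exI[of _ 1] conjI allI impI)
      fix y assume y: "y \<in> {0..1} \<and> h y \<noteq> h x"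
      then have "h y - h x \<in> \<int>" "h y - h x \<noteq> 0" using assms(2) that by auto
      then show "1 \<le> norm (h y - h x)" unfolding real_norm_def by (rule Ints_nonzero_abs_ge1)
    qed simp
  qed simp
  then show ?thesis by (auto simp: constant_on_def)
qed

lemma wind_eq:
  assumes l: "angle_lift \<alpha> (simplex_path \<sigma>) l"
  shows "wind \<alpha> \<sigma> = l 1 - l 0"
  unfolding wind_def
proof (rule the_equality)
  show "\<exists>la. angle_lift \<alpha> (simplex_path \<sigma>) la \<and> l 1 - l 0 = la 1 - la 0" using l by blast
next
  fix d assume "\<exists>la. angle_lift \<alpha> (simplex_path \<sigma>) la \<and> d = la 1 - la 0"
  then obtain m where m: "angle_lift \<alpha> (simplex_path \<sigma>) m" "d = m 1 - m 0" by blast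
  have "(\<lambda>s. m s - l s) 1 = (\<lambda>s. m s - l s) 0"
  proof (rule int_valued_constant)
    show "continuous_on {0..1} (\<lambda>s. m s - l s)"
      using l m by (auto simp: angle_lift_def intro: continuous_intros)
    show "m s - l s \<in> \<int>" if "s \<in> {0..1}" for s
      using l m that by (intro cis_eq_imp_int_diff) (auto simp: angle_lift_def)
  qed
  then show "d = l 1 - l 0" using m by simp
qed

text \<open>A convex domain is contractible, so a nowhere vanishing function on it has a continuous
  logarithm; modulus 1 makes the logarithm purely imaginary.\<close>

lemma circle_valued_log:
  fixes f :: "'b::real_normed_vector \<Rightarrow> complex"
  assumes "continuous_on S f" "convex S" "\<And>x. x \<in> S \<Longrightarrow> norm (f x) = 1"
  obtains l :: "'b \<Rightarrow> real" where "continuous_on S l" "\<And>x. x \<in> S \<Longrightarrow> f x = cis (2 * pi * l x)"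
proof -
  obtain h where h: "continuous_on S h" "\<And>x. x \<in> S \<Longrightarrow> f x = exp (h x)"
    using continuous_logarithm_on_contractible[OF assms(1) convex_imp_contractible[OF assms(2)]]
      assms(3) by (metis norm_zero zero_neq_one)
  show ?thesis
  proof
    show "continuous_on S (\<lambda>x. Im (h x) / (2 * pi))"
      using h(1) by (auto intro!: continuous_intros)
    fix x assume x: "x \<in> S"
    then have "exp (Re (h x)) = 1" using assms(3)[OF x] h(2)[OF x] by simp
    then have "Re (h x) = 0" by simp
    then have "exp (h x) = cis (Im (h x))" by (simp add: exp_eq_polar)
    then show "f x = cis (2 * pi * (Im (h x) / (2 * pi)))" using h(2)[OF x] by simp
  qed
qed

lemma angle_lift_exists:
  assumes "circle_valued X \<alpha>" "singular_simplex 1 X \<sigma>"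
  obtains l where "angle_lift \<alpha> (simplex_path \<sigma>) l"
proof -
  have "continuous_map (top_of_set {0..1}) euclidean (\<alpha> \<circ> simplex_path \<sigma>)"
    using assms by (intro continuous_map_compose[OF simplex_path_continuous]) (auto simp: circle_valued_def)
  then have c: "continuous_on {0..1} (\<lambda>s. \<alpha> (simplex_path \<sigma> s))" by (simp add: o_def)
  have n: "norm (\<alpha> (simplex_path \<sigma> s)) = 1" if "s \<in> {0..1}" for s
    using assms simplex_path_in that by (auto simp: circle_valued_def)
  show ?thesis
    using circle_valued_log[OF c convex_real_interval(5) n] that unfolding angle_lift_def by metis
qed

text \<open>The argument of the constant phase \<open>k\<close> is absorbed into the lift. Thus the
  phase may change from simplex to simplex while \<open>w\<close> is one function for all of them,
  and winding becomes the coboundary of \<open>w\<close>.\<close>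

lemma wind_potential:
  assumes "singular_simplex 1 Z \<sigma>" "continuous_map Z euclideanreal w" "norm k = 1"
    and "\<And>s. s \<in> {0..1} \<Longrightarrow> \<alpha> (simplex_path \<sigma> s) = cis (2 * pi * w (simplex_path \<sigma> s)) * k"
  shows "wind \<alpha> \<sigma> = w (simplex_path \<sigma> 1) - w (simplex_path \<sigma> 0)"
proof -
  have k: "k = cis (2 * pi * (Arg k / (2 * pi)))"
  proof -
    have "k \<noteq> 0" "sgn k = k" using assms(3) by (auto simp: sgn_div_norm)
    then show ?thesis by (simp add: cis_Arg)
  qed
  have "continuous_map (top_of_set {0..1}) euclideanreal (w \<circ> simplex_path \<sigma>)"
    using assms by (intro continuous_map_compose[OF simplex_path_continuous]) auto
  then have "angle_lift \<alpha> (simplex_path \<sigma>) (\<lambda>s. w (simplex_path \<sigma> s) + Arg k / (2 * pi))"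
    using assms(4) k by (auto simp: angle_lift_def o_def distrib_left simp flip: cis_mult intro!: continuous_intros)
  from wind_eq[OF this] show ?thesis by simp
qed

lemma wind_mult:
  assumes \<sigma>: "singular_simplex 1 X \<sigma>" and "circle_valued X \<alpha>" "circle_valued X \<beta>"
    and w: "continuous_map X euclideanreal w"
    and eq: "\<And>x. x \<in> topspace X \<Longrightarrow> \<gamma> x = \<alpha> x * \<beta> x * cis (2 * pi * w x)"
  shows "wind \<gamma> \<sigma> = wind \<alpha> \<sigma> + wind \<beta> \<sigma> + (w (simplex_path \<sigma> 1) - w (simplex_path \<sigma> 0))"
proof -
  obtain l m where l: "angle_lift \<alpha> (simplex_path \<sigma>) l" and m: "angle_lift \<beta> (simplex_path \<sigma>) m"
    using angle_lift_exists assms by metis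
  have "continuous_map (top_of_set {0..1}) euclideanreal (w \<circ> simplex_path \<sigma>)"
    using w by (intro continuous_map_compose[OF simplex_path_continuous[OF \<sigma>]]) auto
  then have "angle_lift \<gamma> (simplex_path \<sigma>) (\<lambda>s. l s + m s + w (simplex_path \<sigma> s))"
    using l m eq simplex_path_in[OF \<sigma>]
    by (auto simp: angle_lift_def o_def distrib_left simp flip: cis_mult intro!: continuous_intros)
  from wind_eq[OF this] wind_eq[OF l] wind_eq[OF m] show ?thesis by simp
qed

lemma wind_cong:
  assumes "\<And>s. s \<in> {0..1} \<Longrightarrow> \<alpha> (simplex_path \<sigma> s) = \<beta> (simplex_path \<tau> s)"
  shows "wind \<alpha> \<sigma> = wind \<beta> \<tau>"
proof -
  have "angle_lift \<alpha> (simplex_path \<sigma>) = angle_lift \<beta> (simplex_path \<tau>)"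
    using assms by (auto simp: angle_lift_def fun_eq_iff)
  then show ?thesis by (simp add: wind_def)
qed

text \<open>Barycentric coordinates 1 and 2 serve as plane coordinates: points of a standard simplex
  are functions on the natural numbers, whereas the logarithm is taken on a convex set in a normed
  space.\<close>

definition tri_vec :: "real \<times> real \<Rightarrow> nat \<Rightarrow> real" where
  "tri_vec z = (\<lambda>i. if i = 0 then 1 - fst z - snd z else if i = 1 then fst z else if i = 2 then snd z else 0)"

definition tri :: "(real \<times> real) set" where
  "tri = {z. 0 \<le> fst z \<and> 0 \<le> snd z \<and> fst z + snd z \<le> 1}"

lemma convex_tri: "convex tri"
proof -
  have "tri = {z. inner (-1, 0) z \<le> 0} \<inter> {z. inner (0, -1) z \<le> 0} \<inter> {z. inner (1, 1) z \<le> 1}"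
    by (auto simp: tri_def inner_prod_def)
  moreover have "convex ({z::real \<times> real. inner (-1, 0) z \<le> 0} \<inter> {z. inner (0, -1) z \<le> 0} \<inter> {z. inner (1, 1) z \<le> 1})"
    by (intro convex_Int convex_halfspace_le)
  ultimately show ?thesis by simp
qed

lemma tri_vec_simplex: "z \<in> tri \<Longrightarrow> tri_vec z \<in> standard_simplex 2"
  by (auto simp: standard_simplex_def tri_vec_def tri_def numeral_2_eq_2)

lemma continuous_map_tri_vec:
  "continuous_map (top_of_set tri) (subtopology (powertop_real UNIV) (standard_simplex 2)) tri_vec"
proof -
  have "continuous_map (top_of_set tri) euclideanreal (\<lambda>z. tri_vec z i)" for i
    unfolding tri_vec_def by (cases "i = 0"; cases "i = 1"; cases "i = 2") (auto intro!: continuous_intros)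
  then have "continuous_map (top_of_set tri) (powertop_real UNIV) tri_vec"
    by (simp add: continuous_map_componentwise_UNIV)
  then show ?thesis
    using tri_vec_simplex by (auto simp: continuous_map_in_subtopology)
qed

lemma face_path_2:
  assumes "s \<in> {0..1}"
  shows "simplex_path (singular_face 2 0 \<tau>) s = \<tau> (tri_vec (1 - s, s))"
    "simplex_path (singular_face 2 1 \<tau>) s = \<tau> (tri_vec (0, s))"
    "simplex_path (singular_face 2 2 \<tau>) s = \<tau> (tri_vec (s, 0))"
proof -
  have "simplical_face 0 (edge_vec s) = tri_vec (1 - s, s)"
    "simplical_face 1 (edge_vec s) = tri_vec (0, s)"
    "simplical_face 2 (edge_vec s) = tri_vec (s, 0)"
    by (auto simp: simplical_face_def edge_vec_def tri_vec_def fun_eq_iff)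
  then show "simplex_path (singular_face 2 0 \<tau>) s = \<tau> (tri_vec (1 - s, s))"
    "simplex_path (singular_face 2 1 \<tau>) s = \<tau> (tri_vec (0, s))"
    "simplex_path (singular_face 2 2 \<tau>) s = \<tau> (tri_vec (s, 0))"
    using edge_vec_simplex[OF assms] by (simp_all add: simplex_path_def singular_face_def)
qed

text \<open>One lift on the whole triangle restricts to lifts on its three sides, so the three
  increments cancel.\<close>

lemma wind_boundary_simplex:
  assumes \<alpha>: "circle_valued X \<alpha>" and \<tau>: "singular_simplex 2 X \<tau>"
  shows "chain_eval (wind \<alpha>) (chain_boundary 2 (frag_of \<tau>)) = 0"
proof -
  have c2: "continuous_map (top_of_set tri) X (\<tau> \<circ> tri_vec)"
    using \<tau> by (intro continuous_map_compose[OF continuous_map_tri_vec]) (auto simp: singular_simplex_def)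
  then have "continuous_map (top_of_set tri) euclidean (\<alpha> \<circ> (\<tau> \<circ> tri_vec))"
    using \<alpha> by (intro continuous_map_compose[OF c2]) (auto simp: circle_valued_def)
  then have c: "continuous_on tri (\<lambda>z. \<alpha> (\<tau> (tri_vec z)))" by (simp add: o_def)
  have n: "norm (\<alpha> (\<tau> (tri_vec z))) = 1" if "z \<in> tri" for z
  proof -
    have "(\<tau> \<circ> tri_vec) z \<in> topspace X"
      using continuous_map_image_subset_topspace[OF c2] that by auto
    then show ?thesis using \<alpha> by (simp add: circle_valued_def)
  qed
  obtain l where l: "continuous_on tri l" "\<And>z. z \<in> tri \<Longrightarrow> \<alpha> (\<tau> (tri_vec z)) = cis (2 * pi * l z)"
    using circle_valued_log[OF c convex_tri n] by metis
  have lift: "wind \<alpha> \<sigma> = l (p 1) - l (p 0)"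
    if p: "continuous_on {0..1} p" "p \<in> {0..1} \<rightarrow> tri" "\<And>s. s \<in> {0..1} \<Longrightarrow> simplex_path \<sigma> s = \<tau> (tri_vec (p s))" for \<sigma> p
  proof -
    have "continuous_on {0..1} (l \<circ> p)"
      using p l by (intro continuous_on_compose) (auto intro: continuous_on_subset)
    then have "angle_lift \<alpha> (simplex_path \<sigma>) (l \<circ> p)"
      using p l by (auto simp: angle_lift_def Pi_iff)
    from wind_eq[OF this] show ?thesis by simp
  qed
  have "wind \<alpha> (singular_face 2 0 \<tau>) = l (0, 1) - l (1, 0)"
    by (subst lift[of "\<lambda>s. (1 - s, s)"]) (auto simp: tri_def face_path_2 intro!: continuous_intros)
  moreover have "wind \<alpha> (singular_face 2 1 \<tau>) = l (0, 1) - l (0, 0)"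
    by (subst lift[of "\<lambda>s. (0, s)"]) (auto simp: tri_def face_path_2[simplified] intro!: continuous_intros)
  moreover have "wind \<alpha> (singular_face 2 2 \<tau>) = l (1, 0) - l (0, 0)"
    by (subst lift[of "\<lambda>s. (s, 0)"]) (auto simp: tri_def face_path_2 intro!: continuous_intros)
  ultimately show ?thesis
    by (simp only: chain_boundary_2_of chain_eval_add chain_eval_diff chain_eval_of)
qed

abbreviation winding :: "('a \<Rightarrow> complex) \<Rightarrow> 'a chain \<Rightarrow> real" where
  "winding \<alpha> \<equiv> chain_eval (wind \<alpha>)"

lemma winding_boundary:
  assumes "circle_valued X \<alpha>" "singular_chain 2 X d"
  shows "winding \<alpha> (chain_boundary 2 d) = 0"
  using assms(2)
  by (induction d rule: singular_chain_induct)
    (simp_all add: wind_boundary_simplex[OF assms(1)] chain_boundary_diff chain_eval_diff)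

lemma winding_homologous:
  assumes "circle_valued X \<alpha>" "homologous_rel 1 X {} c c'"
  shows "winding \<alpha> c = winding \<alpha> c'"
proof -
  obtain d where d: "singular_chain 2 X d" "chain_boundary 2 d = c - c'"
    using assms(2) by (auto simp: homologous_rel_def singular_boundary numeral_2_eq_2)
  then show ?thesis using winding_boundary[OF assms(1) d(1)] by (simp add: chain_eval_diff)
qed

lemma winding_chain_map: "winding \<alpha> (chain_map 1 f c) = winding (\<alpha> \<circ> f) c"
  unfolding chain_eval_chain_map
  by (intro chain_eval_cong wind_cong) (metis comp_apply simplex_path_map)

lemma chain_eval_boundary:
  "chain_eval (\<lambda>\<tau>. w (base_val \<tau>)) (chain_boundary 1 c)
     = chain_eval (\<lambda>\<sigma>. w (simplex_path \<sigma> 1) - w (simplex_path \<sigma> 0)) c"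
proof -
  have "Poly_Mapping.keys c \<subseteq> UNIV" by simp
  then show ?thesis
  proof (induction c rule: frag_induction)
    case (one \<sigma>)
    show ?case unfolding chain_eval_boundary_1_of by simp
  qed (simp_all add: chain_boundary_diff chain_eval_diff)
qed

text \<open>Lifts add when maps are multiplied, and the real potential \<open>w\<close> contributes
  a coboundary, which vanishes on a cycle.\<close>

lemma winding_mult:
  assumes c: "singular_relcycle 1 X {} c" and "circle_valued X \<alpha>" "circle_valued X \<beta>"
    and w: "continuous_map X euclideanreal w"
    and eq: "\<And>x. x \<in> topspace X \<Longrightarrow> \<gamma> x = \<alpha> x * \<beta> x * cis (2 * pi * w x)"
  shows "winding \<gamma> c = winding \<alpha> c + winding \<beta> c"
proof -
  have "singular_simplex 1 X \<sigma>" if "\<sigma> \<in> Poly_Mapping.keys c" for \<sigma>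
    using c that by (auto simp: singular_cycle singular_chain_def)
  then have "winding \<gamma> c = chain_eval (\<lambda>\<sigma>. wind \<alpha> \<sigma> + wind \<beta> \<sigma> + (w (simplex_path \<sigma> 1) - w (simplex_path \<sigma> 0))) c"
    using wind_mult[OF _ assms(2,3) w eq] by (intro chain_eval_cong) blast
  also have "\<dots> = winding \<alpha> c + winding \<beta> c + chain_eval (\<lambda>\<tau>. w (base_val \<tau>)) (chain_boundary 1 c)"
    by (simp only: chain_eval_plus chain_eval_boundary)
  finally show ?thesis using c by (simp add: singular_cycle)
qed

lemma winding_potential:
  assumes "singular_chain 1 Z c" "continuous_map Z euclideanreal w"
    and "\<And>\<sigma>. singular_simplex 1 Z \<sigma> \<Longrightarrow> \<exists>k. norm k = 1 \<and>
           (\<forall>s\<in>{0..1}. \<alpha> (simplex_path \<sigma> s) = cis (2 * pi * w (simplex_path \<sigma> s)) * k)"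
  shows "winding \<alpha> c = chain_eval (\<lambda>\<tau>. w (base_val \<tau>)) (chain_boundary 1 c)"
  unfolding chain_eval_boundary
proof (rule chain_eval_cong)
  fix \<sigma> assume "\<sigma> \<in> Poly_Mapping.keys c"
  then have "singular_simplex 1 Z \<sigma>" using assms(1) by (auto simp: singular_chain_def)
  then show "wind \<alpha> \<sigma> = w (simplex_path \<sigma> 1) - w (simplex_path \<sigma> 0)"
    using assms(2,3) wind_potential[of Z \<sigma> w _ \<alpha>] by blast
qed

text \<open>A lift is compared with the branch \<open>a\<close> of the argument, which may be
  discontinuous. At the ends of every simplex they differ by integers, and the coboundary of any
  function of points vanishes on a cycle.\<close>

lemma winding_Ints:
  assumes \<alpha>: "circle_valued X \<alpha>" and c: "singular_relcycle 1 X {} c"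
  shows "winding \<alpha> c \<in> \<int>"
proof -
  define a where "a x = Arg (\<alpha> x) / (2 * pi)" for x
  have a: "\<alpha> x = cis (2 * pi * a x)" if "x \<in> topspace X" for x
  proof -
    have "norm (\<alpha> x) = 1" using \<alpha> that by (simp add: circle_valued_def)
    then have "\<alpha> x \<noteq> 0" "sgn (\<alpha> x) = \<alpha> x" by (auto simp: sgn_div_norm)
    then show ?thesis by (simp add: a_def cis_Arg)
  qed
  have ch: "singular_chain 1 X c" using c by (simp add: singular_cycle)
  then have "winding \<alpha> c - chain_eval (\<lambda>\<sigma>. a (simplex_path \<sigma> 1) - a (simplex_path \<sigma> 0)) c \<in> \<int>"
  proof (induction c rule: singular_chain_induct)
    case (simplex \<sigma>)
    obtain l where l: "angle_lift \<alpha> (simplex_path \<sigma>) l"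
      using angle_lift_exists[OF \<alpha> simplex] .
    have "l s - a (simplex_path \<sigma> s) \<in> \<int>" if "s \<in> {0..1}" for s
      using l a[OF simplex_path_in[OF simplex that]] that
      by (intro cis_eq_imp_int_diff) (simp add: angle_lift_def)
    then have "(l 1 - a (simplex_path \<sigma> 1)) - (l 0 - a (simplex_path \<sigma> 0)) \<in> \<int>"
      by (intro Ints_diff[of "_ - _" "_ - _"]) auto
    moreover have "chain_eval (\<lambda>\<sigma>. a (simplex_path \<sigma> 1) - a (simplex_path \<sigma> 0)) (frag_of \<sigma>)
        = a (simplex_path \<sigma> 1) - a (simplex_path \<sigma> 0)" by simp
    moreover have "(l 1 - a (simplex_path \<sigma> 1)) - (l 0 - a (simplex_path \<sigma> 0))
        = wind \<alpha> \<sigma> - (a (simplex_path \<sigma> 1) - a (simplex_path \<sigma> 0))"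
      using wind_eq[OF l] by simp
    ultimately show ?case by simp
  next
    case (diff x y)
    then show ?case using Ints_diff[OF diff] by (simp add: chain_eval_diff algebra_simps)
  qed simp
  moreover have "chain_eval (\<lambda>\<sigma>. a (simplex_path \<sigma> 1) - a (simplex_path \<sigma> 0)) c = 0"
    using c by (simp add: singular_cycle flip: chain_eval_boundary)
  ultimately show ?thesis by simp
qed

text \<open>For \<open>m > 0\<close> the chain \<open>e\<close> with the factor \<open>m\<close> is
  itself a cycle, since \<open>m\<close> times its boundary is zero and chain groups are
  torsion-free. Its winding number is therefore an integer.\<close>

lemma winding_mod_boundary:
  assumes \<alpha>: "circle_valued X \<alpha>" and c: "singular_relcycle 1 X {} c" and b: "mod_boundary m 1 X c"
  shows "\<exists>k::int. winding \<alpha> c = of_int (int m * k)"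
proof -
  obtain d e where d: "singular_chain 2 X d" and e: "singular_chain 1 X e"
    and eq: "c = chain_boundary 2 d + frag_cmul (int m) e"
    using b by (auto simp: mod_boundary_def numeral_2_eq_2)
  have w: "winding \<alpha> c = of_int (int m) * winding \<alpha> e"
    unfolding eq chain_eval_add chain_eval_cmul winding_boundary[OF \<alpha> d] by simp
  show ?thesis
  proof (cases "m = 0")
    case False
    have "chain_boundary 1 (chain_boundary 2 d) = 0"
      using chain_boundary_boundary_alt[of 1 X d] d by (simp add: numeral_2_eq_2)
    then have "frag_cmul (int m) (chain_boundary 1 e) = 0"
      using c by (simp add: eq singular_cycle chain_boundary_add chain_boundary_cmul)
    then have "chain_boundary 1 e = 0" using False by simp
    then have "winding \<alpha> e \<in> \<int>" using e by (intro winding_Ints[OF \<alpha>]) (simp add: singular_cycle)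
    then show ?thesis using w by (auto elim!: Ints_cases)
  qed (use w in auto)
qed

section \<open>The polygon in polar coordinates\<close>

text \<open>The product of a quotient map with the identity of a locally compact Hausdorff space,
  here the unit interval, is again a quotient map. So a homotopy descends as soon as each of its
  stages respects the fibres.\<close>

lemma homotopy_descend:
  assumes p: "quotient_map (top_of_set S) Y p"
    and G: "continuous_map (top_of_set ({0..1::real} \<times> S)) Y' G"
    and fib: "\<And>u x y. u \<in> {0..1} \<Longrightarrow> x \<in> S \<Longrightarrow> y \<in> S \<Longrightarrow> p x = p y \<Longrightarrow> G (u, x) = G (u, y)"
  obtains f k where "homotopic_with (\<lambda>_. True) Y Y' f k"
    "\<And>x. x \<in> S \<Longrightarrow> f (p x) = G (0, x)" "\<And>x. x \<in> S \<Longrightarrow> k (p x) = G (1, x)"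
proof -
  let ?I = "top_of_set {0..1::real}"
  have lc: "locally_compact_space ?I"
    by (intro compact_imp_locally_compact_space) (simp add: compact_space_subtopology)
  have "Hausdorff_space ?I" by (simp add: Hausdorff_space_subtopology)
  then have qm: "quotient_map (prod_topology ?I (top_of_set S)) (prod_topology ?I Y) (\<lambda>(u, x). (u, p x))"
    using lc p by (intro quotient_map_prod_right) auto
  have "continuous_map (prod_topology ?I (top_of_set S)) Y' G"
    using G by simp
  then obtain h where h: "continuous_map (prod_topology ?I Y) Y' h"
    "\<And>z. z \<in> {0..1} \<times> S \<Longrightarrow> h ((\<lambda>(u, x). (u, p x)) z) = G z"
  proof (rule quotient_map_lift_exists[OF qm])
    fix z z'
    assume *: "z \<in> topspace (prod_topology ?I (top_of_set S))" "z' \<in> topspace (prod_topology ?I (top_of_set S))"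
      "(case z of (u, x) \<Rightarrow> (u, p x)) = (case z' of (u, x) \<Rightarrow> (u, p x))"
    obtain u x u' x' where z: "z = (u, x)" "z' = (u', x')" by (cases z, cases z')
    have "u \<in> {0..1}" "x \<in> S" "x' \<in> S" "p x = p x'" "u' = u" using * by (simp_all add: z)
    then show "G z = G z'" unfolding z by (simp only:) (rule fib)
  qed auto
  show ?thesis
  proof
    show "homotopic_with (\<lambda>_. True) Y Y' (\<lambda>y. h (0, y)) (\<lambda>y. h (1, y))"
      using h(1) by (auto simp: homotopic_with_def)
    show "h (0, p x) = G (0, x)" "h (1, p x) = G (1, x)" if "x \<in> S" for x
      using h(2)[of "(0, x)"] h(2)[of "(1, x)"] that by auto
  qed
qed

text \<open>\<open>\<Lambda>\<close> is a set of boundary positions and \<open>\<kappa>\<close> contracts each of its components to a point; the periodicity and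
  the symmetry make both compatible with the gluing of the edges.\<close>

definition retraction_rule :: "real set \<Rightarrow> (real \<Rightarrow> real) \<Rightarrow> bool" where
  "retraction_rule \<Lambda> \<kappa> \<longleftrightarrow> open \<Lambda> \<and> (\<forall>t. t + 1 \<in> \<Lambda> \<longleftrightarrow> t \<in> \<Lambda>) \<and> (\<forall>t. - t \<in> \<Lambda> \<longleftrightarrow> t \<in> \<Lambda>) \<and>
     (\<forall>t\<in>\<Lambda>. \<kappa> (t + 1) = \<kappa> t + 1 \<and> \<kappa> (- t) = - \<kappa> t \<and>
       (\<exists>e>0. \<forall>t'. \<bar>t' - t\<bar> < e \<longrightarrow> \<kappa> t' = \<kappa> t) \<and>
       (\<forall>u\<in>{0..1}. (1 - u) * t + u * \<kappa> t \<in> \<Lambda>) \<and> (t \<in> {0..1} \<longrightarrow> \<kappa> t \<in> {0..1}))"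

lemma retraction_ruleD:
  assumes "retraction_rule \<Lambda> \<kappa>"
  shows "open \<Lambda>" "\<And>t. t + 1 \<in> \<Lambda> \<longleftrightarrow> t \<in> \<Lambda>" "\<And>t. - t \<in> \<Lambda> \<longleftrightarrow> t \<in> \<Lambda>"
    "\<And>t. t \<in> \<Lambda> \<Longrightarrow> \<kappa> (t + 1) = \<kappa> t + 1" "\<And>t. t \<in> \<Lambda> \<Longrightarrow> \<kappa> (- t) = - \<kappa> t"
    "\<And>t. t \<in> \<Lambda> \<Longrightarrow> \<exists>e>0. \<forall>t'. \<bar>t' - t\<bar> < e \<longrightarrow> \<kappa> t' = \<kappa> t"
    "\<And>t u. t \<in> \<Lambda> \<Longrightarrow> u \<in> {0..1} \<Longrightarrow> (1 - u) * t + u * \<kappa> t \<in> \<Lambda>"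
    "\<And>t. t \<in> \<Lambda> \<Longrightarrow> t \<in> {0..1} \<Longrightarrow> \<kappa> t \<in> {0..1}"
  using assms unfolding retraction_rule_def by blast+

lemma retraction_rule_shift:
  assumes "retraction_rule \<Lambda> \<kappa>"
  shows "real n + t \<in> \<Lambda> \<longleftrightarrow> t \<in> \<Lambda>" "t \<in> \<Lambda> \<Longrightarrow> \<kappa> (real n + t) = real n + \<kappa> t"
proof -
  have "(real n + t \<in> \<Lambda> \<longleftrightarrow> t \<in> \<Lambda>) \<and> (t \<in> \<Lambda> \<longrightarrow> \<kappa> (real n + t) = real n + \<kappa> t)"
  proof (induction n)
    case (Suc n)
    have "real (Suc n) + t = (real n + t) + 1" by simp
    then show ?case using Suc retraction_ruleD(2,4)[OF assms, of "real n + t"] by (simp add: add_ac)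
  qed simp
  then show "real n + t \<in> \<Lambda> \<longleftrightarrow> t \<in> \<Lambda>" "t \<in> \<Lambda> \<Longrightarrow> \<kappa> (real n + t) = real n + \<kappa> t" by auto
qed

lemma retraction_rule_reflect:
  assumes "retraction_rule \<Lambda> \<kappa>"
  shows "real n - t \<in> \<Lambda> \<longleftrightarrow> t \<in> \<Lambda>" "t \<in> \<Lambda> \<Longrightarrow> \<kappa> (real n - t) = real n - \<kappa> t"
  using retraction_rule_shift[OF assms, where n = n and t = "- t"] retraction_ruleD(3,5)[OF assms, of t] by auto

lemma retraction_rule_continuous:
  assumes "retraction_rule \<Lambda> \<kappa>"
  shows "continuous_on \<Lambda> \<kappa>"
proof -
  have "isCont \<kappa> t" if t: "t \<in> \<Lambda>" for t
  proof -
    obtain e where e: "e > 0" "\<forall>t'. \<bar>t' - t\<bar> < e \<longrightarrow> \<kappa> t' = \<kappa> t"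
      using retraction_ruleD(6)[OF assms t] by blast
    then have "eventually (\<lambda>t'. \<kappa> t' = \<kappa> t) (nhds t)"
      unfolding eventually_nhds_metric dist_real_def by blast
    then show ?thesis by (simp add: isCont_cong)
  qed
  then show ?thesis by (simp add: continuous_at_imp_continuous_on)
qed

locale polygon_surface =
  fixes g :: nat and X :: "'a topology" and q :: "complex \<Rightarrow> 'a"
  assumes g: "1 \<le> g"
    and quot: "quotient_map (top_of_set (cball (0::complex) 1)) X q"
    and ident: "\<And>x y. x \<in> cball 0 1 \<Longrightarrow> y \<in> cball 0 1 \<Longrightarrow> q x = q y \<longleftrightarrow> (x, y) \<in> glued g"
begin

definition polar :: "real \<times> real \<Rightarrow> complex" where
  "polar p = of_real (fst p) * rim_point g (snd p)"

definition Q :: "real \<times> real \<Rightarrow> 'a" where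
  "Q p = q (polar p)"

definition rect :: "(real \<times> real) set" where
  "rect = {0..1} \<times> {0..4 * real g}"

text \<open>Constancy on the fibres of \<open>Q\<close> in generating form: radius 0 is collapsed,
  the positions 0 and \<open>4 * g\<close> are the same radius, and on the rim the edges are paired
  as in \<open>edge_pairing\<close>.\<close>

definition compatible :: "(real \<times> real \<Rightarrow> 'b) \<Rightarrow> bool" where
  "compatible f \<longleftrightarrow> (\<forall>t\<in>{0..4 * real g}. f (0, t) = f (0, 0)) \<and> (\<forall>r\<in>{0..1}. f (r, 4 * real g) = f (r, 0)) \<and>
     (\<forall>i<g. \<forall>s\<in>{0..1}. f (1, 4 * real i + s) = f (1, 4 * real i + 3 - s) \<and>
                        f (1, 4 * real i + 1 + s) = f (1, 4 * real i + 4 - s))"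

lemma compatible_centre: "compatible f \<Longrightarrow> t \<in> {0..4 * real g} \<Longrightarrow> f (0, t) = f (0, 0)"
  unfolding compatible_def by blast

lemma norm_rim_point [simp]: "norm (rim_point g t) = 1"
  by (simp add: rim_point_def)

lemma polar_in_cball: "fst p \<in> {0..1} \<Longrightarrow> polar p \<in> cball 0 1"
  by (simp add: polar_def norm_mult)

lemma continuous_polar: "continuous_on S polar"
  unfolding polar_def rim_point_def using g
  by (intro continuous_intros) auto

lemma rim_point_periodic: "rim_point g (t + 4 * real g) = rim_point g t"
proof -
  have "2 * pi * (t + 4 * real g) / real (4 * g) = 2 * pi * t / real (4 * g) + 2 * pi"
    using g by (simp add: field_simps)
  then have "rim_point g (t + 4 * real g) = cis (2 * pi * t / real (4 * g) + 2 * pi)"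
    by (simp only: rim_point_def)
  also have "\<dots> = rim_point g t" by (simp add: rim_point_def flip: cis_mult)
  finally show ?thesis .
qed

lemma Q_periodic: "Q (r, t + 4 * real g) = Q (r, t)"
  by (simp add: Q_def polar_def rim_point_periodic)

lemma Q_centre: "Q (0, t) = Q (0, t')"
  by (simp add: Q_def polar_def)

lemma Q_glue:
  assumes "i < g" "s \<in> {0..1}"
  shows "Q (1, 4 * real i + s) = Q (1, 4 * real i + 3 - s)"
    "Q (1, 4 * real i + 1 + s) = Q (1, 4 * real i + 4 - s)"
proof -
  have "(rim_point g (4 * real i + s), rim_point g (4 * real i + 3 - s)) \<in> edge_pairing g"
    "(rim_point g (4 * real i + 1 + s), rim_point g (4 * real i + 4 - s)) \<in> edge_pairing g"
    using assms unfolding edge_pairing_def by blast+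
  then have "(rim_point g (4 * real i + s), rim_point g (4 * real i + 3 - s)) \<in> glued g"
    "(rim_point g (4 * real i + 1 + s), rim_point g (4 * real i + 4 - s)) \<in> glued g"
    unfolding glued_def by blast+
  then show "Q (1, 4 * real i + s) = Q (1, 4 * real i + 3 - s)"
    "Q (1, 4 * real i + 1 + s) = Q (1, 4 * real i + 4 - s)"
    by (simp_all add: Q_def polar_def ident)
qed

lemma polar_eq_imp:
  assumes p: "p \<in> rect" "p' \<in> rect" "polar p = polar p'" and f: "compatible f"
  shows "f p = f p'"
proof -
  obtain r t r' t' where eqs: "p = (r, t)" "p' = (r', t')" by (cases p, cases p')
  have b: "0 \<le> r" "r \<le> 1" "0 \<le> r'" "0 \<le> t" "t \<le> 4 * real g" "0 \<le> t'" "t' \<le> 4 * real g"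
    using p by (auto simp: eqs rect_def)
  have "norm (polar p) = norm (polar p')" using p by simp
  then have r: "r' = r" using b by (simp add: polar_def norm_mult eqs)
  show ?thesis
  proof (cases "r = 0")
    case True
    have "f (0, t) = f (0, 0)" "f (0, t') = f (0, 0)" by (rule compatible_centre[OF f]; use b in simp)+
    then show ?thesis by (simp only: eqs r True)
  next
    case False
    then have "rim_point g t = rim_point g t'" using p r by (simp add: polar_def eqs)
    then have "cis (2 * pi * (t / (4 * real g))) = cis (2 * pi * (t' / (4 * real g)))"
      by (simp add: rim_point_def)
    then have "t / (4 * real g) - t' / (4 * real g) \<in> \<int>" by (rule cis_eq_imp_int_diff)
    then obtain n :: int where n: "t / (4 * real g) - t' / (4 * real g) = of_int n" by (rule Ints_cases)
    then have n: "t - t' = of_int n * (4 * real g)" using g by (simp add: field_simps)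
    have "n \<in> {-1, 0, 1}"
    proof -
      have "\<bar>of_int n * (4 * real g)\<bar> \<le> 1 * (4 * real g)" using b n by linarith
      then have "\<bar>real_of_int n\<bar> * (4 * real g) \<le> 1 * (4 * real g)" by (simp add: abs_mult)
      then have "\<bar>real_of_int n\<bar> \<le> 1" using g by (subst (asm) mult_le_cancel_right) auto
      then have "\<bar>n\<bar> \<le> 1" by linarith
      then show ?thesis by auto
    qed
    then consider "t = t'" | "t = 0" "t' = 4 * real g" | "t' = 0" "t = 4 * real g"
      using n b by fastforce
    moreover have "f (r, 4 * real g) = f (r, 0)" using f b unfolding compatible_def by auto
    ultimately show ?thesis by cases (simp_all only: eqs r)
  qed
qed

text \<open>Since \<open>glued\<close> is the closure of the edge pairing, it is enough that the
  function \<open>F\<close> induced on the disc agrees on paired rim points; induction along the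
  closure does the rest.\<close>

lemma compatible_eq:
  assumes f: "compatible f" and p: "p \<in> rect" "p' \<in> rect" "Q p = Q p'"
  shows "f p = f p'"
proof -
  define F where "F z = f (SOME p. p \<in> rect \<and> polar p = z)" for z
  have F: "F (polar p) = f p" if "p \<in> rect" for p
  proof -
    have *: "(SOME p'. p' \<in> rect \<and> polar p' = polar p) \<in> rect \<and> polar (SOME p'. p' \<in> rect \<and> polar p' = polar p) = polar p"
      by (rule someI[of _ p]) (simp only: that simp_thms)
    show ?thesis unfolding F_def
      by (rule polar_eq_imp[OF conjunct1[OF *] that conjunct2[OF *] f])
  qed
  have rim: "rim_point g t = polar (1, t)" for t by (simp add: polar_def)
  have rim_F: "F (rim_point g t) = f (1, t)" if "0 \<le> t" "t \<le> 4 * real g" for t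
    unfolding rim using that by (intro F) (simp add: rect_def)
  have bd: "4 * real i + 4 \<le> 4 * real g" if "i < g" for i
    using that by (simp add: Suc_le_eq flip: of_nat_Suc)
  have pair: "F z = F w" if "(z, w) \<in> edge_pairing g" for z w
    using that f bd unfolding edge_pairing_def compatible_def
    by (fastforce simp: rim_F)
  have "(polar p, polar p') \<in> glued g"
    using p ident[of "polar p" "polar p'"] polar_in_cball by (auto simp: Q_def rect_def)
  then have "F (polar p) = F (polar p')"
    unfolding glued_def
  proof (induction rule: rtrancl_induct)
    case (step y z)
    from step.hyps(2) have "F y = F z" using pair[of y z] pair[of z y] by auto
    then show ?case using step.IH by simp
  qed simp
  then show ?thesis using F p by simp
qed

lemma polar_image: "polar ` rect = cball 0 1"
proof
  show "polar ` rect \<subseteq> cball 0 1" using polar_in_cball by (auto simp: rect_def)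
  show "cball 0 1 \<subseteq> polar ` rect"
  proof
    fix z :: complex assume z: "z \<in> cball 0 1"
    define t where "t = Arg2pi z / (2 * pi) * (4 * real g)"
    have "z = polar (norm z, t)"
      using g Arg2pi[of z] unfolding is_Arg_def by (simp add: polar_def rim_point_def t_def cis_conv_exp)
    moreover have "(norm z, t) \<in> rect"
    proof -
      have "Arg2pi z / (2 * pi) \<le> 1" "0 \<le> Arg2pi z / (2 * pi)" using Arg2pi[of z] by auto
      then have "t \<le> 1 * (4 * real g)" "0 \<le> t" unfolding t_def by (intro mult_right_mono mult_nonneg_nonneg; simp)+
      then show ?thesis using z by (simp add: rect_def)
    qed
    ultimately show "z \<in> polar ` rect" by blast
  qed
qed

text \<open>A continuous surjection from a compact space to a Hausdorff space is closed and hence a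
  quotient map; it is followed by the given quotient of the disc.\<close>

lemma quotient_Q: "quotient_map (top_of_set rect) X Q"
proof -
  have "quotient_map (top_of_set rect) (top_of_set (cball 0 1)) polar"
  proof (rule continuous_closed_imp_quotient_map)
    show "continuous_map (top_of_set rect) (top_of_set (cball 0 1)) polar"
      using polar_image continuous_polar by (auto simp: continuous_map_in_subtopology)
    show "closed_map (top_of_set rect) (top_of_set (cball 0 1)) polar"
    proof (rule continuous_imp_closed_map)
      show "continuous_map (top_of_set rect) (top_of_set (cball 0 1)) polar"
        using polar_image continuous_polar by (auto simp: continuous_map_in_subtopology)
      show "compact_space (top_of_set rect)"
        by (intro compact_space_subtopology) (simp add: rect_def compact_Times)
      show "Hausdorff_space (top_of_set (cball (0::complex) 1))"
        by (simp add: Hausdorff_space_subtopology)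
    qed
    show "polar ` topspace (top_of_set rect) = topspace (top_of_set (cball 0 1))"
      using polar_image by simp
  qed
  from quotient_map_compose[OF this quot] show ?thesis
    by (simp add: o_def Q_def[abs_def])
qed

lemma Q_image: "Q ` rect = topspace X"
  using quotient_imp_surjective_map[OF quotient_Q] by simp

lemma topspace_cases:
  assumes "x \<in> topspace X"
  obtains r t where "0 \<le> r" "r \<le> 1" "0 \<le> t" "t \<le> 4 * real g" "x = Q (r, t)"
  using assms unfolding Q_image[symmetric] rect_def by auto

lemma continuous_map_Q:
  assumes "continuous_on S f" "f \<in> S \<rightarrow> {0..1} \<times> UNIV"
  shows "continuous_map (top_of_set S) X (\<lambda>x. Q (f x))"
proof -
  have "continuous_on S (polar \<circ> f)"
    by (intro continuous_on_compose assms continuous_polar)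
  moreover have "(polar \<circ> f) \<in> S \<rightarrow> cball 0 1"
    using assms(2) polar_in_cball by (force simp: Pi_iff)
  ultimately have "continuous_map (top_of_set S) (top_of_set (cball 0 1)) (polar \<circ> f)"
    by (auto simp: continuous_map_in_subtopology)
  from continuous_map_compose[OF this quotient_imp_continuous_map[OF quot]]
  show ?thesis by (simp add: o_def Q_def)
qed

lemma Q_in_topspace: "r \<in> {0..1} \<Longrightarrow> Q (r, t) \<in> topspace X"
  using continuous_map_image_subset_topspace[OF continuous_map_Q[of UNIV "\<lambda>_::real. (r, t)"]] by auto

lemma map_from_Q:
  assumes "continuous_map (top_of_set rect) Y f" "compatible f"
  obtains h where "continuous_map X Y h" "\<And>p. p \<in> rect \<Longrightarrow> h (Q p) = f p"
proof -
  have f: "f p = f p'" if "p \<in> topspace (top_of_set rect)" "p' \<in> topspace (top_of_set rect)" "Q p = Q p'" for p p'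
    using compatible_eq[OF assms(2), of p p'] that by (simp only: topspace_euclidean_subtopology)
  show ?thesis
  proof (rule quotient_map_lift_exists[OF quotient_Q assms(1)])
    fix x y assume "x \<in> topspace (top_of_set rect)" "y \<in> topspace (top_of_set rect)" "Q x = Q y"
    then show "f x = f y" by (rule f)
  next
    fix h assume "continuous_map X Y h" "\<And>x. x \<in> topspace (top_of_set rect) \<Longrightarrow> h (Q x) = f x"
    then show thesis by (intro that) simp_all
  qed
qed

lemma handle_le: "i < g \<Longrightarrow> 4 * real i + 4 \<le> 4 * real g"
  by (simp add: Suc_le_eq flip: of_nat_Suc)

section \<open>Sectors of the polygon and their retractions to the rim\<close>

definition rectL :: "real set \<Rightarrow> (real \<times> real) set" where
  "rectL \<Lambda> = {p \<in> rect. 0 < fst p \<and> snd p \<in> \<Lambda>}"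

lemma retraction_rule_edges:
  assumes R: "retraction_rule \<Lambda> \<kappa>"
  shows "4 * real g \<in> \<Lambda> \<longleftrightarrow> 0 \<in> \<Lambda>" "4 * real i + s \<in> \<Lambda> \<longleftrightarrow> s \<in> \<Lambda>" "4 * real i + 3 - s \<in> \<Lambda> \<longleftrightarrow> s \<in> \<Lambda>"
    "4 * real i + 1 + s \<in> \<Lambda> \<longleftrightarrow> s \<in> \<Lambda>" "4 * real i + 4 - s \<in> \<Lambda> \<longleftrightarrow> s \<in> \<Lambda>"
    "s \<in> \<Lambda> \<Longrightarrow> \<kappa> (4 * real i + s) = 4 * real i + \<kappa> s" "s \<in> \<Lambda> \<Longrightarrow> \<kappa> (4 * real i + 3 - s) = 4 * real i + 3 - \<kappa> s"
    "s \<in> \<Lambda> \<Longrightarrow> \<kappa> (4 * real i + 1 + s) = 4 * real i + 1 + \<kappa> s" "s \<in> \<Lambda> \<Longrightarrow> \<kappa> (4 * real i + 4 - s) = 4 * real i + 4 - \<kappa> s"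
    "0 \<in> \<Lambda> \<Longrightarrow> \<kappa> 0 = 0" "0 \<in> \<Lambda> \<Longrightarrow> \<kappa> (4 * real g) = 4 * real g"
proof -
  note sh = retraction_rule_shift[OF R] and re = retraction_rule_reflect[OF R]
  show "4 * real g \<in> \<Lambda> \<longleftrightarrow> 0 \<in> \<Lambda>" using sh(1)[where n = "4 * g" and t = 0] by simp
  show "4 * real i + s \<in> \<Lambda> \<longleftrightarrow> s \<in> \<Lambda>" "4 * real i + 3 - s \<in> \<Lambda> \<longleftrightarrow> s \<in> \<Lambda>"
    "4 * real i + 1 + s \<in> \<Lambda> \<longleftrightarrow> s \<in> \<Lambda>" "4 * real i + 4 - s \<in> \<Lambda> \<longleftrightarrow> s \<in> \<Lambda>"
    using sh(1)[where n = "4 * i" and t = s] re(1)[where n = "4 * i + 3" and t = s]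
      sh(1)[where n = "4 * i + 1" and t = s] re(1)[where n = "4 * i + 4" and t = s] by (simp_all add: add_ac)
  show "\<kappa> (4 * real i + s) = 4 * real i + \<kappa> s" "\<kappa> (4 * real i + 3 - s) = 4 * real i + 3 - \<kappa> s"
    "\<kappa> (4 * real i + 1 + s) = 4 * real i + 1 + \<kappa> s" "\<kappa> (4 * real i + 4 - s) = 4 * real i + 4 - \<kappa> s" if "s \<in> \<Lambda>"
    using sh(2)[where n = "4 * i" and t = s] re(2)[where n = "4 * i + 3" and t = s]
      sh(2)[where n = "4 * i + 1" and t = s] re(2)[where n = "4 * i + 4" and t = s] that by (simp_all add: add_ac)
  show "\<kappa> 0 = 0" "\<kappa> (4 * real g) = 4 * real g" if "0 \<in> \<Lambda>"
    using retraction_ruleD(5)[OF R that] sh(2)[where n = "4 * g" and t = 0] that by simp_all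
qed

text \<open>A function on a sector is extended by \<open>undefined\<close> to the whole rectangle,
  so that \<open>compatible_eq\<close> applies to it. The extension respects the gluing because
  membership in the sector does, and the collapsed centre lies outside.\<close>

lemma compatible_rectL:
  assumes R: "retraction_rule \<Lambda> \<kappa>"
    and per: "\<And>r. 0 \<in> \<Lambda> \<Longrightarrow> f (r, 4 * real g) = f (r, 0)"
    and glue: "\<And>i s. i < g \<Longrightarrow> s \<in> {0..1} \<Longrightarrow> s \<in> \<Lambda> \<Longrightarrow> f (1, 4 * real i + s) = f (1, 4 * real i + 3 - s)"
      "\<And>i s. i < g \<Longrightarrow> s \<in> {0..1} \<Longrightarrow> s \<in> \<Lambda> \<Longrightarrow> f (1, 4 * real i + 1 + s) = f (1, 4 * real i + 4 - s)"
  shows "compatible (\<lambda>p. if p \<in> rectL \<Lambda> then f p else undefined)"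
  unfolding compatible_def
proof (intro conjI ballI allI impI)
  fix i s assume i: "i < g" and s: "s \<in> {0..1::real}"
  have "(1, 4 * real i + s) \<in> rectL \<Lambda> \<longleftrightarrow> s \<in> \<Lambda>" "(1, 4 * real i + 3 - s) \<in> rectL \<Lambda> \<longleftrightarrow> s \<in> \<Lambda>"
    "(1, 4 * real i + 1 + s) \<in> rectL \<Lambda> \<longleftrightarrow> s \<in> \<Lambda>" "(1, 4 * real i + 4 - s) \<in> rectL \<Lambda> \<longleftrightarrow> s \<in> \<Lambda>"
    using retraction_rule_edges(2-5)[OF R, of i s] handle_le[OF i] s by (simp_all add: rectL_def rect_def)
  then show "(if (1, 4 * real i + s) \<in> rectL \<Lambda> then f (1, 4 * real i + s) else undefined) =
      (if (1, 4 * real i + 3 - s) \<in> rectL \<Lambda> then f (1, 4 * real i + 3 - s) else undefined)"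
    "(if (1, 4 * real i + 1 + s) \<in> rectL \<Lambda> then f (1, 4 * real i + 1 + s) else undefined) =
      (if (1, 4 * real i + 4 - s) \<in> rectL \<Lambda> then f (1, 4 * real i + 4 - s) else undefined)"
    using glue[OF i s] by simp_all
qed (use retraction_rule_edges(1)[OF R] per in \<open>auto simp: rectL_def rect_def\<close>)

definition region :: "real set \<Rightarrow> 'a set" where
  "region \<Lambda> = Q ` rectL \<Lambda>"

text \<open>Sectors are saturated, because lying in one is itself a compatible predicate.\<close>

lemma region_iff:
  assumes R: "retraction_rule \<Lambda> \<kappa>" and p: "p \<in> rect"
  shows "Q p \<in> region \<Lambda> \<longleftrightarrow> p \<in> rectL \<Lambda>"
proof
  assume "Q p \<in> region \<Lambda>"
  then obtain p' where p': "p' \<in> rectL \<Lambda>" "Q p = Q p'" by (auto simp: region_def)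
  have "compatible (\<lambda>p. 0 < fst p \<and> snd p \<in> \<Lambda>)"
    using retraction_rule_edges(1-5)[OF R] unfolding compatible_def by simp
  from compatible_eq[OF this p _ p'(2)] p' p show "p \<in> rectL \<Lambda>" by (auto simp: rectL_def)
qed (auto simp: region_def)

lemma region_open:
  assumes R: "retraction_rule \<Lambda> \<kappa>"
  shows "openin X (region \<Lambda>)"
proof -
  have sub: "region \<Lambda> \<subseteq> topspace X" using Q_image by (auto simp: region_def rectL_def)
  have "{p \<in> rect. Q p \<in> region \<Lambda>} = rect \<inter> ({0<..} \<times> \<Lambda>)"
    using region_iff[OF R] by (auto simp: rectL_def)
  moreover have "open ({0::real<..} \<times> \<Lambda>)"
    using retraction_ruleD(1)[OF R] by (intro open_Times) auto
  ultimately have "openin (top_of_set rect) {p \<in> rect. Q p \<in> region \<Lambda>}"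
    by (metis openin_open_Int)
  then show ?thesis using quotient_Q sub by (simp add: quotient_map_def)
qed

lemma quotient_region:
  assumes R: "retraction_rule \<Lambda> \<kappa>"
  shows "quotient_map (top_of_set (rectL \<Lambda>)) (subtopology X (region \<Lambda>)) Q"
proof -
  have "quotient_map (subtopology (top_of_set rect) (rectL \<Lambda>)) (subtopology X (region \<Lambda>)) Q"
    using region_iff[OF R] region_open[OF R]
    by (intro quotient_map_restriction[OF quotient_Q]) (auto simp: rectL_def)
  moreover have "rect \<inter> rectL \<Lambda> = rectL \<Lambda>" by (auto simp: rectL_def)
  ultimately show ?thesis by (simp add: subtopology_subtopology)
qed

lemma topspace_region: "topspace (subtopology X (region \<Lambda>)) = region \<Lambda>"
  using Q_image by (auto simp: region_def rectL_def)

text \<open>Sliding towards \<open>\<kappa>\<close> commutes with integer shifts and with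
  reflections of the position, and it stays within one edge. Hence partners on paired edges slide to
  partners.\<close>

lemma compatible_retraction:
  assumes R: "retraction_rule \<Lambda> \<kappa>" and u: "u \<in> {0..1}"
  shows "compatible (\<lambda>p. if p \<in> rectL \<Lambda> then Q ((1 - u) * fst p + u, (1 - u) * snd p + u * \<kappa> (snd p)) else undefined)"
proof (rule compatible_rectL[OF R])
  fix i s assume i: "i < g" and s: "s \<in> {0..1}" "s \<in> \<Lambda>"
  let ?s = "(1 - u) * s + u * \<kappa> s"
  have "?s \<in> {0..1}"
    using retraction_ruleD(8)[OF R s(2,1)] s(1) u convexD_alt[of "{0..1::real}" s "\<kappa> s" u] by simp
  note glue = Q_glue[OF i this]
  have e: "(1 - u) * (4 * real i + s) + u * \<kappa> (4 * real i + s) = 4 * real i + ?s"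
    "(1 - u) * (4 * real i + 3 - s) + u * \<kappa> (4 * real i + 3 - s) = 4 * real i + 3 - ?s"
    "(1 - u) * (4 * real i + 1 + s) + u * \<kappa> (4 * real i + 1 + s) = 4 * real i + 1 + ?s"
    "(1 - u) * (4 * real i + 4 - s) + u * \<kappa> (4 * real i + 4 - s) = 4 * real i + 4 - ?s"
    unfolding retraction_rule_edges(6-9)[OF R s(2)] by (simp_all add: algebra_simps)
  show "Q ((1 - u) * fst (1, 4 * real i + s) + u, (1 - u) * snd (1, 4 * real i + s) + u * \<kappa> (snd (1, 4 * real i + s)))
      = Q ((1 - u) * fst (1, 4 * real i + 3 - s) + u, (1 - u) * snd (1, 4 * real i + 3 - s) + u * \<kappa> (snd (1, 4 * real i + 3 - s)))"
    "Q ((1 - u) * fst (1, 4 * real i + 1 + s) + u, (1 - u) * snd (1, 4 * real i + 1 + s) + u * \<kappa> (snd (1, 4 * real i + 1 + s)))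
      = Q ((1 - u) * fst (1, 4 * real i + 4 - s) + u, (1 - u) * snd (1, 4 * real i + 4 - s) + u * \<kappa> (snd (1, 4 * real i + 4 - s)))"
    unfolding fst_conv snd_conv e using glue by simp_all
next
  fix r assume "0 \<in> \<Lambda>"
  then show "Q ((1 - u) * fst (r, 4 * real g) + u, (1 - u) * snd (r, 4 * real g) + u * \<kappa> (snd (r, 4 * real g)))
      = Q ((1 - u) * fst (r, 0) + u, (1 - u) * snd (r, 0) + u * \<kappa> (snd (r, 0)))"
    using Q_periodic[of "(1 - u) * r + u" 0] retraction_rule_edges(10,11)[OF R] by (simp add: algebra_simps)
qed

text \<open>Points are pushed outwards along the radius while their position slides to
  \<open>\<kappa>\<close>. At the end only the position matters, and it matters in a locally
  constant way.\<close>

lemma region_retract: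
  assumes R: "retraction_rule \<Lambda> \<kappa>"
  obtains r where "homotopic_with (\<lambda>_. True) (subtopology X (region \<Lambda>)) (subtopology X (region \<Lambda>)) id r"
    "continuous_map (subtopology X (region \<Lambda>)) (discrete_topology UNIV) r"
    "\<And>p. p \<in> rectL \<Lambda> \<Longrightarrow> r (Q p) = Q (1, \<kappa> (snd p))"
proof -
  let ?Z = "subtopology X (region \<Lambda>)"
  define H where "H z = ((1 - fst z) * fst (snd z) + fst z,
       (1 - fst z) * snd (snd z) + fst z * \<kappa> (snd (snd z)))" for z :: "real \<times> real \<times> real"
  define G where "G z = Q (H z)" for z
  have k: "continuous_on ({0..1::real} \<times> rectL \<Lambda>) (\<lambda>z. \<kappa> (snd (snd z)))"
    by (rule continuous_on_compose2[OF retraction_rule_continuous[OF R]])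
      (auto simp: rectL_def intro!: continuous_intros)
  have H_cont: "continuous_on ({0..1} \<times> rectL \<Lambda>) H"
    unfolding H_def by (intro continuous_intros k)
  have H_unit: "fst (H z) \<in> {0<..1}" and H_L: "snd (H z) \<in> \<Lambda>" if "z \<in> {0..1} \<times> rectL \<Lambda>" for z
  proof -
    obtain u r t where z: "z = (u, r, t)" by (cases z)
    have b: "0 \<le> u" "u \<le> 1" "0 < r" "r \<le> 1" "t \<in> \<Lambda>" using that by (auto simp: z rectL_def rect_def)
    have "(1 - u) * r + u \<le> (1 - u) * 1 + u" using b by (intro add_right_mono mult_left_mono) auto
    moreover have "0 < (1 - u) * r + u"
      using b by (cases "u = 1") (auto intro!: add_pos_nonneg)
    ultimately show "fst (H z) \<in> {0<..1}" by (simp add: H_def z)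
    show "snd (H z) \<in> \<Lambda>" using retraction_ruleD(7)[OF R b(5)] b by (simp add: H_def z)
  qed
  \<comment> \<open>The slid position is only known to lie in \<open>\<Lambda>\<close>; whole turns
    bring it back into the range of \<open>rect\<close>.\<close>
  have memb: "Q (r, t) \<in> region \<Lambda>" if "0 < r" "r \<le> 1" "t \<in> \<Lambda>" for r t
  proof -
    define n where "n = \<lfloor>t / (4 * real g)\<rfloor>"
    define t' where "t' = t - of_int n * (4 * real g)"
    have "0 \<le> t'" "t' \<le> 4 * real g"
    proof -
      have "of_int n \<le> t / (4 * real g)" "t / (4 * real g) < of_int n + 1" unfolding n_def by linarith+
      then show "0 \<le> t'" "t' \<le> 4 * real g" unfolding t'_def using g by (auto simp: field_simps)
    qed
    have Qn: "Q (r, s + real m * (4 * real g)) = Q (r, s)" for s m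
    proof (induction m)
      case (Suc m)
      have "Q (r, (s + real m * (4 * real g)) + 4 * real g) = Q (r, s)" unfolding Q_periodic by (rule Suc)
      then show ?case by (simp add: algebra_simps)
    qed simp
    have "Q (r, t') = Q (r, t) \<and> t' \<in> \<Lambda>"
    proof (cases "n \<ge> 0")
      case True
      then have e: "t = t' + real (nat n) * (4 * real g)" by (simp add: t'_def)
      then have "t = real (nat n * (4 * g)) + t'" by simp
      then show ?thesis using Qn[of t' "nat n"] retraction_rule_shift(1)[OF R, where n = "nat n * (4 * g)" and t = t'] that(3) e by metis
    next
      case False
      then have e: "t' = t + real (nat (- n)) * (4 * real g)" by (simp add: t'_def)
      then have "t' = real (nat (- n) * (4 * g)) + t" by simp
      then show ?thesis using Qn[of t "nat (- n)"] retraction_rule_shift(1)[OF R, where n = "nat (- n) * (4 * g)" and t = t] that(3) e by metis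
    qed
    then show ?thesis
      using \<open>0 \<le> t'\<close> \<open>t' \<le> 4 * real g\<close> that unfolding region_def
      by (intro image_eqI[of _ _ "(r, t')"]) (auto simp: rectL_def rect_def)
  qed
  have GZ: "continuous_map (top_of_set ({0..1} \<times> rectL \<Lambda>)) ?Z G"
    unfolding continuous_map_in_subtopology
  proof
    show "continuous_map (top_of_set ({0..1} \<times> rectL \<Lambda>)) X G"
      unfolding G_def using H_unit by (intro continuous_map_Q H_cont) (auto simp: mem_Times_iff less_imp_le)
    show "G \<in> topspace (top_of_set ({0..1} \<times> rectL \<Lambda>)) \<rightarrow> region \<Lambda>"
    proof
      fix z assume "z \<in> topspace (top_of_set ({0..1::real} \<times> rectL \<Lambda>))"
      then have "z \<in> {0..1} \<times> rectL \<Lambda>" by simp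
      from H_unit[OF this] H_L[OF this] show "G z \<in> region \<Lambda>"
        using memb[of "fst (H z)" "snd (H z)"] by (simp add: G_def)
    qed
  qed
  have fib: "G (u, x) = G (u, y)" if "u \<in> {0..1}" "x \<in> rectL \<Lambda>" "y \<in> rectL \<Lambda>" "Q x = Q y" for u x y
    using compatible_eq[OF compatible_retraction[OF R that(1)] _ _ that(4)] that
    by (simp add: G_def H_def rectL_def)
  obtain f r where fr: "homotopic_with (\<lambda>_. True) ?Z ?Z f r" "\<And>x. x \<in> rectL \<Lambda> \<Longrightarrow> f (Q x) = G (0, x)"
    "\<And>x. x \<in> rectL \<Lambda> \<Longrightarrow> r (Q x) = G (1, x)"
    using homotopy_descend[OF quotient_region[OF R] GZ fib] by blast
  have f: "f x = x" if "x \<in> region \<Lambda>" for x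
    using that fr(2) by (auto simp: region_def G_def H_def)
  have r: "r (Q p) = Q (1, \<kappa> (snd p))" if "p \<in> rectL \<Lambda>" for p
    using that fr(3) by (simp add: G_def H_def)
  show ?thesis
  proof
    show "homotopic_with (\<lambda>_. True) ?Z ?Z id r"
      using homotopic_with_eq[OF fr(1), of id r] f topspace_region by simp
    show "continuous_map ?Z (discrete_topology UNIV) r"
    proof (rule continuous_compose_quotient_map[OF quotient_region[OF R]])
      show "continuous_map (top_of_set (rectL \<Lambda>)) (discrete_topology UNIV) (r \<circ> Q)"
        unfolding continuous_map_def
      proof (intro conjI allI impI)
        \<comment> \<open>Every subset is open in the discrete topology, so an arbitrary
          \<open>U\<close> has to be pulled back; local constancy of \<open>\<kappa>\<close> makes
          its preimage open.\<close>
        fix U :: "'a set"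
        let ?V = "{t \<in> \<Lambda>. Q (1, \<kappa> t) \<in> U}"
        have "open ?V"
          unfolding open_dist
        proof
          fix t assume t: "t \<in> ?V"
          obtain e where e: "e > 0" "\<forall>t'. \<bar>t' - t\<bar> < e \<longrightarrow> \<kappa> t' = \<kappa> t"
            using retraction_ruleD(6)[OF R, of t] t by blast
          obtain e' where e': "e' > 0" "\<forall>t'. dist t' t < e' \<longrightarrow> t' \<in> \<Lambda>"
            using retraction_ruleD(1)[OF R] t unfolding open_dist by blast
          show "\<exists>e>0. \<forall>y. dist y t < e \<longrightarrow> y \<in> ?V"
          proof (intro exI conjI allI impI)
            show "0 < min e e'" using e e' by simp
            fix y assume y: "dist y t < min e e'"
            then have "\<kappa> y = \<kappa> t" using e(2) by (simp only: dist_real_def min_less_iff_conj)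
            moreover have "y \<in> \<Lambda>" using e'(2) y by (simp only: min_less_iff_conj)
            ultimately show "y \<in> ?V" using t by (simp only: mem_Collect_eq)
          qed
        qed
        then have "open ((UNIV :: real set) \<times> ?V)" by (rule open_Times[OF open_UNIV])
        moreover have "{x \<in> topspace (top_of_set (rectL \<Lambda>)). (r \<circ> Q) x \<in> U} = rectL \<Lambda> \<inter> (UNIV \<times> ?V)"
          using r by (auto simp: rectL_def)
        ultimately show "openin (top_of_set (rectL \<Lambda>)) {x \<in> topspace (top_of_set (rectL \<Lambda>)). (r \<circ> Q) x \<in> U}"
          by (simp only: openin_open_Int)
      qed auto
    qed
  qed (use r in auto)
qed

lemma region_acyclic:
  assumes R: "retraction_rule \<Lambda> \<kappa>" and p: "p = 1 \<or> p = 2"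
    and c: "singular_relcycle p (subtopology X (region \<Lambda>)) {} c"
  shows "singular_relboundary p (subtopology X (region \<Lambda>)) {} c"
proof (rule region_retract[OF R])
  fix r assume "homotopic_with (\<lambda>_. True) (subtopology X (region \<Lambda>)) (subtopology X (region \<Lambda>)) id r"
    "continuous_map (subtopology X (region \<Lambda>)) (discrete_topology UNIV) r"
  then show ?thesis by (rule discrete_retract_acyclic[OF _ _ p c])
qed

end

section \<open>Slit surfaces\<close>

text \<open>\<open>slit 1 0\<close> cuts along the radii to the corners of the polygon, \<open>slit 1 (1/2)\<close> along the radii to the midpoints
  of the edges, and \<open>slit 2 0\<close> along both.\<close>

definition slit :: "nat \<Rightarrow> real \<Rightarrow> real set" where
  "slit c a = {t. real c * t + a \<notin> \<int>}"

text \<open>The midpoint of the component of \<open>slit c a\<close> that contains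
  \<open>t\<close>.\<close>

definition slit_centre :: "nat \<Rightarrow> real \<Rightarrow> real \<Rightarrow> real" where
  "slit_centre c a t = (of_int \<lfloor>real c * t + a\<rfloor> + 1/2 - a) / real c"

lemma between_ints_notin_Ints:
  assumes "of_int n < (y::real)" "y < of_int n + 1"
  shows "y \<notin> \<int>"
  using assms by (auto elim!: Ints_cases)

lemma retraction_rule_slit:
  assumes c: "1 \<le> c" and a: "a = 0 \<or> a = 1/2"
  shows "retraction_rule (slit c a) (slit_centre c a)"
  unfolding retraction_rule_def
proof (intro conjI allI ballI impI)
  have cpos: "real c > 0" using c by simp
  have "slit c a = (\<lambda>t. real c * t + a) -` (- \<int>)" by (auto simp: slit_def)
  then show "open (slit c a)"
    by (simp only:) (intro open_vimage continuous_intros open_Compl closed_Ints)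
  show "t + 1 \<in> slit c a \<longleftrightarrow> t \<in> slit c a" for t
  proof -
    have "real c * (t + 1) + a = (real c * t + a) + of_int (int c)" by (simp add: algebra_simps)
    then show ?thesis unfolding slit_def mem_Collect_eq by (simp only: Ints_of_int add_in_Ints_iff_right)
  qed
  \<comment> \<open>That \<open>2 * a\<close> is an integer is what makes the set of cuts symmetric
    under a change of sign.\<close>
  have "2 * a = of_int 0 \<or> 2 * a = of_int 1" using a by auto
  then obtain m :: int where m: "2 * a = of_int m" by blast
  have neg: "real c * (- t) + a = of_int m - (real c * t + a)" for t using m by simp
  show "- t \<in> slit c a \<longleftrightarrow> t \<in> slit c a" for t
    unfolding slit_def mem_Collect_eq neg using minus_in_Ints_iff[of "real c * t + a"]
    by (metis Ints_diff Ints_of_int diff_diff_eq2 add_diff_cancel_left')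
  fix t assume t: "t \<in> slit c a"
  define y where "y = real c * t + a"
  define n where "n = \<lfloor>y\<rfloor>"
  have y: "y \<notin> \<int>" using t by (simp add: slit_def y_def)
  have ny: "of_int n < y" "y < of_int n + 1"
    using y Ints_of_int[of n] of_int_floor_le[of y] floor_correct[of y] unfolding n_def
    by (auto simp: less_le)
  have k: "slit_centre c a t = (of_int n + 1/2 - a) / real c"
    by (simp add: slit_centre_def n_def y_def)
  have "\<lfloor>real c * (t + 1) + a\<rfloor> = n + int c"
    using ny by (intro floor_unique) (simp_all add: y_def algebra_simps)
  then have "slit_centre c a (t + 1) = (of_int (n + int c) + 1/2 - a) / real c"
    by (simp only: slit_centre_def)
  then show "slit_centre c a (t + 1) = slit_centre c a t + 1"
    using cpos by (simp add: k field_simps)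
  have "\<lfloor>real c * (- t) + a\<rfloor> = m - n - 1"
    unfolding neg using ny by (intro floor_unique) (auto simp: y_def[symmetric])
  then have "slit_centre c a (- t) = (of_int (m - n - 1) + 1/2 - a) / real c"
    by (simp only: slit_centre_def)
  also have "of_int (m - n - 1) + 1/2 - a = - (of_int n + 1/2 - a)" using m by simp
  finally show "slit_centre c a (- t) = - slit_centre c a t" by (simp only: k minus_divide_left)
  show "\<exists>e>0. \<forall>t'. \<bar>t' - t\<bar> < e \<longrightarrow> slit_centre c a t' = slit_centre c a t"
  proof (intro exI conjI allI impI)
    show "0 < min (y - of_int n) (of_int n + 1 - y) / real c" using ny cpos by simp
    fix t' assume "\<bar>t' - t\<bar> < min (y - of_int n) (of_int n + 1 - y) / real c"
    then have "real c * \<bar>t' - t\<bar> < min (y - of_int n) (of_int n + 1 - y)"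
      using cpos by (simp add: pos_less_divide_eq mult.commute)
    then have "\<bar>real c * t' - real c * t\<bar> < min (y - of_int n) (of_int n + 1 - y)"
      using cpos by (simp add: abs_mult flip: right_diff_distrib)
    then have "\<lfloor>real c * t' + a\<rfloor> = n" by (intro floor_unique) (auto simp: y_def)
    then show "slit_centre c a t' = slit_centre c a t"
      unfolding k by (simp only: slit_centre_def)
  qed
  show "(1 - u) * t + u * slit_centre c a t \<in> slit c a" if u: "u \<in> {0..1}" for u
  proof -
    have "real c * ((1 - u) * t + u * slit_centre c a t) + a = (1 - u) * y + u * (of_int n + 1/2)"
      unfolding k y_def using cpos by (simp add: field_simps)
    moreover have "(1 - u) * y + u * (of_int n + 1/2) \<in> {of_int n<..<of_int n + 1}"
      using u ny convexD_alt[of "{of_int n<..<of_int n + 1}" y "of_int n + 1/2" u] by simp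
    ultimately show ?thesis
      using between_ints_notin_Ints[of n] by (simp add: slit_def)
  qed
  show "slit_centre c a t \<in> {0..1}" if "t \<in> {0..1}"
  proof -
    have "real c * t \<le> real c * 1" using that cpos by (intro mult_left_mono) auto
    then have "0 \<le> y" "y \<le> real c + a" using that a by (auto simp: y_def)
    then have "0 < of_int n + (1::real)" "real_of_int n < real_of_int (int c) + a" using ny by auto
    then have "0 \<le> n" "n \<le> int c" "a = 0 \<Longrightarrow> n < int c" using a by linarith+
    then have "0 \<le> of_int n + 1/2 - a" "of_int n + 1/2 - a \<le> real c" using a by linarith+
    then show ?thesis using cpos by (simp add: k)
  qed
qed

lemma slit_rule_round: "retraction_rule (slit 1 (1/2)) (slit_centre 1 (1/2))"
  and slit_rule_edge: "retraction_rule (slit 1 0) (slit_centre 1 0)"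
  and slit_rule_half: "retraction_rule (slit 2 0) (slit_centre 2 0)"
  by (rule retraction_rule_slit; simp)+

lemma slit_Int: "slit 1 (1/2) \<inter> slit 1 0 = slit 2 0"
proof -
  have "2 * t \<in> \<int> \<longleftrightarrow> t \<in> \<int> \<or> t + 1/2 \<in> \<int>" for t :: real
  proof
    assume "2 * t \<in> \<int>"
    then obtain n :: int where n: "2 * t = of_int n" by (rule Ints_cases)
    consider k where "n = 2 * k" | k where "n = 2 * k + 1" by (metis evenE oddE)
    then show "t \<in> \<int> \<or> t + 1/2 \<in> \<int>"
    proof cases
      case 1
      then have "t = of_int k" using n by simp
      then show ?thesis by simp
    next
      case 2
      then have "t + 1/2 = of_int (k + 1)" using n by simp
      then show ?thesis by (metis Ints_of_int)
    qed
  next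
    assume "t \<in> \<int> \<or> t + 1/2 \<in> \<int>"
    then show "2 * t \<in> \<int>"
    proof
      assume "t + 1/2 \<in> \<int>"
      then have "2 * (t + 1/2) - 1 \<in> \<int>" by (intro Ints_diff Ints_mult) auto
      then show ?thesis by (simp add: algebra_simps)
    qed (intro Ints_mult, auto)
  qed
  then show ?thesis by (auto simp: slit_def)
qed

lemma slit_Un: "slit 1 (1/2) \<union> slit 1 0 = UNIV"
proof -
  have "\<not> (t \<in> \<int> \<and> t + 1/2 \<in> \<int>)" for t :: real
  proof
    assume "t \<in> \<int> \<and> t + 1/2 \<in> \<int>"
    then have "(t + 1/2) - t \<in> \<int>" by (intro Ints_diff) auto
    then have "(1/2::real) \<in> \<int>" by simp
    then show False using between_ints_notin_Ints[of 0 "1/2"] by simp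
  qed
  then show ?thesis by (auto simp: slit_def)
qed

lemma slit_centre_bounds:
  assumes R: "retraction_rule \<Lambda> \<kappa>" and t: "t \<in> \<Lambda>" "0 \<le> t" "t \<le> real N"
  shows "0 \<le> \<kappa> t" "\<kappa> t \<le> real N"
proof -
  define n where "n = nat \<lfloor>t\<rfloor>"
  define s where "s = t - real n"
  have tn: "t = real n + s" by (simp add: s_def)
  have "\<lfloor>t\<rfloor> \<ge> 0" using t by simp
  then have "real n = of_int \<lfloor>t\<rfloor>" by (simp add: n_def)
  then have s: "0 \<le> s" "s < 1" unfolding s_def by linarith+
  have sL: "s \<in> \<Lambda>" using retraction_rule_shift(1)[OF R, where n = n and t = s] t tn by simp
  have k: "\<kappa> t = real n + \<kappa> s" using retraction_rule_shift(2)[OF R sL, of n] tn by simp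
  have ks: "\<kappa> s \<in> {0..1}" using retraction_ruleD(8)[OF R sL] s by simp
  show "0 \<le> \<kappa> t" using k ks by simp
  show "\<kappa> t \<le> real N"
  proof (cases "n < N")
    case True
    then have "real n + 1 \<le> real N" by simp
    then show ?thesis using k ks by simp
  next
    case False
    \<comment> \<open>At the right end the unit interval starting at \<open>t\<close> lies outside
      the range, but there \<open>t\<close> is an integer, and \<open>\<kappa>\<close> fixes 0
      because it is odd.\<close>
    then have "s = 0" "n = N" using tn t s by linarith+
    moreover have "\<kappa> 0 = 0" using retraction_ruleD(5)[OF R, of 0] sL \<open>s = 0\<close> by simp
    ultimately show ?thesis using k by simp
  qed
qed

text \<open>Number the half edges; the one at \<open>t\<close> is \<open>8 * i + h\<close>, as a
  handle has eight of them. The three centres are the nearest corner, the midpoint of the edge and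
  the midpoint of the half edge. This turns later statements about jumps into tables with eight
  rows.\<close>

lemma half_slit_cases:
  assumes t: "t \<in> slit 2 0" "0 \<le> t" "t \<le> 4 * real g"
  obtains i h where "i < g" "h < 8"
    "slit_centre 1 (1/2) t = 4 * real i + real ((h + 1) div 2)"
    "slit_centre 1 0 t = 4 * real i + real (h div 2) + 1/2"
    "slit_centre 2 0 t = 4 * real i + real h / 2 + 1/4"
proof -
  define n where "n = nat \<lfloor>2 * t\<rfloor>"
  have nz: "2 * t \<notin> \<int>" using t by (simp add: slit_def)
  have "\<lfloor>2 * t\<rfloor> \<ge> 0" using t by simp
  then have fn: "\<lfloor>2 * t\<rfloor> = int n" by (simp add: n_def)
  then have n: "real n \<le> 2 * t" "2 * t < real n + 1" by linarith+
  have "real n \<noteq> 2 * t" using nz by (metis Ints_of_nat)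
  then have n': "real n < 2 * t" using n by simp
  then have "real n < real (8 * g)" using t by simp
  then have n8: "n < 8 * g" by (simp only: of_nat_less_iff)
  define i where "i = n div 8"
  define h where "h = n mod 8"
  have ih: "n = 8 * i + h" by (simp add: i_def h_def)
  have h8: "h < 8" by (simp add: h_def)
  have "i < g" using n8 ih by simp
  have half: "n div 2 = 4 * i + h div 2" "(n + 1) div 2 = 4 * i + (h + 1) div 2"
    using ih by presburger+
  have k2: "slit_centre 1 0 t = real (n div 2) + 1/2"
  proof -
    have "\<lfloor>t\<rfloor> = int (n div 2)"
    proof (rule floor_unique)
      show "of_int (int (n div 2)) \<le> t" "t < of_int (int (n div 2)) + 1"
        using n by (cases "even n"; auto elim!: evenE oddE)+
    qed
    then show ?thesis by (simp add: slit_centre_def)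
  qed
  have k1: "slit_centre 1 (1/2) t = real ((n + 1) div 2)"
  proof -
    have "\<lfloor>t + 1/2\<rfloor> = int ((n + 1) div 2)"
    proof (rule floor_unique)
      show "of_int (int ((n + 1) div 2)) \<le> t + 1/2" "t + 1/2 < of_int (int ((n + 1) div 2)) + 1"
        using n by (cases "even n"; auto elim!: evenE oddE)+
    qed
    then show ?thesis by (simp add: slit_centre_def)
  qed
  have k3: "slit_centre 2 0 t = real n / 2 + 1/4"
    using fn by (simp add: slit_centre_def)
  show ?thesis
  proof (rule that[OF \<open>i < g\<close> h8])
    show "slit_centre 1 (1/2) t = 4 * real i + real ((h + 1) div 2)" using k1 half(2) by simp
    show "slit_centre 1 0 t = 4 * real i + real (h div 2) + 1/2" using k2 half(1) by simp
    show "slit_centre 2 0 t = 4 * real i + real h / 2 + 1/4" using k3 ih by simp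
  qed
qed

section \<open>The cocycles dual to the edges\<close>

text \<open>The edges with numbers \<open>4 * i\<close> and \<open>4 * i + 1\<close> carry the letters \<open>a\<close> and \<open>b\<close> of handle \<open>i\<close>;
  the edge \<open>j\<close> is glued to the edge \<open>j + 2\<close>, hence a ramp up, a plateau, and a ramp down.\<close>

definition ramp :: "nat \<Rightarrow> real \<Rightarrow> real" where
  "ramp j t = max 0 (min 1 (min (t - real j) (real j + 3 - t)))"

definition letter :: "nat \<Rightarrow> nat \<Rightarrow> bool" where
  "letter g j \<longleftrightarrow> (\<exists>i<g. j = 4 * i \<or> j = 4 * i + 1)"

text \<open>On the pair of edges that carry the letter \<open>j\<close> the ramp takes equal values
  at partners. Of the two edges with the other letter of the same handle, one lies under the plateau
  and the other where the ramp is 0, so partners differ by 1, which \<open>cis\<close> does not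
  see.\<close>

lemma ramp_glue:
  assumes "letter g j" "s \<in> {0..1}"
  shows "ramp j (4 * real i + s) - ramp j (4 * real i + 3 - s) = (if j = 4 * i + 1 then -1 else 0)"
    "ramp j (4 * real i + 1 + s) - ramp j (4 * real i + 4 - s) = (if j = 4 * i then 1 else 0)"
proof -
  obtain i' where j: "j = 4 * i' \<or> j = 4 * i' + 1" using assms(1) by (auto simp: letter_def)
  consider "i' = i" | "real i' + 1 \<le> real i" | "real i + 1 \<le> real i'" by linarith
  then show "ramp j (4 * real i + s) - ramp j (4 * real i + 3 - s) = (if j = 4 * i + 1 then -1 else 0)"
    using j assms(2) by cases (auto simp: ramp_def)
  consider "i' = i" | "real i' + 1 \<le> real i" | "real i + 1 \<le> real i'" by linarith
  then show "ramp j (4 * real i + 1 + s) - ramp j (4 * real i + 4 - s) = (if j = 4 * i then 1 else 0)"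
    using j assms(2) by cases (auto simp: ramp_def)
qed

lemma ramp_ends: "letter g j \<Longrightarrow> ramp j 0 = 0" "letter g j \<Longrightarrow> ramp j (4 * real g) = 0"
proof -
  assume "letter g j"
  then obtain i where "i < g" "j = 4 * i \<or> j = 4 * i + 1" by (auto simp: letter_def)
  moreover from this have "real i + 1 \<le> real g" by simp
  ultimately show "ramp j 0 = 0" "ramp j (4 * real g) = 0" by (auto simp: ramp_def)
qed

lemma continuous_ramp: "continuous_on S (\<lambda>x. ramp j x)"
  unfolding ramp_def by (intro continuous_intros)

text \<open>The jump at a half edge between the potentials on the two slit surfaces.\<close>

definition jump :: "nat \<Rightarrow> real \<Rightarrow> real" where
  "jump j t = ramp j (slit_centre 1 (1/2) t) - ramp j (slit_centre 1 0 t)"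

lemma cis_int: "(x::real) - y \<in> \<int> \<Longrightarrow> cis (2 * pi * x) = cis (2 * pi * y)"
proof -
  assume "x - y \<in> \<int>"
  then obtain n :: int where "x - y = of_int n" by (rule Ints_cases)
  then have "cis (2 * pi * x) = cis (2 * pi * y) * cis (2 * pi * of_int n)"
    by (simp add: algebra_simps cis_mult)
  then show ?thesis by (simp add: cis_multiple_2pi)
qed

context polygon_surface
begin

text \<open>Jumps name half edges up to gluing: a letter with nonzero jump names the edge, and the
  sign names the half, negative for the first and positive for the second. The point
  \<open>real j + 1/2 + jump j t / 2\<close> is the midpoint of that half.\<close>

lemma jump_facts:
  assumes t: "t \<in> slit 2 0" "0 \<le> t" "t \<le> 4 * real g"
  shows "\<exists>j. letter g j \<and> jump j t \<noteq> 0"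
    "letter g j \<Longrightarrow> jump j t \<in> {0, 1/2, -1/2}"
    "letter g j \<Longrightarrow> jump j t \<noteq> 0 \<longleftrightarrow> ramp j (slit_centre 1 0 t) = 1/2"
    "letter g j \<Longrightarrow> ramp j (slit_centre 1 0 t) \<in> {0, 1/2, 1}"
    "letter g j \<Longrightarrow> jump j t \<noteq> 0 \<Longrightarrow> Q (1, slit_centre 2 0 t) = Q (1, real j + 1/2 + jump j t / 2)"
    "jump j (slit_centre 2 0 t) = jump j t"
proof -
  obtain i h where i: "i < g" and h: "h < 8"
    and k: "slit_centre 1 (1/2) t = 4 * real i + real ((h + 1) div 2)"
    "slit_centre 1 0 t = 4 * real i + real (h div 2) + 1/2"
    "slit_centre 2 0 t = 4 * real i + real h / 2 + 1/4"
    using half_slit_cases[OF t] .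
  have hs: "h = 0 \<or> h = 1 \<or> h = 2 \<or> h = 3 \<or> h = 4 \<or> h = 5 \<or> h = 6 \<or> h = 7" using h by linarith
  \<comment> \<open>The rows 0 and 5, 1 and 4, 2 and 7, 3 and 6 belong to glued half edges, and
    their jumps agree.\<close>
  have table: "jump j t = (if j = 4 * i then (if h = 0 \<or> h = 5 then -1/2 else if h = 1 \<or> h = 4 then 1/2 else 0)
        else if j = 4 * i + 1 then (if h = 2 \<or> h = 7 then -1/2 else if h = 3 \<or> h = 6 then 1/2 else 0) else 0)
      \<and> ramp j (slit_centre 1 0 t) = (if j = 4 * i then (if h = 2 \<or> h = 3 then 1 else if h = 6 \<or> h = 7 then 0 else 1/2)
        else if j = 4 * i + 1 then (if h = 0 \<or> h = 1 then 0 else if h = 4 \<or> h = 5 then 1 else 1/2) else 0)"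
    if l: "letter g j" for j
  proof -
    obtain i' where j: "j = 4 * i' \<or> j = 4 * i' + 1" using l by (auto simp: letter_def)
    consider "i' = i" | "real i' + 1 \<le> real i" | "real i + 1 \<le> real i'" by linarith
    then show ?thesis
      unfolding jump_def k using j hs by cases (elim disjE; simp add: ramp_def)+
  qed
  have la: "letter g (4 * i)" "letter g (4 * i + 1)" using i by (auto simp: letter_def)
  show "\<exists>j. letter g j \<and> jump j t \<noteq> 0"
  proof (cases "h = 0 \<or> h = 1 \<or> h = 4 \<or> h = 5")
    case True
    then have "jump (4 * i) t \<noteq> 0" using table[OF la(1)] by auto
    then show ?thesis using la(1) by blast
  next
    case False
    then have "jump (4 * i + 1) t \<noteq> 0" using table[OF la(2)] hs by auto
    then show ?thesis using la(2) by blast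
  qed
  show "jump j t \<in> {0, 1/2, -1/2}" "jump j t \<noteq> 0 \<longleftrightarrow> ramp j (slit_centre 1 0 t) = 1/2"
    "ramp j (slit_centre 1 0 t) \<in> {0, 1/2, 1}" if "letter g j"
    using table[OF that] hs by auto
  show "Q (1, slit_centre 2 0 t) = Q (1, real j + 1/2 + jump j t / 2)" if l: "letter g j" and nz: "jump j t \<noteq> 0"
  proof -
    have e1: "4 * real i + 3 - 1/4 = 4 * real i + 11/4" "4 * real i + 3 - 3/4 = 4 * real i + 9/4"
      "4 * real i + 4 - 1/4 = 4 * real i + 15/4" "4 * real i + 4 - 3/4 = 4 * real i + 13/4"
      "4 * real i + 1 + 1/4 = 4 * real i + 5/4" "4 * real i + 1 + 3/4 = 4 * real i + 7/4" by simp_all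
    have gl: "Q (1, 4 * real i + 11/4) = Q (1, 4 * real i + 1/4)" "Q (1, 4 * real i + 9/4) = Q (1, 4 * real i + 3/4)"
      "Q (1, 4 * real i + 15/4) = Q (1, 4 * real i + 5/4)" "Q (1, 4 * real i + 13/4) = Q (1, 4 * real i + 7/4)"
      using Q_glue[OF i, of "1/4"] Q_glue[OF i, of "3/4"] unfolding e1 by simp_all
    show ?thesis
      using hs
    proof (elim disjE)
    qed (use table[OF l] nz gl in \<open>auto simp: k(3) add_ac split: if_splits\<close>)
  qed
  show "jump j (slit_centre 2 0 t) = jump j t"
  proof -
    have fl: "\<lfloor>4 * real i + x\<rfloor> = 4 * int i + \<lfloor>x\<rfloor>" for x by linarith
    have "slit_centre 1 (1/2) (slit_centre 2 0 t) = slit_centre 1 (1/2) t"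
      "slit_centre 1 0 (slit_centre 2 0 t) = slit_centre 1 0 t"
      unfolding k using hs by (elim disjE; simp add: slit_centre_def add.assoc fl)+
    then show ?thesis by (simp only: jump_def)
  qed
qed

text \<open>The map to the circle dual to the letter \<open>j\<close>: along the rim it goes round
  once on edge \<open>j\<close>, back on the partner edge, and is constant on all other edges. The
  factor \<open>fst p\<close> shrinks it to the constant 1 at the centre.\<close>

definition turn :: "nat \<Rightarrow> 'a \<Rightarrow> complex" where
  "turn j = (SOME h. continuous_map X euclidean h \<and>
     (\<forall>p\<in>rect. h (Q p) = cis (2 * pi * (fst p * ramp j (snd p)))))"

lemma turn:
  assumes j: "letter g j"
  shows "continuous_map X euclidean (turn j)"
    "p \<in> rect \<Longrightarrow> turn j (Q p) = cis (2 * pi * (fst p * ramp j (snd p)))"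
proof -
  let ?f = "\<lambda>p. cis (2 * pi * (fst p * ramp j (snd p)))"
  have cont: "continuous_map (top_of_set rect) euclidean ?f"
    by (simp, intro continuous_intros continuous_on_compose2[OF continuous_ramp[of UNIV j]]) auto
  have comp: "compatible ?f"
    unfolding compatible_def
  proof (intro conjI ballI allI impI)
    fix i s assume "i < g" and s: "s \<in> {0..1::real}"
    have r: "ramp j (4 * real i + s) - ramp j (4 * real i + 3 - s) \<in> \<int>"
      "ramp j (4 * real i + 1 + s) - ramp j (4 * real i + 4 - s) \<in> \<int>"
      unfolding ramp_glue[OF j s] by simp_all
    show "?f (1, 4 * real i + s) = ?f (1, 4 * real i + 3 - s)"
      "?f (1, 4 * real i + 1 + s) = ?f (1, 4 * real i + 4 - s)"
      using cis_int[OF r(1)] cis_int[OF r(2)] by (simp_all only: fst_conv snd_conv mult_1)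
  qed (simp_all add: ramp_ends[OF j])
  have ex: "\<exists>h. continuous_map X euclidean h \<and> (\<forall>p\<in>rect. h (Q p) = ?f p)"
    by (rule map_from_Q[OF cont comp]) blast
  show "continuous_map X euclidean (turn j)"
    unfolding turn_def by (rule someI2_ex[OF ex]) blast
  show "p \<in> rect \<Longrightarrow> turn j (Q p) = ?f p"
    unfolding turn_def by (rule someI2_ex[OF ex]) blast
qed

lemma turn_circle_valued: "letter g j \<Longrightarrow> circle_valued X (turn j)"
  using turn Q_image by (force simp: circle_valued_def)

text \<open>The ramp alone is defined on a sector only up to the integers in
  \<open>ramp_glue\<close>. Its values at \<open>t\<close> and at \<open>\<kappa> t\<close> jump by
  the same integer across a gluing, so the difference is single-valued.\<close>

lemma potential_exists:
  assumes R: "retraction_rule \<Lambda> \<kappa>" and j: "letter g j"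
  obtains w where "continuous_map (subtopology X (region \<Lambda>)) euclideanreal w"
    "\<And>p. p \<in> rectL \<Lambda> \<Longrightarrow> w (Q p) = fst p * ramp j (snd p) - ramp j (\<kappa> (snd p))"
proof -
  let ?f = "\<lambda>p. fst p * ramp j (snd p) - ramp j (\<kappa> (snd p))"
  have "continuous_on (rectL \<Lambda>) (\<lambda>p. \<kappa> (snd p))"
    by (rule continuous_on_compose2[OF retraction_rule_continuous[OF R]])
      (auto simp: rectL_def intro!: continuous_intros)
  then have cont: "continuous_map (top_of_set (rectL \<Lambda>)) euclideanreal ?f"
    by (simp, intro continuous_intros continuous_on_compose2[OF continuous_ramp[of UNIV j]]) auto
  have comp: "compatible (\<lambda>p. if p \<in> rectL \<Lambda> then ?f p else undefined)"
  proof (rule compatible_rectL[OF R])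
    fix i s assume s: "s \<in> {0..1::real}" "s \<in> \<Lambda>"
    have ks: "\<kappa> s \<in> {0..1}" using retraction_ruleD(8)[OF R s(2,1)] .
    show "?f (1, 4 * real i + s) = ?f (1, 4 * real i + 3 - s)"
      "?f (1, 4 * real i + 1 + s) = ?f (1, 4 * real i + 4 - s)"
      using ramp_glue[OF j s(1), of i] ramp_glue[OF j ks, of i]
      unfolding fst_conv snd_conv retraction_rule_edges(6-9)[OF R s(2)] by linarith+
  next
    fix r assume "0 \<in> \<Lambda>"
    then show "?f (r, 4 * real g) = ?f (r, 0)"
      using retraction_rule_edges(10,11)[OF R] by (simp add: ramp_ends[OF j])
  qed
  show ?thesis
  proof (rule quotient_map_lift_exists[OF quotient_region[OF R] cont])
    fix x y assume x: "x \<in> topspace (top_of_set (rectL \<Lambda>))" "y \<in> topspace (top_of_set (rectL \<Lambda>))" and eq: "Q x = Q y"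
    then have m: "x \<in> rectL \<Lambda>" "y \<in> rectL \<Lambda>" by simp_all
    then have "x \<in> rect" "y \<in> rect" by (simp_all add: rectL_def)
    from compatible_eq[OF comp this eq] m show "?f x = ?f y" by (simp only: if_True)
  next
    fix w assume "continuous_map (subtopology X (region \<Lambda>)) euclideanreal w"
      "\<And>x. x \<in> topspace (top_of_set (rectL \<Lambda>)) \<Longrightarrow> w (Q x) = ?f x"
    then show thesis by (intro that) simp_all
  qed
qed

text \<open>On the sector \<open>turn j\<close> is the exponential of \<open>w\<close> times the
  value of \<open>turn j\<close> at the retracted point, and the latter is constant along every
  simplex because the retraction is locally constant.\<close>

lemma winding_region:
  assumes R: "retraction_rule \<Lambda> \<kappa>" and j: "letter g j"
    and w: "continuous_map (subtopology X (region \<Lambda>)) euclideanreal w"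
    "\<And>p. p \<in> rectL \<Lambda> \<Longrightarrow> w (Q p) = fst p * ramp j (snd p) - ramp j (\<kappa> (snd p))"
    and c: "singular_chain 1 (subtopology X (region \<Lambda>)) c"
  shows "winding (turn j) c = chain_eval (\<lambda>\<tau>. w (base_val \<tau>)) (chain_boundary 1 c)"
proof (rule winding_potential[OF c w(1)])
  fix \<sigma> assume \<sigma>: "singular_simplex 1 (subtopology X (region \<Lambda>)) \<sigma>"
  obtain r where r: "continuous_map (subtopology X (region \<Lambda>)) (discrete_topology UNIV) r"
    "\<And>p. p \<in> rectL \<Lambda> \<Longrightarrow> r (Q p) = Q (1, \<kappa> (snd p))"
    using region_retract[OF R] by blast
  obtain x where x: "simplex_map 1 r \<sigma> = const_simplex 1 x"
    using simplex_map_discrete[OF r(1) \<sigma>] by blast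
  have rx: "r (simplex_path \<sigma> s) = x" if "s \<in> {0..1}" for s
    using simplex_path_map[OF that, of r \<sigma>] edge_vec_simplex[OF that] unfolding x
    by (simp add: simplex_path_def const_simplex_def)
  have path: "simplex_path \<sigma> s \<in> region \<Lambda>" if "s \<in> {0..1}" for s
    using simplex_path_in[OF \<sigma> that] topspace_region by simp
  have key: "turn j y = cis (2 * pi * w y) * turn j (r y) \<and> norm (turn j (r y)) = 1" if y: "y \<in> region \<Lambda>" for y
  proof -
    obtain p where p: "p \<in> rectL \<Lambda>" "y = Q p" using y by (auto simp: region_def)
    then have pr: "p \<in> rect" "snd p \<in> \<Lambda>" by (auto simp: rectL_def)
    have "0 \<le> \<kappa> (snd p)" "\<kappa> (snd p) \<le> real (4 * g)"
      using slit_centre_bounds[OF R pr(2), of "4 * g"] pr(1) by (auto simp: rect_def)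
    then have "(1, \<kappa> (snd p)) \<in> rect" by (simp add: rect_def)
    then show ?thesis
      unfolding p(2) r(2)[OF p(1)] w(2)[OF p(1)] turn(2)[OF j pr(1)]
      by (simp add: turn(2)[OF j] cis_mult algebra_simps)
  qed
  show "\<exists>k. norm k = 1 \<and> (\<forall>s\<in>{0..1}. turn j (simplex_path \<sigma> s) = cis (2 * pi * w (simplex_path \<sigma> s)) * k)"
    using key[OF path] rx by (intro exI[of _ "turn j x"]) (metis atLeastAtMost_iff order_refl zero_le_one)
qed

end

section \<open>Homology of the surface\<close>

lemma homologous_to_split_cycle:
  assumes c: "singular_relcycle (Suc p) (subtopology X Y) {} c"
    and c1: "singular_chain (Suc p) (subtopology X A) c1" and c2: "singular_chain (Suc p) (subtopology X B) c2"
    and h: "homologous_rel (Suc p) (subtopology X Y) {} c (c1 + c2)"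
  shows "chain_boundary (Suc p) c1 = - chain_boundary (Suc p) c2"
    "singular_chain p (subtopology X (A \<inter> B)) (chain_boundary (Suc p) c1)"
    "chain_boundary p (chain_boundary (Suc p) c1) = 0"
proof -
  have "singular_relcycle (Suc p) (subtopology X Y) {} (c1 + c2)"
    using c h homologous_rel_singular_relcycle by blast
  then have "chain_boundary (Suc p) c1 + chain_boundary (Suc p) c2 = 0"
    by (simp add: singular_cycle chain_boundary_add)
  then show eq: "chain_boundary (Suc p) c1 = - chain_boundary (Suc p) c2"
    by (simp add: eq_neg_iff_add_eq_0)
  have "singular_chain p (subtopology X A) (chain_boundary (Suc p) c1)"
    using c1 by (rule singular_chain_boundary_alt)
  moreover have "singular_chain p (subtopology X B) (chain_boundary (Suc p) c1)"
    unfolding eq singular_chain_minus using c2 by (rule singular_chain_boundary_alt)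
  ultimately show "singular_chain p (subtopology X (A \<inter> B)) (chain_boundary (Suc p) c1)"
    by (rule singular_chain_Int)
  show "chain_boundary p (chain_boundary (Suc p) c1) = 0"
    using chain_boundary_boundary_alt c1 by blast
qed

text \<open>If \<open>d\<close> in the intersection has the same boundary as \<open>c1\<close>, then
  \<open>c1 - d\<close> and \<open>c2 + d\<close> are cycles in the two acyclic sets, and their sum
  is \<open>c1 + c2\<close>. The hypothesis \<open>common\<close> says that the connecting
  homomorphism kills the class of \<open>c\<close>.\<close>

lemma mayer_vietoris_bounds:
  assumes A: "openin X A" and B: "openin X B"
    and acyc: "\<And>c. singular_relcycle (Suc p) (subtopology X A) {} c \<Longrightarrow> singular_relboundary (Suc p) (subtopology X A) {} c"
      "\<And>c. singular_relcycle (Suc p) (subtopology X B) {} c \<Longrightarrow> singular_relboundary (Suc p) (subtopology X B) {} c"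
    and c: "singular_relcycle (Suc p) (subtopology X (A \<union> B)) {} c"
    and common: "\<And>c1 c2. singular_chain (Suc p) (subtopology X A) c1 \<Longrightarrow> singular_chain (Suc p) (subtopology X B) c2 \<Longrightarrow>
        homologous_rel (Suc p) (subtopology X (A \<union> B)) {} c (c1 + c2) \<Longrightarrow>
        chain_boundary (Suc p) c1 = - chain_boundary (Suc p) c2 \<Longrightarrow>
        singular_chain p (subtopology X (A \<inter> B)) (chain_boundary (Suc p) c1) \<Longrightarrow>
        chain_boundary p (chain_boundary (Suc p) c1) = 0 \<Longrightarrow>
        \<exists>d. singular_chain (Suc p) (subtopology X (A \<inter> B)) d \<and> chain_boundary (Suc p) d = chain_boundary (Suc p) c1"
  shows "singular_relboundary (Suc p) (subtopology X (A \<union> B)) {} c"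
proof -
  obtain c1 c2 where s: "singular_chain (Suc p) (subtopology X A) c1" "singular_chain (Suc p) (subtopology X B) c2"
    "homologous_rel (Suc p) (subtopology X (A \<union> B)) {} c (c1 + c2)"
    by (rule cycle_split_open_cover[OF A B c])
  note b = homologous_to_split_cycle[OF c s]
  obtain d where d: "singular_chain (Suc p) (subtopology X (A \<inter> B)) d" "chain_boundary (Suc p) d = chain_boundary (Suc p) c1"
    using common[OF s b] by blast
  have dA: "singular_chain (Suc p) (subtopology X A) d" and dB: "singular_chain (Suc p) (subtopology X B) d"
    using d(1) singular_chain_mono by blast+
  have "singular_relboundary (Suc p) (subtopology X A) {} (c1 - d)"
    using s(1) dA d(2) by (intro acyc) (simp add: singular_cycle singular_chain_diff chain_boundary_diff)
  moreover have "singular_relboundary (Suc p) (subtopology X B) {} (c2 + d)"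
    using s(2) dB d(2) b(1) by (intro acyc) (simp add: singular_cycle singular_chain_add chain_boundary_add)
  ultimately have "singular_relboundary (Suc p) (subtopology X (A \<union> B)) {} ((c1 - d) + (c2 + d))"
    using singular_relboundary_add singular_boundary_mono by (metis Un_upper1 Un_upper2)
  then have "singular_relboundary (Suc p) (subtopology X (A \<union> B)) {} (c1 + c2)" by simp
  then show ?thesis
    using s(3) by (metis homologous_rel_def singular_relboundary_add diff_add_cancel)
qed

lemma boundary_in_whole:
  "singular_relboundary p (subtopology X S) {} c \<Longrightarrow> singular_relboundary p X {} c"
  using singular_boundary_mono[where T = S and S = UNIV and X = X] by simp

text \<open>A function of a locally constant map has equal values at the two ends of every
  1-simplex.\<close>

lemma eval_locally_constant:
  fixes r :: "'a \<Rightarrow> 'a"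
  assumes r: "continuous_map Z (discrete_topology UNIV) r" and c: "singular_chain 1 Z c"
  shows "chain_eval (\<lambda>\<tau>. v (r (base_val \<tau>))) (chain_boundary 1 c) = 0"
proof -
  have "chain_eval (\<lambda>\<tau>. v (r (base_val \<tau>))) (chain_boundary 1 c)
      = chain_eval (\<lambda>\<sigma>. v (r (simplex_path \<sigma> 1)) - v (r (simplex_path \<sigma> 0))) c"
    by (rule chain_eval_boundary)
  also have "\<dots> = chain_eval (\<lambda>_. 0) c"
  proof (rule chain_eval_cong)
    fix \<sigma> assume "\<sigma> \<in> Poly_Mapping.keys c"
    then have "singular_simplex 1 Z \<sigma>" using c by (auto simp: singular_chain_def)
    then obtain x where x: "simplex_map 1 r \<sigma> = const_simplex 1 x"
      using simplex_map_discrete[OF r] by blast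
    have "r (simplex_path \<sigma> s) = x" if "s \<in> {0..1}" for s
      using simplex_path_map[OF that, of r \<sigma>] edge_vec_simplex[OF that] unfolding x
      by (simp add: simplex_path_def const_simplex_def)
    then show "v (r (simplex_path \<sigma> 1)) - v (r (simplex_path \<sigma> 0)) = 0" by simp
  qed
  also have "\<dots> = 0" by (simp add: chain_eval_def)
  finally show ?thesis .
qed

section \<open>The surface without the centre of the polygon\<close>

context polygon_surface
begin

text \<open>The punctured surface retracts to the graph formed by the rim, with one vertex and
  \<open>2 * g\<close> edges. The set cut at the edge midpoints retracts to the vertex, the set cut
  at the corners to the edge midpoints, and their intersection to one point for each half edge of
  the graph.\<close>

abbreviation edges_slit :: "'a set" where "edges_slit \<equiv> region (slit 1 (1/2))"
abbreviation corners_slit :: "'a set" where "corners_slit \<equiv> region (slit 1 0)"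

definition punctured :: "'a set" where
  "punctured = edges_slit \<union> corners_slit"

lemma punctured_eq: "punctured = Q ` {p \<in> rect. 0 < fst p}"
  using slit_Un by (auto simp: punctured_def region_def rectL_def)

lemma slits_Int: "edges_slit \<inter> corners_slit = region (slit 2 0)"
proof -
  have "Q p \<in> edges_slit \<and> Q p \<in> corners_slit \<longleftrightarrow> Q p \<in> region (slit 2 0)" if "p \<in> rect" for p
    unfolding region_iff[OF slit_rule_round that] region_iff[OF slit_rule_edge that]
      region_iff[OF slit_rule_half that]
    using slit_Int by (simp only: rectL_def mem_Collect_eq Int_iff) blast
  note * = this
  have rng: "\<exists>p\<in>rect. x = Q p" if "x \<in> region \<Lambda>" for x \<Lambda> using that by (auto simp: region_def rectL_def)
  show ?thesis
  proof (rule subset_antisym; rule subsetI)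
    fix x assume x: "x \<in> edges_slit \<inter> corners_slit"
    then obtain p where p: "p \<in> rect" "x = Q p" using rng by blast
    then show "x \<in> region (slit 2 0)" using x *[OF p(1)] by (simp only: Int_iff)
  next
    fix x assume x: "x \<in> region (slit 2 0)"
    then obtain p where p: "p \<in> rect" "x = Q p" using rng by blast
    then show "x \<in> edges_slit \<inter> corners_slit" using x *[OF p(1)] by (simp only: Int_iff)
  qed
qed

lemma punctured_open: "openin X punctured"
  unfolding punctured_def
  by (rule openin_Un[OF region_open[OF slit_rule_round] region_open[OF slit_rule_edge]])

lemma slits_acyclic:
  assumes "p = 0 \<or> p = 1"
  shows "singular_relcycle (Suc p) (subtopology X edges_slit) {} c \<Longrightarrow> singular_relboundary (Suc p) (subtopology X edges_slit) {} c"
    "singular_relcycle (Suc p) (subtopology X corners_slit) {} c \<Longrightarrow> singular_relboundary (Suc p) (subtopology X corners_slit) {} c"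
proof -
  have p: "Suc p = 1 \<or> Suc p = 2" using assms by auto
  show "singular_relcycle (Suc p) (subtopology X edges_slit) {} c \<Longrightarrow> singular_relboundary (Suc p) (subtopology X edges_slit) {} c"
    by (rule region_acyclic[OF slit_rule_round p])
  show "singular_relcycle (Suc p) (subtopology X corners_slit) {} c \<Longrightarrow> singular_relboundary (Suc p) (subtopology X corners_slit) {} c"
    by (rule region_acyclic[OF slit_rule_edge p])
qed

text \<open>The common boundary of the two pieces is a 1-cycle in the half edges, which retract to a
  discrete set, so it bounds there.\<close>

lemma punctured_2_cycle_bounds:
  assumes c: "singular_relcycle 2 (subtopology X punctured) {} c"
  shows "singular_relboundary 2 (subtopology X punctured) {} c"
proof -
  have "singular_relboundary (Suc 1) (subtopology X (edges_slit \<union> corners_slit)) {} c"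
  proof (rule mayer_vietoris_bounds[OF region_open[OF slit_rule_round] region_open[OF slit_rule_edge]])
    show "singular_relcycle (Suc 1) (subtopology X (edges_slit \<union> corners_slit)) {} c"
      using c by (simp add: punctured_def numeral_2_eq_2)
    fix c1 assume "singular_chain 1 (subtopology X (edges_slit \<inter> corners_slit)) (chain_boundary (Suc 1) c1)"
      "chain_boundary 1 (chain_boundary (Suc 1) c1) = 0"
    then have "singular_relcycle 1 (subtopology X (region (slit 2 0))) {} (chain_boundary (Suc 1) c1)"
      unfolding slits_Int by (simp add: singular_cycle)
    from region_acyclic[OF slit_rule_half disjI1[OF refl] this]
    show "\<exists>d. singular_chain (Suc 1) (subtopology X (edges_slit \<inter> corners_slit)) d \<and>
        chain_boundary (Suc 1) d = chain_boundary (Suc 1) c1"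
      unfolding singular_boundary slits_Int .
  qed (erule slits_acyclic[OF disjI2[OF refl]])+
  then show ?thesis by (simp add: punctured_def numeral_2_eq_2)
qed

text \<open>The components of the common part are the half edges. On each of them the common boundary has total
  coefficient 0: the jump functions separate the two halves of an edge, and their squares separate the edges.\<close>

lemma common_boundary_bounds:
  assumes s1: "singular_chain 1 (subtopology X edges_slit) c1" "singular_chain 1 (subtopology X corners_slit) c2"
      "homologous_rel 1 (subtopology X punctured) {} c (c1 + c2)"
    and b: "chain_boundary 1 c1 = - chain_boundary 1 c2"
      "singular_chain 0 (subtopology X (region (slit 2 0))) (chain_boundary 1 c1)"
    and wz: "\<And>j. letter g j \<Longrightarrow> winding (turn j) c = 0"
  shows "\<exists>d. singular_chain 1 (subtopology X (region (slit 2 0))) d \<and> chain_boundary 1 d = chain_boundary 1 c1"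
proof -
  let ?Z = "subtopology X (region (slit 2 0))"
  define e where "e = chain_boundary 1 c1"
  have e: "singular_chain 0 ?Z e" "e = - chain_boundary 1 c2"
    using b by (simp_all add: e_def)
  have base: "\<exists>p\<in>rectL (slit 2 0). base_val \<tau> = Q p" if "\<tau> \<in> Poly_Mapping.keys e" for \<tau>
  proof -
    have "singular_simplex 0 ?Z \<tau>" using e(1) that by (auto simp: singular_chain_def)
    from zero_simplex_eq_const(2)[OF this] show ?thesis
      unfolding topspace_region by (auto simp: region_def)
  qed
  obtain r2 where r2: "continuous_map (subtopology X corners_slit) (discrete_topology UNIV) r2"
    "\<And>p. p \<in> rectL (slit 1 0) \<Longrightarrow> r2 (Q p) = Q (1, slit_centre 1 0 (snd p))"
    by (rule region_retract[OF slit_rule_edge]) blast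
  obtain r3 where r3: "homotopic_with (\<lambda>_. True) ?Z ?Z id r3"
    "\<And>p. p \<in> rectL (slit 2 0) \<Longrightarrow> r3 (Q p) = Q (1, slit_centre 2 0 (snd p))"
    by (rule region_retract[OF slit_rule_half]) blast
  have sub: "rectL (slit 2 0) \<subseteq> rectL (slit 1 (1/2))" "rectL (slit 2 0) \<subseteq> rectL (slit 1 0)"
    using slit_Int by (auto simp: rectL_def)
  \<comment> \<open>On the half edges the two potentials of \<open>turn j\<close> differ by the
    jump. Their values on \<open>e\<close> are, up to sign, the winding numbers of \<open>c1\<close>
    and \<open>c2\<close>, which add up to that of \<open>c\<close>, that is, to zero.\<close>
  have jump_eval: "\<exists>D. (\<forall>p\<in>rectL (slit 2 0). D (Q p) = jump j (snd p)) \<and> chain_eval (\<lambda>\<tau>. D (base_val \<tau>)) e = 0"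
    if j: "letter g j" for j
  proof -
    obtain w1 where w1: "continuous_map (subtopology X edges_slit) euclideanreal w1"
      "\<And>p. p \<in> rectL (slit 1 (1/2)) \<Longrightarrow> w1 (Q p) = fst p * ramp j (snd p) - ramp j (slit_centre 1 (1/2) (snd p))"
      by (rule potential_exists[OF slit_rule_round j]) blast
    obtain w2 where w2: "continuous_map (subtopology X corners_slit) euclideanreal w2"
      "\<And>p. p \<in> rectL (slit 1 0) \<Longrightarrow> w2 (Q p) = fst p * ramp j (snd p) - ramp j (slit_centre 1 0 (snd p))"
      by (rule potential_exists[OF slit_rule_edge j]) blast
    have "winding (turn j) c1 = chain_eval (\<lambda>\<tau>. w1 (base_val \<tau>)) e"
      using winding_region[OF slit_rule_round j w1 s1(1)] by (simp add: e_def)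
    moreover have "winding (turn j) c2 = - chain_eval (\<lambda>\<tau>. w2 (base_val \<tau>)) e"
      using winding_region[OF slit_rule_edge j w2 s1(2)] by (simp add: e(2) chain_eval_minus)
    moreover have "winding (turn j) c1 + winding (turn j) c2 = 0"
    proof -
      have "circle_valued (subtopology X punctured) (turn j)"
        using turn_circle_valued[OF j] by (auto simp: circle_valued_def continuous_map_from_subtopology)
      from winding_homologous[OF this s1(3)] wz[OF j] show ?thesis by (simp add: chain_eval_add)
    qed
    ultimately have "chain_eval (\<lambda>\<tau>. w2 (base_val \<tau>) - w1 (base_val \<tau>)) e = 0"
      by (simp add: chain_eval_minus_fun)
    moreover have "w2 (Q p) - w1 (Q p) = jump j (snd p)" if "p \<in> rectL (slit 2 0)" for p
      using w1(2)[OF subsetD[OF sub(1) that]] w2(2)[OF subsetD[OF sub(2) that]] by (simp only: jump_def)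
    ultimately show ?thesis by (intro exI[of _ "\<lambda>x. w2 x - w1 x"]) simp
  qed
  \<comment> \<open>This is the indicator of edge \<open>j\<close>, read off after retracting to
    edge midpoints: among these, \<open>turn j\<close> is -1 only at that of edge \<open>j\<close>,
    where the ramp is 1/2 and not an integer. It vanishes on \<open>e\<close> because
    \<open>e\<close> is also a boundary from the set cut at the corners.\<close>
  have square_eval: "\<exists>V. (\<forall>p\<in>rectL (slit 2 0). V (Q p) = (if jump j (snd p) = 0 then 0 else 1)) \<and>
      chain_eval (\<lambda>\<tau>. V (base_val \<tau>)) e = 0" if j: "letter g j" for j
  proof -
    define v :: "'a \<Rightarrow> real" where "v x = (if turn j x = -1 then 1 else 0)" for x
    have "v (r2 (Q p)) = (if jump j (snd p) = 0 then 0 else 1)" if p: "p \<in> rectL (slit 2 0)" for p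
    proof -
      have p': "snd p \<in> slit 2 0" "0 \<le> snd p" "snd p \<le> 4 * real g" "snd p \<in> slit 1 0"
        using p sub by (auto simp: rectL_def rect_def)
      have "0 \<le> slit_centre 1 0 (snd p)" "slit_centre 1 0 (snd p) \<le> real (4 * g)"
        using slit_centre_bounds[OF slit_rule_edge p'(4), of "4 * g"] p' by auto
      then have "(1, slit_centre 1 0 (snd p)) \<in> rect" by (simp add: rect_def)
      then have "turn j (r2 (Q p)) = cis (2 * pi * ramp j (slit_centre 1 0 (snd p)))"
        using r2(2)[of p] sub p turn(2)[OF j] by auto
      moreover have "cis (2 * pi * x) = -1 \<longleftrightarrow> x = 1/2" if "x \<in> {0, 1/2, 1}" for x
      proof -
        have "cis (2 * pi * (1/2)) = -1" "cis (2 * pi * 0) = 1" "cis (2 * pi * 1) = 1"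
          by (simp_all add: cis_2pi)
        then show ?thesis using that by (elim insertE emptyE) (simp_all only:, simp_all)
      qed
      ultimately show ?thesis
        using jump_facts(3)[OF p'(1-3) j] jump_facts(4)[OF p'(1-3) j] by (simp add: v_def)
    qed
    moreover have "chain_eval (\<lambda>\<tau>. v (r2 (base_val \<tau>))) e = 0"
      unfolding e(2) chain_eval_minus eval_locally_constant[OF r2(1) s1(2)] by simp
    ultimately show ?thesis by (intro exI[of _ "\<lambda>x. v (r2 x)"]) simp
  qed
  have "chain_map 0 r3 e = 0"
  proof (rule zero_chain_map_eq_0[OF e(1)])
    fix y
    show "chain_eval (\<lambda>\<tau>. if r3 (base_val \<tau>) = y then 1 else 0) e = 0"
    proof (cases "\<exists>p\<in>rectL (slit 2 0). r3 (Q p) = y")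
      case False
      have "chain_eval (\<lambda>\<tau>. if r3 (base_val \<tau>) = y then 1 else 0) e = chain_eval (\<lambda>_. 0) e"
      proof (rule chain_eval_cong)
        fix \<tau> assume "\<tau> \<in> Poly_Mapping.keys e"
        then obtain p where "p \<in> rectL (slit 2 0)" "base_val \<tau> = Q p" using base by blast
        then show "(if r3 (base_val \<tau>) = y then 1 else (0::real)) = 0" using False by auto
      qed
      then show ?thesis by (simp add: chain_eval_def)
    next
      case True
      then obtain p0 where p0: "p0 \<in> rectL (slit 2 0)" "r3 (Q p0) = y" by blast
      have b0: "snd p0 \<in> slit 2 0" "0 \<le> snd p0" "snd p0 \<le> 4 * real g"
        using p0 by (auto simp: rectL_def rect_def)
      obtain j where j: "letter g j" "jump j (snd p0) \<noteq> 0" using jump_facts(1)[OF b0] by blast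
      have J0: "jump j (snd p0) = 1/2 \<or> jump j (snd p0) = -1/2" using jump_facts(2)[OF b0 j(1)] j(2) by auto
      obtain D where D: "\<And>p. p \<in> rectL (slit 2 0) \<Longrightarrow> D (Q p) = jump j (snd p)"
        "chain_eval (\<lambda>\<tau>. D (base_val \<tau>)) e = 0" using jump_eval[OF j(1)] by blast
      obtain V where V: "\<And>p. p \<in> rectL (slit 2 0) \<Longrightarrow> V (Q p) = (if jump j (snd p) = 0 then 0 else 1)"
        "chain_eval (\<lambda>\<tau>. V (base_val \<tau>)) e = 0" using square_eval[OF j(1)] by blast
      \<comment> \<open>The indicator of one half edge is a combination of the two cochains: for
        \<open>J\<close> and \<open>J0\<close> in {1/2, -1/2} the number
        \<open>1/2 + 2 * J0 * J\<close> is 1 if they agree and 0 if they are opposite; off the edge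
        both terms vanish.\<close>
      have "chain_eval (\<lambda>\<tau>. if r3 (base_val \<tau>) = y then 1 else 0) e
          = chain_eval (\<lambda>\<tau>. 1/2 * V (base_val \<tau>) + (2 * jump j (snd p0)) * D (base_val \<tau>)) e"
      proof (rule chain_eval_cong)
        fix \<tau> assume "\<tau> \<in> Poly_Mapping.keys e"
        then obtain p where p: "p \<in> rectL (slit 2 0)" "base_val \<tau> = Q p" using base by blast
        have b1: "snd p \<in> slit 2 0" "0 \<le> snd p" "snd p \<le> 4 * real g"
          using p by (auto simp: rectL_def rect_def)
        have in3: "(1, slit_centre 2 0 t) \<in> rectL (slit 2 0)" if "t \<in> slit 2 0" "0 \<le> t" "t \<le> 4 * real g" for t
          using slit_centre_bounds[OF slit_rule_half that(1,2), of "4 * g"] that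
            retraction_ruleD(7)[OF slit_rule_half that(1), of 1] by (simp add: rectL_def rect_def)
        have iff: "r3 (Q p) = y \<longleftrightarrow> jump j (snd p) = jump j (snd p0)"
        proof
          assume "r3 (Q p) = y"
          then have "Q (1, slit_centre 2 0 (snd p)) = Q (1, slit_centre 2 0 (snd p0))"
            using r3(2) p(1) p0 by simp
          then have "jump j (slit_centre 2 0 (snd p)) = jump j (slit_centre 2 0 (snd p0))"
            using D(1)[OF in3[OF b0]] D(1)[OF in3[OF b1]] by (metis snd_conv)
          then show "jump j (snd p) = jump j (snd p0)" by (simp only: jump_facts(6)[OF b0] jump_facts(6)[OF b1])
        next
          assume eq: "jump j (snd p) = jump j (snd p0)"
          then have "jump j (snd p) \<noteq> 0" using j(2) by simp
          from jump_facts(5)[OF b1 j(1) this] jump_facts(5)[OF b0 j] eq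
          have "Q (1, slit_centre 2 0 (snd p)) = Q (1, slit_centre 2 0 (snd p0))" by simp
          then show "r3 (Q p) = y" using r3(2) p(1) p0 by simp
        qed
        have J: "jump j (snd p) = 0 \<or> jump j (snd p) = 1/2 \<or> jump j (snd p) = -1/2"
          using jump_facts(2)[OF b1 j(1)] by auto
        show "(if r3 (base_val \<tau>) = y then 1 else 0) = 1/2 * V (base_val \<tau>) + (2 * jump j (snd p0)) * D (base_val \<tau>)"
          unfolding p(2) iff D(1)[OF p(1)] V(1)[OF p(1)] using J J0 by (elim disjE; simp only:; simp)
      qed
      also have "\<dots> = 0" by (simp only: chain_eval_plus chain_eval_times D(2) V(2))
      finally show ?thesis .
    qed
  qed
  moreover have "\<exists>d. singular_chain 1 ?Z d \<and> chain_boundary 1 d = e - chain_map 0 r3 e"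
    by (rule zero_chain_retract[OF homotopic_id_path_component[OF r3(1)] e(1)])
  ultimately show ?thesis by (simp add: e_def)
qed

lemma punctured_1_cycle_bounds:
  assumes c: "singular_relcycle 1 (subtopology X punctured) {} c"
    and wz: "\<And>j. letter g j \<Longrightarrow> winding (turn j) c = 0"
  shows "singular_relboundary 1 (subtopology X punctured) {} c"
proof -
  have "singular_relboundary (Suc 0) (subtopology X (edges_slit \<union> corners_slit)) {} c"
  proof (rule mayer_vietoris_bounds[OF region_open[OF slit_rule_round] region_open[OF slit_rule_edge]])
    show "singular_relcycle (Suc 0) (subtopology X (edges_slit \<union> corners_slit)) {} c"
      using c by (simp add: punctured_def)
    fix c1 c2
    assume s: "singular_chain (Suc 0) (subtopology X edges_slit) c1" "singular_chain (Suc 0) (subtopology X corners_slit) c2"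
      "homologous_rel (Suc 0) (subtopology X (edges_slit \<union> corners_slit)) {} c (c1 + c2)"
      and b: "chain_boundary (Suc 0) c1 = - chain_boundary (Suc 0) c2"
        "singular_chain 0 (subtopology X (edges_slit \<inter> corners_slit)) (chain_boundary (Suc 0) c1)"
    then have "\<exists>d. singular_chain 1 (subtopology X (region (slit 2 0))) d \<and> chain_boundary 1 d = chain_boundary 1 c1"
      using wz unfolding slits_Int by (intro common_boundary_bounds[of c1 c2 c]) (simp_all add: punctured_def)
    then show "\<exists>d. singular_chain (Suc 0) (subtopology X (edges_slit \<inter> corners_slit)) d \<and>
        chain_boundary (Suc 0) d = chain_boundary (Suc 0) c1"
      unfolding slits_Int by simp
  qed (erule slits_acyclic[OF disjI1[OF refl]])+
  then show ?thesis by (simp add: punctured_def)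
qed

section \<open>Filling in the disc around the centre\<close>

definition open_disc :: "real \<Rightarrow> 'a set" where
  "open_disc \<rho> = Q ` {p \<in> rect. fst p < \<rho>}"

lemma open_disc_iff:
  assumes \<rho>: "\<rho> \<le> 1" and p: "p \<in> rect"
  shows "Q p \<in> open_disc \<rho> \<longleftrightarrow> fst p < \<rho>"
proof
  assume "Q p \<in> open_disc \<rho>"
  then obtain p' where p': "p' \<in> rect" "fst p' < \<rho>" "Q p = Q p'" by (auto simp: open_disc_def)
  have "compatible (\<lambda>p. fst p < \<rho>)" by (simp add: compatible_def)
  from compatible_eq[OF this p p'(1,3)] p'(2) show "fst p < \<rho>" by simp
qed (use p in \<open>auto simp: open_disc_def\<close>)

lemma open_disc_preimage:
  assumes "\<rho> \<le> 1"
  shows "{p \<in> rect. Q p \<in> open_disc \<rho>} = {p \<in> rect. fst p < \<rho>}"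
  using open_disc_iff[OF assms] by blast

lemma open_disc_open:
  assumes \<rho>: "\<rho> \<le> 1"
  shows "openin X (open_disc \<rho>)"
proof -
  have "{p \<in> rect. fst p < \<rho>} = rect \<inter> ({..<\<rho>} \<times> UNIV)" by auto
  moreover have "open ({..<\<rho>} \<times> (UNIV :: real set))" by (intro open_Times) auto
  ultimately have "openin (top_of_set rect) {p \<in> rect. Q p \<in> open_disc \<rho>}"
    unfolding open_disc_preimage[OF \<rho>] by (simp only: openin_open_Int)
  moreover have "open_disc \<rho> \<subseteq> topspace X" using Q_image by (auto simp: open_disc_def)
  ultimately show ?thesis using quotient_Q by (simp add: quotient_map_def)
qed

lemma topspace_disc_punctured:
  assumes "0 < \<rho>"
  shows "open_disc \<rho> \<union> punctured = topspace X"
proof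
  show "open_disc \<rho> \<union> punctured \<subseteq> topspace X"
    using Q_image by (auto simp: open_disc_def punctured_eq)
  show "topspace X \<subseteq> open_disc \<rho> \<union> punctured"
    unfolding Q_image[symmetric] open_disc_def punctured_eq using assms by (fastforce simp: rect_def)
qed

lemma open_disc_acyclic:
  assumes c: "singular_relcycle 1 (subtopology X (open_disc 1)) {} c"
  shows "singular_relboundary 1 (subtopology X (open_disc 1)) {} c"
proof -
  let ?S = "{p \<in> rect. fst p < 1}" and ?Z = "subtopology X (open_disc 1)"
  have q: "quotient_map (top_of_set ?S) ?Z Q"
  proof -
    have "quotient_map (subtopology (top_of_set rect) ?S) ?Z Q"
      using open_disc_preimage[of 1] open_disc_open[of 1]
      by (intro quotient_map_restriction[OF quotient_Q]) auto
    moreover have "rect \<inter> ?S = ?S" by auto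
    ultimately show ?thesis by (simp add: subtopology_subtopology)
  qed
  define H where "H z = ((1 - fst z) * fst (snd z), snd (snd z))" for z :: "real \<times> real \<times> real"
  have H: "H z \<in> ?S" if "z \<in> {0..1} \<times> ?S" for z
  proof -
    obtain u r t where z: "z = (u, r, t)" by (cases z)
    have b: "0 \<le> u" "u \<le> 1" "0 \<le> r" "r < 1" "0 \<le> t" "t \<le> 4 * real g" using that by (auto simp: z rect_def)
    have "(1 - u) * r \<le> 1 * r" using b by (intro mult_right_mono) auto
    then show ?thesis using b by (simp add: H_def z rect_def)
  qed
  have G: "continuous_map (top_of_set ({0..1} \<times> ?S)) ?Z (\<lambda>z. Q (H z))"
    unfolding continuous_map_in_subtopology
  proof
    show "continuous_map (top_of_set ({0..1} \<times> ?S)) X (\<lambda>z. Q (H z))"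
    proof (rule continuous_map_Q)
      show "continuous_on ({0..1} \<times> ?S) H" unfolding H_def by (intro continuous_intros)
      show "H \<in> {0..1} \<times> ?S \<rightarrow> {0..1} \<times> UNIV" using H by (force simp: rect_def mem_Times_iff)
    qed
    show "(\<lambda>z. Q (H z)) \<in> topspace (top_of_set ({0..1} \<times> ?S)) \<rightarrow> open_disc 1"
      using H by (auto simp: open_disc_def)
  qed
  have fib: "Q (H (u, x)) = Q (H (u, y))" if u: "u \<in> {0..1}" and x: "x \<in> ?S" and y: "y \<in> ?S" and eq: "Q x = Q y" for u x y
  proof -
    \<comment> \<open>Cutting the function off at radius 1 makes the conditions on the edges
      trivial.\<close>
    have "compatible (\<lambda>p. if fst p < 1 then Q ((1 - u) * fst p, snd p) else undefined)"
      unfolding compatible_def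
      using Q_centre[of _ 0] Q_periodic[of _ 0] by (auto intro: Q_centre)
    from compatible_eq[OF this _ _ eq] x y show ?thesis by (simp add: H_def)
  qed
  obtain f k where fk: "homotopic_with (\<lambda>_. True) ?Z ?Z f k" "\<And>x. x \<in> ?S \<Longrightarrow> f (Q x) = Q (H (0, x))"
    "\<And>x. x \<in> ?S \<Longrightarrow> k (Q x) = Q (H (1, x))"
    using homotopy_descend[OF q G fib] by blast
  have f: "f x = x" if "x \<in> open_disc 1" for x
    using that fk(2) by (auto simp: open_disc_def H_def)
  have k: "k x = Q (0, 0)" if "x \<in> open_disc 1" for x
    using that fk(3) Q_centre[of _ 0] by (auto simp: open_disc_def H_def)
  have t: "topspace ?Z = open_disc 1" using openin_subset[OF open_disc_open[of 1]] by auto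
  show ?thesis
  proof (rule discrete_retract_acyclic[OF _ _ disjI1[OF refl] c])
    show "homotopic_with (\<lambda>_. True) ?Z ?Z id (\<lambda>_. Q (0, 0))"
      using homotopic_with_eq[OF fk(1), of id "\<lambda>_. Q (0, 0)"] f k t by simp
  qed auto
qed

lemma path_connected_annulus: "path_connected_space (subtopology X (open_disc 1 \<inter> punctured))"
proof -
  have eq: "open_disc 1 \<inter> punctured = Q ` ({0<..<1} \<times> {0..4 * real g})" (is "_ = Q ` ?S")
  proof -
    have "Q p \<in> open_disc 1 \<and> Q p \<in> punctured \<longleftrightarrow> fst p < 1 \<and> 0 < fst p" if p: "p \<in> rect" for p
    proof -
      have "Q p \<in> punctured \<longleftrightarrow> 0 < fst p"
        unfolding punctured_def Un_iff region_iff[OF slit_rule_round p] region_iff[OF slit_rule_edge p]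
        using slit_Un p by (simp only: rectL_def mem_Collect_eq) blast
      then show ?thesis using open_disc_iff[OF _ p, of 1] by simp
    qed
    moreover have "open_disc 1 \<subseteq> Q ` rect" by (auto simp: open_disc_def)
    moreover have "?S = {p \<in> rect. fst p < 1 \<and> 0 < fst p}" by (auto simp: rect_def)
    ultimately show ?thesis by blast
  qed
  have "continuous_map (top_of_set ?S) X (\<lambda>p. Q (id p))"
    by (rule continuous_map_Q) (auto intro: continuous_on_id)
  moreover have "path_connectedin (top_of_set ?S) ?S"
    by (simp add: path_connectedin_subtopology convex_Times convex_imp_path_connected)
  ultimately have "path_connectedin X ((\<lambda>p. Q (id p)) ` ?S)"
    by (rule path_connectedin_continuous_map_image)
  then show ?thesis unfolding eq by (simp add: path_connectedin_def)
qed

text \<open>The cycle is moved off the disc. The boundary of its part in the disc lies in an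
  annulus, which is path connected, so a chain \<open>d\<close> of the annulus has the same boundary
  and replaces that part. The new cycle lies in the punctured surface and keeps its winding
  numbers.\<close>

theorem cycle_zero_winding_bounds:
  assumes c: "singular_relcycle 1 X {} c" and wz: "\<And>j. letter g j \<Longrightarrow> winding (turn j) c = 0"
  shows "singular_relboundary 1 X {} c"
proof -
  have tX: "subtopology X (open_disc 1 \<union> punctured) = X"
    using topspace_disc_punctured[of 1] by simp
  have c': "singular_relcycle (Suc 0) (subtopology X (open_disc 1 \<union> punctured)) {} c"
    unfolding tX using c by simp
  obtain c1 c2 where s: "singular_chain (Suc 0) (subtopology X (open_disc 1)) c1"
    "singular_chain (Suc 0) (subtopology X punctured) c2"
    "homologous_rel (Suc 0) (subtopology X (open_disc 1 \<union> punctured)) {} c (c1 + c2)"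
    using cycle_split_open_cover[OF open_disc_open[of 1] punctured_open c'] by auto
  note b = homologous_to_split_cycle[OF c' s]
  have ch1: "singular_chain 1 X c1" using s(1) by (simp add: singular_chain_subtopology)
  have sub: "open_disc 1 \<inter> punctured \<subseteq> topspace X" using topspace_disc_punctured[of 1] by auto
  obtain d where d: "singular_chain 1 (subtopology X (open_disc 1 \<inter> punctured)) d"
    "chain_boundary 1 d = chain_boundary 1 c1"
    using zero_chain_bounds_path_connected[OF path_connected_annulus sub ch1] b(2) by auto
  have dA: "singular_chain 1 (subtopology X (open_disc 1)) d" and dB: "singular_chain 1 (subtopology X punctured) d"
    using d(1) singular_chain_mono by blast+
  have "singular_relcycle 1 (subtopology X (open_disc 1)) {} (c1 - d)"
    using s(1) dA d(2) by (simp add: singular_cycle singular_chain_diff chain_boundary_diff)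
  from open_disc_acyclic[OF this] have b1: "singular_relboundary 1 X {} (c1 - d)"
    by (rule boundary_in_whole)
  have cyc2: "singular_relcycle 1 (subtopology X punctured) {} (c2 + d)"
    using s(2) dB d(2) b(1) by (simp add: singular_cycle singular_chain_add chain_boundary_add)
  have hom: "homologous_rel 1 X {} c (c2 + d)"
  proof -
    have "singular_relboundary 1 X {} (c - (c1 + c2))" using s(3) unfolding tX by (simp add: homologous_rel_def)
    from singular_relboundary_add[OF this b1] show ?thesis by (simp add: homologous_rel_def algebra_simps)
  qed
  have "winding (turn j) (c2 + d) = 0" if "letter g j" for j
    using winding_homologous[OF turn_circle_valued[OF that] hom] wz[OF that] by simp
  from punctured_1_cycle_bounds[OF cyc2 this]
  have "singular_relboundary 1 X {} (c2 + d)"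
    by (rule boundary_in_whole)
  with hom show ?thesis by (metis homologous_rel_def singular_relboundary_add diff_add_cancel)
qed

text \<open>Split a 2-cycle into a part in the disc, which \<open>f\<close> fixes simplex by
  simplex, and a part in the punctured surface. The second part and its image have the same
  boundary, so their difference is a 2-cycle of the punctured surface and bounds.\<close>

theorem trivial_on_disc_imp_orientation_preserving:
  assumes f: "continuous_map X X f" and \<rho>: "0 < \<rho>" "\<rho> \<le> 1"
    and id: "\<And>x. x \<in> open_disc \<rho> \<Longrightarrow> f x = x" and pun: "f ` punctured \<subseteq> punctured"
  shows "orientation_preserving X f"
  unfolding orientation_preserving_def
proof
  fix z assume "z \<in> carrier (homology_group 2 X)"
  then obtain c where z: "z = homologous_rel_set 2 X {} c" and c: "singular_relcycle 2 X {} c"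
    using carrier_relative_homology_group[of 2 X "{}"] by auto
  have tX: "subtopology X (open_disc \<rho> \<union> punctured) = X"
    using topspace_disc_punctured[OF \<rho>(1)] by simp
  have c': "singular_relcycle (Suc 1) (subtopology X (open_disc \<rho> \<union> punctured)) {} c"
    unfolding tX using c by (simp add: numeral_2_eq_2)
  obtain c1 c2 where s: "singular_chain (Suc 1) (subtopology X (open_disc \<rho>)) c1"
    "singular_chain (Suc 1) (subtopology X punctured) c2"
    "homologous_rel (Suc 1) (subtopology X (open_disc \<rho> \<union> punctured)) {} c (c1 + c2)"
    using cycle_split_open_cover[OF open_disc_open[OF \<rho>(2)] punctured_open c'] by auto
  note b = homologous_to_split_cycle[OF c' s]
  have s2: "singular_chain 2 (subtopology X (open_disc \<rho>)) c1" "singular_chain 2 (subtopology X punctured) c2"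
    "homologous_rel 2 X {} c (c1 + c2)" "chain_boundary 2 c1 = - chain_boundary 2 c2"
    using s b(1) unfolding tX by (simp_all add: numeral_2_eq_2)
  have tp: "topspace (subtopology X (open_disc \<rho>)) = open_disc \<rho>"
    using openin_subset[OF open_disc_open[OF \<rho>(2)]] by auto
  have f1: "chain_map 2 f c1 = c1"
    using id by (intro chain_map_id_gen[OF s2(1)]) (simp add: tp)
  have "continuous_map (subtopology X punctured) (subtopology X punctured) f"
    using f pun by (auto simp: continuous_map_in_subtopology continuous_map_from_subtopology)
  then have f2: "singular_chain 2 (subtopology X punctured) (chain_map 2 f c2)"
    by (rule singular_chain_chain_map[OF s2(2)])
  have "chain_boundary 2 (chain_map 2 f c2) = chain_map 1 f (chain_boundary 2 c2)"
    using chain_boundary_chain_map[OF s2(2), of f] by simp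
  also have "\<dots> = - chain_map 1 f (chain_boundary 2 c1)"
    using s2(4) by (simp add: chain_map_minus)
  also have "chain_map 1 f (chain_boundary 2 c1) = chain_boundary 2 c1"
    using chain_boundary_chain_map[OF s2(1), of f] f1 by simp
  also have "- chain_boundary 2 c1 = chain_boundary 2 c2" using s2(4) by simp
  finally have "singular_relcycle 2 (subtopology X punctured) {} (chain_map 2 f c2 - c2)"
    using f2 s2(2) by (simp add: singular_cycle singular_chain_diff chain_boundary_diff)
  from punctured_2_cycle_bounds[OF this]
  have "singular_relboundary 2 X {} (chain_map 2 f c2 - c2)"
    by (rule boundary_in_whole)
  then have h1: "homologous_rel 2 X {} (chain_map 2 f (c1 + c2)) (c1 + c2)"
    by (simp add: homologous_rel_def chain_map_add f1)
  have "singular_relboundary 2 X {} (chain_map 2 f (c - (c1 + c2)))"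
    using s2(3) f by (intro singular_relboundary_chain_map[where S = "{}"]) (auto simp: homologous_rel_def)
  then have h0: "homologous_rel 2 X {} (chain_map 2 f c) (chain_map 2 f (c1 + c2))"
    by (simp add: homologous_rel_def chain_map_diff)
  have "homologous_rel 2 X {} (chain_map 2 f c) c"
    using homologous_rel_trans[OF homologous_rel_trans[OF h1 h0]] s2(3) homologous_rel_sym homologous_rel_trans h0 h1
    by metis
  then have "homologous_rel_set 2 X {} (chain_map 2 f c) = homologous_rel_set 2 X {} c"
    by (simp add: homologous_rel_set_eq)
  moreover have "hom_induced 2 X {} X {} f (homologous_rel_set 2 X {} c) = homologous_rel_set 2 X {} (chain_map 2 f c)"
    using hom_induced_chain_map[OF f _ c, of "{}"] by simp
  ultimately show "hom_induced 2 X {} X {} f z = z" unfolding z by simp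
qed

end

section \<open>A Dehn twist in every handle\<close>

text \<open>Handle \<open>i\<close> is the part of the polygon next to the edges \<open>4 * i, \<dots>, 4 * i + 3\<close>. With the height
  \<open>y = roof x - 8 * (1 - r)\<close> in place of the radius, it becomes the pentagon with vertices
  \<open>v\<^sub>0 = (0, 0)\<close>, \<open>v\<^sub>1 = (1, 3)\<close>, \<open>v\<^sub>2 = (2, 4)\<close>, \<open>v\<^sub>3 = (3, 3)\<close>, \<open>v\<^sub>4 = (4, 0)\<close>. The twist is affine on triangles:
  it maps \<open>v\<^sub>1 v\<^sub>2 v\<^sub>3\<close> to \<open>v\<^sub>1 v\<^sub>2 v\<^sub>0\<close> and \<open>v\<^sub>0 v\<^sub>1 v\<^sub>3\<close> to \<open>v\<^sub>0 v\<^sub>2 v\<^sub>3\<close>, and fixes the rest, so the edge \<open>a\<close> goes to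
  the diagonal \<open>v\<^sub>0 v\<^sub>2\<close>, which is homotopic to \<open>a b\<close>.\<close>

definition roof :: "real \<Rightarrow> real" where
  "roof x = min (min (3 * x) (x + 2)) (min (6 - x) (12 - 3 * x))"

text \<open>As the roof is at most 4, the slope 8 places all points of nonnegative height at radius
  at least 1/2. Below height 0 nothing moves, which leaves the inner disc of radius 1/2
  untouched.\<close>

definition height :: "real \<times> real \<Rightarrow> real" where
  "height p = roof (snd p) - 8 * (1 - fst p)"

text \<open>The clamping keeps the radius in the unit interval for all arguments, so each affine
  formula gives a continuous map to the surface on the whole box and not only on its own
  triangle.\<close>

definition at_height :: "real \<Rightarrow> real \<Rightarrow> real \<times> real" where
  "at_height x y = (max 0 (min 1 (1 - (roof x - y) / 8)), x)"

definition twist_loc :: "real \<times> real \<Rightarrow> real \<times> real" where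
  "twist_loc p = (let x = snd p; y = height p in
     if y \<le> 3 then (if x \<le> y then at_height ((x + y) / 2) ((3 * y - x) / 2) else p)
     else at_height ((3 * y - x) / 2 - 3) ((5 * y - 3 * x) / 2 - 3))"

text \<open>The line \<open>y = 2 * x\<close> is the diagonal from \<open>v0\<close> to
  \<open>v2\<close>, along which the inverse tears: it maps \<open>v0 v2 v3\<close> to
  \<open>v0 v1 v3\<close> and \<open>v0 v1 v2\<close> to \<open>v3 v1 v2\<close>.\<close>

definition untwist_loc :: "real \<times> real \<Rightarrow> real \<times> real" where
  "untwist_loc p = (let x = snd p; y = height p in
     if y \<le> 2 * x then (if y \<le> x then p else at_height ((3 * x - y) / 2) ((x + y) / 2))
     else at_height (3 + (5 * x - 3 * y) / 2) (3 + (3 * x - y) / 2))"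

definition local_box :: "(real \<times> real) set" where
  "local_box = {0..1} \<times> {0..4}"

lemma roof_bounds: "x \<in> {0..4} \<Longrightarrow> 0 \<le> roof x" "roof x \<le> 4"
  by (auto simp: roof_def)

lemma le_roof_iff: "y \<le> roof x \<longleftrightarrow> y \<le> 3 * x \<and> y \<le> x + 2 \<and> y \<le> 6 - x \<and> y \<le> 12 - 3 * x"
  by (auto simp: roof_def)

lemma at_height_self: "p \<in> local_box \<Longrightarrow> at_height (snd p) (height p) = p"
  by (cases p) (simp add: at_height_def height_def local_box_def diff_divide_distrib)

lemma at_height:
  assumes "x \<in> {0..4}" "0 \<le> y" "y \<le> roof x"
  shows "height (at_height x y) = y" "snd (at_height x y) = x" "at_height x y \<in> local_box"
    "0 < fst (at_height x y)"
proof -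
  have "0 \<le> (roof x - y) / 8" "(roof x - y) / 8 \<le> 1/2" using assms roof_bounds[of x] by simp_all
  then have e: "at_height x y = (1 - (roof x - y) / 8, x)" by (simp add: at_height_def)
  show "height (at_height x y) = y" "snd (at_height x y) = x" unfolding e by (simp_all add: height_def diff_divide_distrib)
  show "at_height x y \<in> local_box" "0 < fst (at_height x y)"
    unfolding e using assms \<open>0 \<le> (roof x - y) / 8\<close> \<open>(roof x - y) / 8 \<le> 1/2\<close> by (simp_all add: local_box_def)
qed

lemma at_height_roof: "at_height x (roof x) = (1, x)"
  by (simp add: at_height_def)

lemma height_le_roof: "p \<in> local_box \<Longrightarrow> height p \<le> roof (snd p)"
  by (auto simp: height_def local_box_def)

lemma height_rim: "height (1, x) = roof x"
  by (simp add: height_def)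

text \<open>Lying below the roof is a system of four linear inequalities, so it is linear arithmetic
  that every affine piece stays inside the pentagon.\<close>

lemma twist_loc_cases:
  assumes p: "p \<in> local_box"
  obtains (low) "height p \<le> snd p" "height p \<le> 3" "twist_loc p = p"
  | (middle) x' y' where "snd p \<le> height p" "height p \<le> 3" "x' = (snd p + height p) / 2" "y' = (3 * height p - snd p) / 2"
      "x' \<in> {0..4}" "0 \<le> y'" "y' \<le> roof x'" "twist_loc p = at_height x' y'"
  | (high) x' y' where "3 < height p" "x' = (3 * height p - snd p) / 2 - 3" "y' = (5 * height p - 3 * snd p) / 2 - 3"
      "x' \<in> {0..4}" "0 \<le> y'" "y' \<le> roof x'" "twist_loc p = at_height x' y'"
proof -
  define x y where "x = snd p" and "y = height p"
  have x: "0 \<le> x" "x \<le> 4" using p by (auto simp: local_box_def x_def)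
  have y: "y \<le> 3 * x" "y \<le> x + 2" "y \<le> 6 - x" "y \<le> 12 - 3 * x"
    using height_le_roof[OF p] unfolding le_roof_iff x_def y_def by auto
  consider "y \<le> 3" "\<not> x \<le> y" | "y \<le> 3" "x \<le> y" | "3 < y" by linarith
  then show ?thesis
  proof cases
    case 1
    then show ?thesis using low by (simp add: twist_loc_def Let_def x_def y_def)
  next
    case 2
    have "(3 * y - x) / 2 \<le> roof ((x + y) / 2)" unfolding le_roof_iff using 2 x y by (simp add: field_simps)
    moreover have "twist_loc p = at_height ((x + y) / 2) ((3 * y - x) / 2)"
      using 2 by (simp add: twist_loc_def Let_def x_def y_def)
    ultimately show ?thesis using middle[of "(x + y) / 2" "(3 * y - x) / 2"] 2 x y by (simp add: x_def y_def)
  next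
    case 3
    have "(5 * y - 3 * x) / 2 - 3 \<le> roof ((3 * y - x) / 2 - 3)" unfolding le_roof_iff using 3 x y by (simp add: field_simps)
    moreover have "twist_loc p = at_height ((3 * y - x) / 2 - 3) ((5 * y - 3 * x) / 2 - 3)"
      using 3 by (simp add: twist_loc_def Let_def x_def y_def)
    moreover have "0 \<le> (5 * y - 3 * x) / 2 - 3" "(3 * y - x) / 2 - 3 \<in> {0..4}" using 3 x y by (simp_all add: field_simps)
    ultimately show ?thesis using high[of "(3 * y - x) / 2 - 3" "(5 * y - 3 * x) / 2 - 3"] 3 by (simp add: x_def y_def)
  qed
qed

lemma untwist_loc_cases:
  assumes p: "p \<in> local_box"
  obtains (low) "height p \<le> snd p" "untwist_loc p = p"
  | (middle) x' y' where "snd p < height p" "height p \<le> 2 * snd p" "x' = (3 * snd p - height p) / 2" "y' = (snd p + height p) / 2"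
      "x' \<in> {0..4}" "0 \<le> y'" "y' \<le> roof x'" "untwist_loc p = at_height x' y'"
  | (high) x' y' where "2 * snd p < height p" "x' = 3 + (5 * snd p - 3 * height p) / 2" "y' = 3 + (3 * snd p - height p) / 2"
      "x' \<in> {0..4}" "0 \<le> y'" "y' \<le> roof x'" "untwist_loc p = at_height x' y'"
proof -
  define x y where "x = snd p" and "y = height p"
  have x: "0 \<le> x" "x \<le> 4" using p by (auto simp: local_box_def x_def)
  have y: "y \<le> 3 * x" "y \<le> x + 2" "y \<le> 6 - x" "y \<le> 12 - 3 * x"
    using height_le_roof[OF p] unfolding le_roof_iff x_def y_def by auto
  consider "y \<le> x" | "x < y" "y \<le> 2 * x" | "2 * x < y" by linarith
  then show ?thesis
  proof cases
    case 1
    then have "untwist_loc p = p" using x by (simp add: untwist_loc_def Let_def x_def y_def)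
    then show ?thesis using low 1 by (simp add: x_def y_def)
  next
    case 2
    have "(x + y) / 2 \<le> roof ((3 * x - y) / 2)" unfolding le_roof_iff using 2 x y by (simp add: field_simps)
    moreover have "untwist_loc p = at_height ((3 * x - y) / 2) ((x + y) / 2)"
      using 2 by (simp add: untwist_loc_def Let_def x_def y_def)
    moreover have "0 \<le> (x + y) / 2" "(3 * x - y) / 2 \<in> {0..4}" using 2 x y by (simp_all add: field_simps)
    ultimately show ?thesis using middle[of "(3 * x - y) / 2" "(x + y) / 2"] 2 by (simp add: x_def y_def)
  next
    case 3
    have "3 + (3 * x - y) / 2 \<le> roof (3 + (5 * x - 3 * y) / 2)" unfolding le_roof_iff using 3 x y by (simp add: field_simps)
    moreover have "untwist_loc p = at_height (3 + (5 * x - 3 * y) / 2) (3 + (3 * x - y) / 2)"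
      using 3 by (simp add: untwist_loc_def Let_def x_def y_def)
    moreover have "0 \<le> 3 + (3 * x - y) / 2" "3 + (5 * x - 3 * y) / 2 \<in> {0..4}" using 3 x y by (simp_all add: field_simps)
    ultimately show ?thesis using high[of "3 + (5 * x - 3 * y) / 2" "3 + (3 * x - y) / 2"] 3 by (simp add: x_def y_def)
  qed
qed

lemma twist_loc_box: "twist_loc p \<in> local_box" if "p \<in> local_box"
  by (rule twist_loc_cases[OF that]) (use that in \<open>simp_all add: at_height\<close>)

lemma untwist_loc_box: "untwist_loc p \<in> local_box" if "p \<in> local_box"
  by (rule untwist_loc_cases[OF that]) (use that in \<open>simp_all add: at_height\<close>)

lemma twist_loc_fst_pos: "p \<in> local_box \<Longrightarrow> 0 < fst p \<Longrightarrow> 0 < fst (twist_loc p)"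
  by (erule twist_loc_cases) (simp_all add: at_height)

lemma roof_edges:
  assumes "s \<in> {0..1}"
  shows "roof s = 3 * s" "roof (3 - s) = 3 + s" "roof (1 + s) = 3 + s" "roof (4 - s) = 3 * s"
  using assms by (auto simp: roof_def)

text \<open>For \<open>s = 0\<close> the case distinction of the definition picks another representative of the same vertex.\<close>

lemma twist_loc_edges:
  assumes s: "s \<in> {0..1}"
  shows "twist_loc (1, s) = at_height (2 * s) (4 * s)"
    "twist_loc (1, 3 - s) = (if s = 0 then (1, 3) else at_height (2 * s) (4 * s))"
    "twist_loc (1, 1 + s) = (if s = 0 then (1, 2) else (1, 1 + s))"
    "twist_loc (1, 4 - s) = (1, 4 - s)"
proof -
  show "twist_loc (1, s) = at_height (2 * s) (4 * s)"
    using s by (simp add: twist_loc_def Let_def height_rim roof_edges)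
  have "at_height 3 3 = (1, 3)" using at_height_roof[of 3] by (simp add: roof_def)
  then show "twist_loc (1, 3 - s) = (if s = 0 then (1, 3) else at_height (2 * s) (4 * s))"
    using s by (simp add: twist_loc_def Let_def height_rim roof_edges field_simps)
  have "at_height 2 4 = (1, 2)" "at_height (1 + s) (3 + s) = (1, 1 + s)"
    using at_height_roof[of 2] at_height_roof[of "1 + s"] roof_edges(3)[OF s] by (simp_all add: roof_def)
  moreover have "twist_loc (1, 1 + s) = (if s = 0 then at_height 2 4 else at_height (1 + s) (3 + s))"
    using s by (simp add: twist_loc_def Let_def height_rim roof_edges algebra_simps add_divide_distrib diff_divide_distrib)
  ultimately show "twist_loc (1, 1 + s) = (if s = 0 then (1, 2) else (1, 1 + s))" by simp
  show "twist_loc (1, 4 - s) = (1, 4 - s)"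
  proof (cases "s = 1")
    case True
    then show ?thesis using \<open>at_height 3 3 = (1, 3)\<close> s by (simp add: twist_loc_def Let_def height_rim roof_def)
  next
    case False
    then show ?thesis using s by (simp add: twist_loc_def Let_def height_rim roof_edges)
  qed
qed

lemma untwist_loc_edges:
  assumes s: "s \<in> {0..1}"
  shows "untwist_loc (1, s) = (if s = 0 then (1, 0) else at_height (3 - 2 * s) 3)"
    "untwist_loc (1, 3 - s) = (if s = 0 then (1, 3) else at_height (3 - 2 * s) 3)"
    "untwist_loc (1, 1 + s) = (1, 1 + s) \<or> s = 1 \<and> untwist_loc (1, 1 + s) = (1, 1)"
    "untwist_loc (1, 4 - s) = (1, 4 - s)"
proof -
  show "untwist_loc (1, s) = (if s = 0 then (1, 0) else at_height (3 - 2 * s) 3)"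
    using s by (simp add: untwist_loc_def Let_def height_rim roof_edges algebra_simps add_divide_distrib diff_divide_distrib)
  show "untwist_loc (1, 3 - s) = (if s = 0 then (1, 3) else at_height (3 - 2 * s) 3)"
    using s by (simp add: untwist_loc_def Let_def height_rim roof_edges algebra_simps add_divide_distrib diff_divide_distrib)
  have "at_height (1 + s) (3 + s) = (1, 1 + s)" "at_height 1 3 = (1, 1)"
    using at_height_roof[of "1 + s"] at_height_roof[of 1] roof_edges(3)[OF s] by (simp_all add: roof_def)
  then show "untwist_loc (1, 1 + s) = (1, 1 + s) \<or> s = 1 \<and> untwist_loc (1, 1 + s) = (1, 1)"
    using s by (cases "s = 1")
      (simp_all add: untwist_loc_def Let_def height_rim roof_def algebra_simps add_divide_distrib diff_divide_distrib)
  show "untwist_loc (1, 4 - s) = (1, 4 - s)"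
    using s by (simp add: untwist_loc_def Let_def height_rim roof_edges)
qed

text \<open>The sides are the radii shared with the neighbouring handles. The identity there and
  near the centre lets the maps of the handles fit together.\<close>

lemma twist_loc_sides:
  assumes "r \<in> {0..1}"
  shows "twist_loc (r, 0) = (r, 0)" "twist_loc (r, 4) = (r, 4)" "x \<in> {0..4} \<Longrightarrow> r < 1/2 \<Longrightarrow> twist_loc (r, x) = (r, x)"
    "untwist_loc (r, 0) = (r, 0)" "untwist_loc (r, 4) = (r, 4)" "x \<in> {0..4} \<Longrightarrow> r < 1/2 \<Longrightarrow> untwist_loc (r, x) = (r, x)"
proof -
  have h: "height (r, 0) = - 8 * (1 - r)" "height (r, 4) = - 8 * (1 - r)" by (simp_all add: height_def roof_def)
  show "twist_loc (r, 0) = (r, 0)"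
    using assms h at_height_roof[of 0] by (auto simp: twist_loc_def Let_def roof_def)
  show "twist_loc (r, 4) = (r, 4)" "untwist_loc (r, 0) = (r, 0)" "untwist_loc (r, 4) = (r, 4)"
    using assms h by (simp_all add: twist_loc_def untwist_loc_def Let_def)
  assume x: "x \<in> {0..4}" and r: "r < 1/2"
  have "height (r, x) < 0" using roof_bounds(2)[of x] r by (simp add: height_def)
  then show "twist_loc (r, x) = (r, x)" "untwist_loc (r, x) = (r, x)"
    using x by (simp_all add: twist_loc_def untwist_loc_def Let_def)
qed

lemma continuous_at_height:
  "continuous_on S f \<Longrightarrow> continuous_on S h \<Longrightarrow> continuous_on S (\<lambda>p. at_height (f p) (h p))"
  unfolding at_height_def roof_def by (intro continuous_intros) auto

lemma continuous_height: "continuous_on S height"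
  unfolding height_def roof_def by (intro continuous_intros)

text \<open>The twist tears the pentagon along \<open>v\<^sub>1 v\<^sub>3\<close>, and the two sides of the tear land on the two copies of the edge \<open>a\<close>.\<close>

lemma continuous_map_twist:
  assumes low: "\<And>f. continuous_on local_box f \<Longrightarrow> f \<in> local_box \<rightarrow> {0..1} \<times> UNIV \<Longrightarrow>
        continuous_map (top_of_set local_box) Y (\<lambda>p. \<Phi> p (f p))"
    and high: "\<And>f. continuous_on local_box f \<Longrightarrow> f \<in> local_box \<rightarrow> {0..1} \<times> UNIV \<Longrightarrow>
        continuous_map (top_of_set local_box) Y (\<lambda>p. \<Psi> p (f p))"
    and tear: "\<And>p s. p \<in> local_box \<Longrightarrow> height p = 3 \<Longrightarrow> s \<in> {0..1} \<Longrightarrow> \<Phi> p (1, 3 - s) = \<Psi> p (1, s)"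
  shows "continuous_map (top_of_set local_box) Y (\<lambda>p. if height p \<le> 3 then \<Phi> p (twist_loc p) else \<Psi> p (twist_loc p))"
proof -
  let ?L = "top_of_set local_box"
  have [continuous_intros]: "continuous_on S height" for S by (rule continuous_height)
  have range: "(\<lambda>p. at_height (f p) (h p)) \<in> local_box \<rightarrow> {0..1} \<times> UNIV" for f h by (auto simp: at_height_def)
  have pieces: "continuous_map ?L Y (\<lambda>p. \<Phi> p (at_height (f p) (h p)))" "continuous_map ?L Y (\<lambda>p. \<Psi> p (at_height (f p) (h p)))"
    if "continuous_on local_box f" "continuous_on local_box h" for f h
    by (rule low[OF continuous_at_height[OF that] range], rule high[OF continuous_at_height[OF that] range])
  have idm: "continuous_map ?L Y (\<lambda>p. \<Phi> p p)"
    by (rule low) (auto simp: local_box_def)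
  let ?low = "\<lambda>p. if snd p \<le> height p then \<Phi> p (at_height ((snd p + height p) / 2) ((3 * height p - snd p) / 2)) else \<Phi> p p"
  have low': "continuous_map ?L Y ?low"
  proof (rule continuous_map_cases_le[OF _ _ continuous_map_from_subtopology[OF pieces(1)] continuous_map_from_subtopology[OF idm]])
    fix p assume p: "p \<in> topspace ?L" and h: "snd p = height p"
    then have "at_height ((snd p + height p) / 2) ((3 * height p - snd p) / 2) = at_height (snd p) (height p)" by simp
    then show "\<Phi> p (at_height ((snd p + height p) / 2) ((3 * height p - snd p) / 2)) = \<Phi> p p"
      using at_height_self[of p] p by simp
  qed (auto intro!: continuous_intros)
  have "continuous_map ?L Y (\<lambda>p. if height p \<le> 3 then ?low p
      else \<Psi> p (at_height ((3 * height p - snd p) / 2 - 3) ((5 * height p - 3 * snd p) / 2 - 3)))"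
  proof (rule continuous_map_cases_le[OF _ _ continuous_map_from_subtopology[OF low'] continuous_map_from_subtopology[OF pieces(2)]])
    fix p assume p: "p \<in> topspace ?L" and h: "height p = 3"
    then have pb: "p \<in> local_box" by simp
    have x: "1 \<le> snd p" "snd p \<le> 3"
      using height_le_roof[OF pb] h unfolding le_roof_iff by auto
    define s where "s = (3 - snd p) / 2"
    have s: "s \<in> {0..1}" using x by (simp add: s_def)
    have e: "(snd p + height p) / 2 = 3 - s" "(3 * height p - snd p) / 2 = 3 + s"
      "(5 * height p - 3 * snd p) / 2 - 3 = 3 * s"
      using h by (simp_all add: s_def field_simps)
    have "at_height (3 - s) (3 + s) = (1, 3 - s)" "at_height s (3 * s) = (1, s)"
      using at_height_roof[of s] at_height_roof[of "3 - s"] by (simp_all only: roof_edges[OF s])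
    then show "?low p = \<Psi> p (at_height ((3 * height p - snd p) / 2 - 3) ((5 * height p - 3 * snd p) / 2 - 3))"
      unfolding e using x h tear[OF pb h s] by simp
  qed (auto intro!: continuous_intros)
  then show ?thesis
    by (rule continuous_map_eq) (simp add: twist_loc_def Let_def)
qed

section \<open>Transfer of the twist to the surface\<close>

context polygon_surface
begin

definition shift :: "nat \<Rightarrow> real \<times> real \<Rightarrow> real \<times> real" where
  "shift i p = (fst p, 4 * real i + snd p)"

text \<open>Handles are closed strips of the rectangle that meet along radii in cyclic order, and
  the edge pairing never leaves a handle. So agreement on the common radii and at the centre is all
  that relates different handles.\<close>

lemma handlewise_map:
  fixes \<psi> :: "nat \<Rightarrow> real \<times> real \<Rightarrow> 'b"
  assumes cont: "\<And>i. i < g \<Longrightarrow> continuous_map (top_of_set local_box) Y (\<psi> i)"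
    and match: "\<And>i r. Suc i < g \<Longrightarrow> r \<in> {0..1} \<Longrightarrow> \<psi> i (r, 4) = \<psi> (Suc i) (r, 0)"
      "\<And>r. r \<in> {0..1} \<Longrightarrow> \<psi> (g - 1) (r, 4) = \<psi> 0 (r, 0)"
    and centre: "\<And>i x. i < g \<Longrightarrow> x \<in> {0..4} \<Longrightarrow> \<psi> i (0, x) = \<psi> 0 (0, 0)"
    and glue: "\<And>i s. i < g \<Longrightarrow> s \<in> {0..1} \<Longrightarrow> \<psi> i (1, s) = \<psi> i (1, 3 - s)"
      "\<And>i s. i < g \<Longrightarrow> s \<in> {0..1} \<Longrightarrow> \<psi> i (1, 1 + s) = \<psi> i (1, 4 - s)"
  obtains h where "continuous_map X Y h"
    "\<And>i p. i < g \<Longrightarrow> p \<in> local_box \<Longrightarrow> h (Q (shift i p)) = \<psi> i p"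
proof -
  \<comment> \<open>The minimum gives the last position \<open>4 * g\<close> to the last handle;
    every other common radius counts for the handle that follows it.\<close>
  define ix where "ix t = min (nat \<lfloor>t / 4\<rfloor>) (g - 1)" for t :: real
  define f where "f p = \<psi> (ix (snd p)) (fst p, snd p - 4 * real (ix (snd p)))" for p
  have f: "f (r, 4 * real i + x) = \<psi> i (r, x)" if "i < g" "r \<in> {0..1}" "x \<in> {0..4}" for i r x
  proof (cases "x = 4")
    case False
    then have "\<lfloor>(4 * real i + x) / 4\<rfloor> = int i" using that by (intro floor_unique) auto
    then have "ix (4 * real i + x) = i" using that g by (simp add: ix_def)
    then show ?thesis by (simp add: f_def)
  next
    case True
    have "(4 * real i + x) / 4 = real (Suc i)" using True by simp
    then have n: "nat \<lfloor>(4 * real i + x) / 4\<rfloor> = Suc i" by (simp only: floor_of_nat nat_int)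
    show ?thesis
    proof (cases "Suc i < g")
      case T: True
      then have "ix (4 * real i + x) = Suc i" using n by (simp add: ix_def)
      then show ?thesis using match(1)[OF T that(2)] True by (simp add: f_def)
    next
      case False
      then have "ix (4 * real i + x) = i" using n that by (simp add: ix_def)
      then show ?thesis by (simp add: f_def)
    qed
  qed
  have rect_cover: "\<exists>i<g. t \<in> {4 * real i..4 * real i + 4}" if t: "0 \<le> t" "t \<le> 4 * real g" for t
  proof (cases "t = 4 * real g")
    case True
    then show ?thesis using g by (intro exI[of _ "g - 1"]) (simp add: of_nat_diff)
  next
    case False
    define i where "i = nat \<lfloor>t / 4\<rfloor>"
    have "\<lfloor>t / 4\<rfloor> \<ge> 0" using t by simp
    then have "real i = of_int \<lfloor>t / 4\<rfloor>" by (simp add: i_def)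
    then have "real i \<le> t / 4" "t / 4 < real i + 1" by linarith+
    then have i: "4 * real i \<le> t" "t < 4 * real i + 4" by simp_all
    then have "real i < real g" using t False by simp
    then show ?thesis using i by (intro exI[of _ i]) simp
  qed
  have fcont: "continuous_map (top_of_set rect) Y f"
  proof (rule pasting_lemma_closed[where I = "{..<g}" and T = "\<lambda>i. {0..1} \<times> {4 * real i..4 * real i + 4}"
        and f = "\<lambda>i p. \<psi> i (fst p, snd p - 4 * real i)"])
    fix i assume i: "i \<in> {..<g}"
    have sub: "{0..1} \<times> {4 * real i..4 * real i + 4} \<subseteq> rect"
      using handle_le[of i] i by (auto simp: rect_def)
    then show "closedin (top_of_set rect) ({0..1} \<times> {4 * real i..4 * real i + 4})"
      by (intro closed_subset closed_Times) auto
    have "continuous_map (top_of_set ({0..1} \<times> {4 * real i..4 * real i + 4})) (top_of_set local_box)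
        (\<lambda>p. (fst p, snd p - 4 * real i))"
      by (auto simp: continuous_map_in_subtopology local_box_def intro!: continuous_intros)
    from continuous_map_compose[OF this cont[of i]] i sub
    show "continuous_map (subtopology (top_of_set rect) ({0..1} \<times> {4 * real i..4 * real i + 4})) Y
        (\<lambda>p. \<psi> i (fst p, snd p - 4 * real i))"
      by (simp add: subtopology_subtopology Int_absorb1 o_def)
  next
    fix i j p assume "i \<in> {..<g}" "j \<in> {..<g}"
      "p \<in> topspace (top_of_set rect) \<inter> ({0..1} \<times> {4 * real i..4 * real i + 4}) \<inter> ({0..1} \<times> {4 * real j..4 * real j + 4})"
    then show "\<psi> i (fst p, snd p - 4 * real i) = \<psi> j (fst p, snd p - 4 * real j)"
      using f[of i "fst p" "snd p - 4 * real i"] f[of j "fst p" "snd p - 4 * real j"] by auto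
  next
    fix p assume "p \<in> topspace (top_of_set rect)"
    then have p: "fst p \<in> {0..1}" "0 \<le> snd p" "snd p \<le> 4 * real g" by (auto simp: rect_def)
    obtain i where "i < g" "snd p \<in> {4 * real i..4 * real i + 4}" using rect_cover[OF p(2,3)] by blast
    then show "\<exists>j. j \<in> {..<g} \<and> p \<in> {0..1} \<times> {4 * real j..4 * real j + 4} \<and> f p = \<psi> j (fst p, snd p - 4 * real j)"
      using p f[of i "fst p" "snd p - 4 * real i"] by (intro exI[of _ i]) (auto simp: mem_Times_iff)
  qed simp
  have comp: "compatible f"
    unfolding compatible_def
  proof (intro conjI ballI allI impI)
    fix t assume "t \<in> {0..4 * real g}"
    then obtain i where i: "i < g" "t \<in> {4 * real i..4 * real i + 4}" using rect_cover[of t] by auto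
    have "f (0, t) = \<psi> 0 (0, 0)" using f[of i 0 "t - 4 * real i"] centre[of i "t - 4 * real i"] i by simp
    moreover have "f (0, 0) = \<psi> 0 (0, 0)" using f[of 0 0 0] g by simp
    ultimately show "f (0, t) = f (0, 0)" by simp
  next
    fix r :: real assume r: "r \<in> {0..1}"
    have "f (r, 4 * real (g - 1) + 4) = \<psi> (g - 1) (r, 4)" using f[of "g - 1" r 4] g r by simp
    moreover have "4 * real (g - 1) + 4 = 4 * real g" using g by (simp add: of_nat_diff)
    moreover have "f (r, 0) = \<psi> 0 (r, 0)" using f[of 0 r 0] g r by simp
    ultimately show "f (r, 4 * real g) = f (r, 0)" using match(2)[OF r] by simp
  next
    fix i s assume i: "i < g" and s: "s \<in> {0..1::real}"
    show "f (1, 4 * real i + s) = f (1, 4 * real i + 3 - s)"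
      using f[OF i, of 1 s] f[OF i, of 1 "3 - s"] glue(1)[OF i s] s by (simp add: algebra_simps)
    show "f (1, 4 * real i + 1 + s) = f (1, 4 * real i + 4 - s)"
      using f[OF i, of 1 "1 + s"] f[OF i, of 1 "4 - s"] glue(2)[OF i s] s by (simp add: algebra_simps)
  qed
  obtain h where h: "continuous_map X Y h" "\<And>p. p \<in> rect \<Longrightarrow> h (Q p) = f p"
    by (rule map_from_Q[OF fcont comp]) blast
  show ?thesis
  proof
    fix i p assume i: "i < g" and p: "p \<in> local_box"
    then have "shift i p \<in> rect" using handle_le[OF i] by (auto simp: shift_def local_box_def rect_def)
    then have "h (Q (shift i p)) = f (shift i p)" by (rule h(2))
    also have "\<dots> = \<psi> i (fst p, snd p)" unfolding shift_def using i p by (intro f) (auto simp: local_box_def)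
    finally show "h (Q (shift i p)) = \<psi> i p" by simp
  qed (rule h(1))
qed

lemma shift_cover:
  assumes "x \<in> topspace X"
  obtains i p where "i < g" "p \<in> local_box" "x = Q (shift i p)"
proof -
  obtain r t where rt: "0 \<le> r" "r \<le> 1" "0 \<le> t" "t \<le> 4 * real g" "x = Q (r, t)"
    using topspace_cases[OF assms] .
  define i where "i = min (nat \<lfloor>t / 4\<rfloor>) (g - 1)"
  have ig: "i < g" using g by (simp add: i_def)
  have "4 * real i \<le> t \<and> t \<le> 4 * real i + 4"
  proof -
    have n: "real (nat \<lfloor>t / 4\<rfloor>) \<le> t / 4" "t / 4 < real (nat \<lfloor>t / 4\<rfloor>) + 1" using rt by linarith+
    show ?thesis
    proof (cases "nat \<lfloor>t / 4\<rfloor> \<le> g - 1")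
      case True
      then have "real i = real (nat \<lfloor>t / 4\<rfloor>)" by (simp add: i_def)
      then show ?thesis using n by linarith
    next
      case False
      then have "i = g - 1" "real g \<le> real (nat \<lfloor>t / 4\<rfloor>)" by (simp_all add: i_def)
      then show ?thesis using n rt g by (simp add: of_nat_diff)
    qed
  qed
  then show ?thesis using rt ig by (intro that[of i "(r, t - 4 * real i)"]) (auto simp: local_box_def shift_def)
qed

text \<open>The ends of the paired edges link the corners of a handle in the order 0, 3, 2, 1,
  4.\<close>

lemma Q_corner:
  assumes "i < g"
  shows "Q (1, 4 * real i + 1) = Q (1, 4 * real i)" "Q (1, 4 * real i + 2) = Q (1, 4 * real i)"
    "Q (1, 4 * real i + 3) = Q (1, 4 * real i)" "Q (1, 4 * real i + 4) = Q (1, 4 * real i)"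
proof -
  have e: "4 * real i + 3 - 1 = 4 * real i + 2" "4 * real i + 1 + 1 = 4 * real i + 2"
    "4 * real i + 4 - 1 = 4 * real i + 3" by simp_all
  have G: "Q (1, 4 * real i) = Q (1, 4 * real i + 3)" "Q (1, 4 * real i + 1) = Q (1, 4 * real i + 4)"
    "Q (1, 4 * real i + 1) = Q (1, 4 * real i + 2)" "Q (1, 4 * real i + 2) = Q (1, 4 * real i + 3)"
    using Q_glue[OF assms, of 0] Q_glue[OF assms, of 1] unfolding e by (simp_all only: add_0_right diff_0_right) simp_all
  then show "Q (1, 4 * real i + 1) = Q (1, 4 * real i)" "Q (1, 4 * real i + 2) = Q (1, 4 * real i)"
    "Q (1, 4 * real i + 3) = Q (1, 4 * real i)" "Q (1, 4 * real i + 4) = Q (1, 4 * real i)"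
    by metis+
qed

lemma continuous_shift_map:
  assumes "continuous_on local_box f" "f \<in> local_box \<rightarrow> {0..1} \<times> UNIV"
  shows "continuous_map (top_of_set local_box) X (\<lambda>p. Q (shift i (f p)))"
proof (rule continuous_map_Q)
  show "continuous_on local_box (\<lambda>p. shift i (f p))"
    unfolding shift_def by (intro continuous_intros assms)
  show "(\<lambda>p. shift i (f p)) \<in> local_box \<rightarrow> {0..1} \<times> UNIV"
    using assms(2) by (auto simp: shift_def Pi_iff mem_Times_iff)
qed

lemma Q_at_height_edge:
  assumes i: "i < g" and s: "s \<in> {0..1}"
  shows "Q (shift i (at_height s (3 * s))) = Q (shift i (at_height (3 - s) (3 + s)))"
  using Q_glue(1)[OF i s] at_height_roof[of s] at_height_roof[of "3 - s"] s
  by (simp add: roof_edges shift_def algebra_simps)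

lemma twist_exists:
  obtains T where "continuous_map X X T"
    "\<And>i p. i < g \<Longrightarrow> p \<in> local_box \<Longrightarrow> T (Q (shift i p)) = Q (shift i (twist_loc p))"
proof (rule handlewise_map[of X "\<lambda>i p. Q (shift i (twist_loc p))"])
  fix i assume i: "i < g"
  have "continuous_map (top_of_set local_box) X (\<lambda>p. if height p \<le> 3 then Q (shift i (twist_loc p)) else Q (shift i (twist_loc p)))"
    using Q_glue(1)[OF i]
    by (intro continuous_map_twist continuous_shift_map) (auto simp: shift_def algebra_simps)
  then show "continuous_map (top_of_set local_box) X (\<lambda>p. Q (shift i (twist_loc p)))" by simp
  show "Q (shift i (twist_loc (1, s))) = Q (shift i (twist_loc (1, 3 - s)))" if s: "s \<in> {0..1}" for s
  proof (cases "s = 0")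
    case True
    have "at_height 0 0 = (1, 0)" using at_height_roof[of 0] by (simp add: roof_def)
    then show ?thesis
      using twist_loc_edges(1,2)[OF s] True Q_corner[OF i] by (simp add: shift_def)
  qed (use twist_loc_edges(1,2)[OF s] in simp)
  show "Q (shift i (twist_loc (1, 1 + s))) = Q (shift i (twist_loc (1, 4 - s)))" if s: "s \<in> {0..1}" for s
    using twist_loc_edges(3,4)[OF s] Q_corner[OF i] Q_glue(2)[OF i s]
    by (cases "s = 0") (simp_all add: shift_def algebra_simps)
  show "Q (shift i (twist_loc (0, x))) = Q (shift 0 (twist_loc (0, 0)))" if "x \<in> {0..4}" for x
    using twist_loc_sides(3)[of 0] that by (simp add: shift_def) (rule Q_centre)
next
  fix i and r :: real assume r: "r \<in> {0..1}"
  show "Q (shift i (twist_loc (r, 4))) = Q (shift (Suc i) (twist_loc (r, 0)))"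
    using twist_loc_sides[OF r] by (simp add: shift_def algebra_simps)
next
  fix r :: real assume r: "r \<in> {0..1}"
  show "Q (shift (g - 1) (twist_loc (r, 4))) = Q (shift 0 (twist_loc (r, 0)))"
    using twist_loc_sides[OF r] Q_periodic[of r 0] g by (simp add: shift_def of_nat_diff)
qed (rule that)

text \<open>On the line \<open>y = 2 * x\<close> the two branches give the two copies of the edge
  \<open>a\<close>, so continuity there holds only after the gluing.\<close>

lemma untwist_exists:
  obtains T where "continuous_map X X T"
    "\<And>i p. i < g \<Longrightarrow> p \<in> local_box \<Longrightarrow> T (Q (shift i p)) = Q (shift i (untwist_loc p))"
proof (rule handlewise_map[of X "\<lambda>i p. Q (shift i (untwist_loc p))"])
  fix i assume i: "i < g"
  let ?L = "top_of_set local_box"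
  have [continuous_intros]: "continuous_on S height" for S by (rule continuous_height)
  have ah: "continuous_map ?L X (\<lambda>p. Q (shift i (at_height (f p) (h p))))"
    if "continuous_on local_box f" "continuous_on local_box h" for f h
    using that by (intro continuous_shift_map continuous_at_height) (auto simp: at_height_def)
  have idm: "continuous_map ?L X (\<lambda>p. Q (shift i p))"
    by (rule continuous_shift_map) (auto simp: local_box_def)
  let ?low = "\<lambda>p. if height p \<le> snd p then Q (shift i p)
    else Q (shift i (at_height ((3 * snd p - height p) / 2) ((snd p + height p) / 2)))"
  have low: "continuous_map ?L X ?low"
  proof (rule continuous_map_cases_le[OF _ _ continuous_map_from_subtopology[OF idm] continuous_map_from_subtopology[OF ah]])
    fix p assume p: "p \<in> topspace ?L" and h: "height p = snd p"
    then have "at_height ((3 * snd p - height p) / 2) ((snd p + height p) / 2) = at_height (snd p) (height p)" by simp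
    then show "Q (shift i p) = Q (shift i (at_height ((3 * snd p - height p) / 2) ((snd p + height p) / 2)))"
      using at_height_self[of p] p by simp
  qed (auto intro!: continuous_intros)
  have "continuous_map ?L X (\<lambda>p. if height p \<le> 2 * snd p then ?low p
      else Q (shift i (at_height (3 + (5 * snd p - 3 * height p) / 2) (3 + (3 * snd p - height p) / 2))))"
  proof (rule continuous_map_cases_le[OF _ _ continuous_map_from_subtopology[OF low] continuous_map_from_subtopology[OF ah]])
    fix p assume p: "p \<in> topspace ?L" and h: "height p = 2 * snd p"
    then have pb: "p \<in> local_box" by simp
    have x: "0 \<le> snd p" "snd p \<le> 2"
      using height_le_roof[OF pb] h pb unfolding le_roof_iff by (auto simp: local_box_def)
    define s where "s = snd p / 2"
    have s: "s \<in> {0..1}" using x by (simp add: s_def)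
    have e: "snd p = 2 * s" "height p = 4 * s" using h by (simp_all add: s_def)
    have "?low p = Q (shift i (at_height s (3 * s)))"
    proof (cases "s = 0")
      case True
      then have "at_height 0 0 = p" using at_height_self[OF pb] e by simp
      then show ?thesis using True e by simp
    qed (use e s in simp)
    then show "?low p = Q (shift i (at_height (3 + (5 * snd p - 3 * height p) / 2) (3 + (3 * snd p - height p) / 2)))"
      using Q_at_height_edge[OF i s] by (simp add: e)
  qed (auto intro!: continuous_intros)
  then show "continuous_map ?L X (\<lambda>p. Q (shift i (untwist_loc p)))"
    by (rule continuous_map_eq) (simp add: untwist_loc_def Let_def)
  show "Q (shift i (untwist_loc (1, s))) = Q (shift i (untwist_loc (1, 3 - s)))" if s: "s \<in> {0..1}" for s
    using untwist_loc_edges(1,2)[OF s] Q_corner[OF i] by (cases "s = 0") (simp_all add: shift_def)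
  show "Q (shift i (untwist_loc (1, 1 + s))) = Q (shift i (untwist_loc (1, 4 - s)))" if s: "s \<in> {0..1}" for s
    using untwist_loc_edges(3)[OF s]
  proof
    assume "untwist_loc (1, 1 + s) = (1, 1 + s)"
    then show ?thesis using untwist_loc_edges(4)[OF s] Q_glue(2)[OF i s] by (simp add: shift_def algebra_simps)
  next
    assume "s = 1 \<and> untwist_loc (1, 1 + s) = (1, 1)"
    then have "s = 1" "untwist_loc (1, 2) = (1, 1)" by auto
    then show ?thesis using untwist_loc_edges(4)[OF s] Q_corner[OF i] by (simp add: shift_def)
  qed
  show "Q (shift i (untwist_loc (0, x))) = Q (shift 0 (untwist_loc (0, 0)))" if "x \<in> {0..4}" for x
    using twist_loc_sides(6)[of 0] that by (simp add: shift_def) (rule Q_centre)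
next
  fix i and r :: real assume r: "r \<in> {0..1}"
  show "Q (shift i (untwist_loc (r, 4))) = Q (shift (Suc i) (untwist_loc (r, 0)))"
    using twist_loc_sides[OF r] by (simp add: shift_def algebra_simps)
next
  fix r :: real assume r: "r \<in> {0..1}"
  show "Q (shift (g - 1) (untwist_loc (r, 4))) = Q (shift 0 (untwist_loc (r, 0)))"
    using twist_loc_sides[OF r] Q_periodic[of r 0] g by (simp add: shift_def of_nat_diff)
qed (rule that)

text \<open>The identity holds only after the gluing. A point of the edge from \<open>v2\<close> to
  \<open>v3\<close> goes to the diagonal, where the inverse takes the branch that leads to its
  partner on the edge from \<open>v0\<close> to \<open>v1\<close>.\<close>

lemma untwist_twist:
  assumes i: "i < g" and p: "p \<in> local_box"
  shows "Q (shift i (untwist_loc (twist_loc p))) = Q (shift i p)"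
  using p
proof (cases rule: twist_loc_cases)
  case low
  moreover have "0 \<le> snd p" using p by (auto simp: local_box_def)
  ultimately show ?thesis by (simp add: untwist_loc_def Let_def)
next
  case (middle x' y')
  note ah = at_height[OF middle(5-7)]
  have r: "height p \<le> 3 * snd p" using height_le_roof[OF p] unfolding le_roof_iff by simp
  show ?thesis
  proof (cases "height p = snd p")
    case True
    then have "twist_loc p = p" using at_height_self[OF p] middle(3,4,8) by simp
    moreover have "0 \<le> snd p" using p by (auto simp: local_box_def)
    ultimately show ?thesis using True by (simp add: untwist_loc_def Let_def)
  next
    case False
    have "(3 * x' - y') / 2 = snd p" "(x' + y') / 2 = height p" "\<not> y' \<le> x'" "y' \<le> 2 * x'"
      using middle(1-4) False r by (simp_all add: field_simps)
    then have "untwist_loc (twist_loc p) = at_height (snd p) (height p)"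
      unfolding middle(8) untwist_loc_def Let_def ah by simp
    then show ?thesis using at_height_self[OF p] by simp
  qed
next
  case (high x' y')
  note ah = at_height[OF high(4-6)]
  have r: "height p \<le> 6 - snd p" "height p \<le> 12 - 3 * snd p" "height p \<le> snd p + 2" "height p \<le> 3 * snd p"
    using height_le_roof[OF p] unfolding le_roof_iff by simp_all
  show ?thesis
  proof (cases "height p = 6 - snd p")
    case True
    define s where "s = 3 - snd p"
    have s: "s \<in> {0..1}" "s \<noteq> 0" using high(1) r True by (simp_all add: s_def)
    have e: "x' = 2 * s" "y' = 4 * s" "snd p = 3 - s" "height p = 3 + s" using high(2,3) True by (simp_all add: s_def field_simps)
    have "untwist_loc (twist_loc p) = at_height s (3 * s)"
      unfolding high(7) untwist_loc_def Let_def ah using s by (simp add: e)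
    then show ?thesis using Q_at_height_edge[OF i s(1)] at_height_self[OF p] by (simp add: e)
  next
    case False
    have "3 + (5 * x' - 3 * y') / 2 = snd p" "3 + (3 * x' - y') / 2 = height p" "\<not> y' \<le> 2 * x'"
      using high(1-3) False r by (simp_all add: field_simps)
    then have "untwist_loc (twist_loc p) = at_height (snd p) (height p)"
      unfolding high(7) untwist_loc_def Let_def ah by simp
    then show ?thesis using at_height_self[OF p] by simp
  qed
qed

text \<open>The exceptional points are those of the edge from \<open>v0\<close> to
  \<open>v1\<close>: they go to the tear at height 3, and the twist returns them to the partner edge
  from \<open>v2\<close> to \<open>v3\<close>.\<close>

lemma twist_untwist:
  assumes i: "i < g" and p: "p \<in> local_box"
  shows "Q (shift i (twist_loc (untwist_loc p))) = Q (shift i p)"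
  using p
proof (cases rule: untwist_loc_cases)
  case low
  have "0 \<le> snd p" using p by (auto simp: local_box_def)
  have "height p \<le> 3" using low height_le_roof[OF p] unfolding le_roof_iff by simp
  moreover have "at_height ((snd p + height p) / 2) ((3 * height p - snd p) / 2) = p" if "snd p = height p"
    using at_height_self[OF p] that by simp
  ultimately have "twist_loc p = p" using low by (simp add: twist_loc_def Let_def)
  then show ?thesis using low by simp
next
  case (middle x' y')
  note ah = at_height[OF middle(5-7)]
  have r: "height p \<le> 6 - snd p" using height_le_roof[OF p] unfolding le_roof_iff by simp
  have "(x' + y') / 2 = snd p" "(3 * y' - x') / 2 = height p" "x' \<le> y'" "y' \<le> 3"
    using middle(1-4) r by (simp_all add: field_simps)
  then have "twist_loc (untwist_loc p) = at_height (snd p) (height p)"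
    unfolding middle(8) twist_loc_def Let_def ah by simp
  then show ?thesis using at_height_self[OF p] by simp
next
  case (high x' y')
  note ah = at_height[OF high(4-6)]
  have r: "height p \<le> 3 * snd p" "height p \<le> snd p + 2"
    using height_le_roof[OF p] unfolding le_roof_iff by simp_all
  show ?thesis
  proof (cases "height p = 3 * snd p")
    case True
    define s where "s = snd p"
    have s: "s \<in> {0..1}" "s \<noteq> 0" using high(1) r True p by (simp_all add: s_def local_box_def)
    have e: "x' = 3 - 2 * s" "y' = 3" "snd p = s" "height p = 3 * s" using high(2,3) True by (simp_all add: s_def field_simps)
    have "(x' + y') / 2 = 3 - s" "(3 * y' - x') / 2 = 3 + s" "x' \<le> y'" using e s by simp_all
    then have "twist_loc (untwist_loc p) = at_height (3 - s) (3 + s)"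
      unfolding high(7) twist_loc_def Let_def ah using e(2) by (simp only: order_refl if_True)
    then show ?thesis using Q_at_height_edge[OF i s(1)] at_height_self[OF p] by (simp add: e)
  next
    case False
    have "(3 * y' - x') / 2 - 3 = snd p" "(5 * y' - 3 * x') / 2 - 3 = height p" "\<not> y' \<le> 3"
      using high(1-3) False r by (simp_all add: field_simps)
    then have "twist_loc (untwist_loc p) = at_height (snd p) (height p)"
      unfolding high(7) twist_loc_def Let_def ah by simp
    then show ?thesis using at_height_self[OF p] by simp
  qed
qed


section \<open>Action of the twist and of the reflection on winding numbers\<close>

lemma topspace_rect:
  assumes "x \<in> topspace X"
  obtains r t where "(r, t) \<in> rect" "x = Q (r, t)"
  using assms unfolding Q_image[symmetric] by auto

lemma shift_in_rect: "i < g \<Longrightarrow> p \<in> local_box \<Longrightarrow> shift i p \<in> rect"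
  using handle_le by (fastforce simp: shift_def local_box_def rect_def)

text \<open>As the edge \<open>a\<close> becomes \<open>a b\<close> and \<open>b\<close> is fixed,
  the class dual to \<open>b\<close> (odd \<open>j\<close>) pulls back to the sum of the classes
  dual to \<open>a\<close> and \<open>b\<close>, while the class dual to \<open>a\<close> is kept.
  The function \<open>w\<close> is the difference \<open>\<psi>\<close> of real lifts, made
  single-valued by an integer.\<close>

lemma twist_potential:
  assumes T: "\<And>i p. i < g \<Longrightarrow> p \<in> local_box \<Longrightarrow> T (Q (shift i p)) = Q (shift i (twist_loc p))"
    and j: "letter g j" and j': "odd j \<Longrightarrow> letter g (j - 1)"
  obtains w where "continuous_map X euclideanreal w"
    "\<And>x. x \<in> topspace X \<Longrightarrow>
       turn j (T x) = turn j x * (if odd j then turn (j - 1) x else 1) * cis (2 * pi * w x)"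
proof -
  define R where "R k i p = fst p * ramp k (4 * real i + snd p)" for k i p
  define S where "S i p = R j i p + (if odd j then R (j - 1) i p else 0)" for i p
  \<comment> \<open>For the letter \<open>b\<close> the ramp is 0 on one copy of the edge
    \<open>a\<close> and 1 on the other. The two sides of the tear land on these copies, and
    \<open>n\<close> supplies the missing 1 above the tear.\<close>
  define n where "n i p = (if j = 4 * i + 1 \<and> 3 < height p then 1 else 0 :: real)" for i p
  define \<psi> where "\<psi> i p = R j i (twist_loc p) + n i p - S i p" for i p
  have R_cont: "continuous_on local_box (\<lambda>p. R k i (f p))" if "continuous_on local_box f" for k i f
    unfolding R_def by (intro continuous_intros continuous_on_compose2[OF continuous_ramp[of UNIV k]] that) auto
  have S_cont: "continuous_on local_box (S i)" for i
    unfolding S_def by (cases "odd j") (auto intro!: continuous_intros R_cont)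
  have ra: "R j i (1, s) = R j i (1, 3 - s) + (if j = 4 * i + 1 then -1 else 0)"
    "R j i (1, 1 + s) = R j i (1, 4 - s) + (if j = 4 * i then 1 else 0)" if "s \<in> {0..1}" for i s
    using ramp_glue[OF j that, of i] by (simp_all add: R_def algebra_simps)
  have ra': "R (j - 1) i (1, s) = R (j - 1) i (1, 3 - s)"
    "R (j - 1) i (1, 1 + s) = R (j - 1) i (1, 4 - s) + (if j = 4 * i + 1 then 1 else 0)"
    if "s \<in> {0..1}" "odd j" for i s
  proof -
    obtain k where k: "j = 4 * k \<or> j = 4 * k + 1" using j by (auto simp: letter_def)
    then have "j = 4 * k + 1" using that(2) by auto
    then have "j - 1 \<noteq> 4 * i + 1" "j - 1 = 4 * i \<longleftrightarrow> j = 4 * i + 1" by presburger+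
    then show "R (j - 1) i (1, s) = R (j - 1) i (1, 3 - s)"
      "R (j - 1) i (1, 1 + s) = R (j - 1) i (1, 4 - s) + (if j = 4 * i + 1 then 1 else 0)"
      using ramp_glue[OF j'[OF that(2)] that(1), of i] by (simp_all add: R_def algebra_simps)
  qed
  have eo: "j = 4 * i + 1 \<Longrightarrow> odd j" "j = 4 * i \<Longrightarrow> even j" for i by simp_all
  obtain w where w: "continuous_map X euclideanreal w"
    "\<And>i p. i < g \<Longrightarrow> p \<in> local_box \<Longrightarrow> w (Q (shift i p)) = \<psi> i p"
  proof (rule handlewise_map[of euclideanreal \<psi>])
    fix i assume i: "i < g"
    have "continuous_map (top_of_set local_box) euclideanreal (\<lambda>p. if height p \<le> 3
        then R j i (twist_loc p) - S i p else R j i (twist_loc p) + (if j = 4 * i + 1 then 1 else 0) - S i p)"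
    proof (rule continuous_map_twist[where \<Phi> = "\<lambda>p z. R j i z - S i p"
          and \<Psi> = "\<lambda>p z. R j i z + (if j = 4 * i + 1 then 1 else 0) - S i p"])
      show "R j i (1, 3 - s) - S i p = R j i (1, s) + (if j = 4 * i + 1 then 1 else 0) - S i p" if "s \<in> {0..1}" for p s
        using ra(1)[OF that, of i] by simp
    qed (auto intro!: continuous_intros R_cont S_cont)
    then show "continuous_map (top_of_set local_box) euclideanreal (\<psi> i)"
      by (rule continuous_map_eq) (simp add: \<psi>_def n_def)
    show "\<psi> i (1, s) = \<psi> i (1, 3 - s)" if s: "s \<in> {0..1}" for s
    proof (cases "s = 0")
      case True
      have "at_height 0 0 = (1, 0)" using at_height_roof[of 0] by (simp add: roof_def)
      then show ?thesis
        using twist_loc_edges(1,2)[OF s] True ra(1)[OF s, of i] ra'(1)[OF s, of i] eo[of i] s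
        by (auto simp: \<psi>_def n_def S_def height_rim roof_edges roof_def)
    next
      case False
      then show ?thesis
        using twist_loc_edges(1,2)[OF s] ra(1)[OF s, of i] ra'(1)[OF s, of i] eo[of i] s
        by (auto simp: \<psi>_def n_def S_def height_rim roof_edges)
    qed
    show "\<psi> i (1, 1 + s) = \<psi> i (1, 4 - s)" if s: "s \<in> {0..1}" for s
    proof (cases "s = 0")
      case True
      have "R j i (1, 2) = R j i (1, 1) + (if j = 4 * i + 1 then 1 else 0)"
        using ra(1)[of 1 i] ra(2)[of 0 i] ra(2)[of 1 i] ra(1)[of 0 i] eo[of i] by (auto split: if_splits)
      then show ?thesis
        using twist_loc_edges(3,4)[OF s] True ra(2)[OF s, of i] ra'(2)[OF s, of i] eo[of i] s
        by (auto simp: \<psi>_def n_def S_def height_rim roof_edges roof_def)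
    next
      case False
      then show ?thesis
        using twist_loc_edges(3,4)[OF s] ra(2)[OF s, of i] ra'(2)[OF s, of i] eo[of i] s
        by (auto simp: \<psi>_def n_def S_def height_rim roof_edges)
    qed
    show "\<psi> i (0, x) = \<psi> 0 (0, 0)" if x: "x \<in> {0..4}" for x
    proof -
      have "twist_loc (0, x) = (0, x)" "twist_loc (0, 0) = (0, 0)" using twist_loc_sides(3)[of 0 x] twist_loc_sides(3)[of 0 0] x by auto
      moreover have "height (0, x) \<le> 3" "height (0, 0) \<le> 3" using roof_bounds(2)[of x] roof_bounds(2)[of 0] by (auto simp: height_def)
      ultimately show ?thesis by (simp add: \<psi>_def n_def S_def R_def)
    qed
  next
    fix i and r :: real assume r: "r \<in> {0..1}"
    have h: "height (r, 0) \<le> 3" "height (r, 4) \<le> 3" using r by (auto simp: height_def roof_def)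
    show "\<psi> i (r, 4) = \<psi> (Suc i) (r, 0)"
      using twist_loc_sides[OF r] h by (simp add: \<psi>_def n_def S_def R_def algebra_simps)
  next
    fix r :: real assume r: "r \<in> {0..1}"
    have h: "height (r, 0) \<le> 3" "height (r, 4) \<le> 3" using r by (auto simp: height_def roof_def)
    have "4 * real (g - 1) + 4 = 4 * real g" using g by (simp add: of_nat_diff)
    then show "\<psi> (g - 1) (r, 4) = \<psi> 0 (r, 0)"
      using twist_loc_sides[OF r] h ramp_ends[OF j] ramp_ends[OF j'] by (simp add: \<psi>_def n_def S_def R_def)
  qed (rule that)
  show ?thesis
  proof (rule that[OF w(1)])
    fix x assume "x \<in> topspace X"
    then obtain i p where x: "i < g" "p \<in> local_box" "x = Q (shift i p)" by (rule shift_cover)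
    have t: "turn j (T x) = cis (2 * pi * R j i (twist_loc p))"
      unfolding x(3) T[OF x(1,2)] turn(2)[OF j shift_in_rect[OF x(1) twist_loc_box[OF x(2)]]]
      by (simp add: R_def shift_def)
    have tj: "turn k x = cis (2 * pi * R k i p)" if "letter g k" for k
      unfolding x(3) turn(2)[OF that shift_in_rect[OF x(1,2)]] by (simp add: R_def shift_def)
    have "turn j x * (if odd j then turn (j - 1) x else 1) = cis (2 * pi * S i p)"
      using tj[OF j] tj[OF j'] by (simp add: S_def distrib_left flip: cis_mult)
    then have "turn j x * (if odd j then turn (j - 1) x else 1) * cis (2 * pi * w x) = cis (2 * pi * (S i p + w x))"
      by (simp only: cis_mult distrib_left)
    also have "\<dots> = cis (2 * pi * R j i (twist_loc p))"
      using w(2)[OF x(1,2)] by (intro cis_int) (simp add: x(3) \<psi>_def n_def)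
    finally show "turn j (T x) = turn j x * (if odd j then turn (j - 1) x else 1) * cis (2 * pi * w x)"
      using t by simp
  qed
qed

lemma twist_winding:
  assumes T: "continuous_map X X T"
      "\<And>i p. i < g \<Longrightarrow> p \<in> local_box \<Longrightarrow> T (Q (shift i p)) = Q (shift i (twist_loc p))"
    and k: "k < g" and c: "singular_relcycle 1 X {} c"
  shows "winding (turn (4 * k)) (chain_map 1 T c) = winding (turn (4 * k)) c"
    "winding (turn (4 * k + 1)) (chain_map 1 T c) = winding (turn (4 * k + 1)) c + winding (turn (4 * k)) c"
proof -
  have l: "letter g (4 * k)" "letter g (4 * k + 1)" using k by (auto simp: letter_def)
  have one: "circle_valued X (\<lambda>_. 1)" by (simp add: circle_valued_def)
  have zero: "winding (\<lambda>_. 1) c = 0"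
  proof -
    have "winding (\<lambda>_. 1) c = chain_eval (\<lambda>\<tau>. (\<lambda>_. 0) (base_val \<tau>)) (chain_boundary 1 c)"
      using c by (intro winding_potential[of X]) (auto simp: singular_cycle intro!: exI[of _ 1])
    then show ?thesis by (simp add: chain_eval_def)
  qed
  obtain w where w: "continuous_map X euclideanreal w" "\<And>x. x \<in> topspace X \<Longrightarrow>
      turn (4 * k) (T x) = turn (4 * k) x * (if odd (4 * k) then turn (4 * k - 1) x else 1) * cis (2 * pi * w x)"
    by (rule twist_potential[OF T(2) l(1)]) auto
  show "winding (turn (4 * k)) (chain_map 1 T c) = winding (turn (4 * k)) c"
    unfolding winding_chain_map
    using winding_mult[OF c turn_circle_valued[OF l(1)] one w(1), of "turn (4 * k) \<circ> T"] w(2) zero by simp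
  obtain w where w: "continuous_map X euclideanreal w" "\<And>x. x \<in> topspace X \<Longrightarrow>
      turn (4 * k + 1) (T x) = turn (4 * k + 1) x * (if odd (4 * k + 1) then turn (4 * k + 1 - 1) x else 1) * cis (2 * pi * w x)"
    by (rule twist_potential[OF T(2) l(2)]) (use l(1) in auto)
  show "winding (turn (4 * k + 1)) (chain_map 1 T c) = winding (turn (4 * k + 1)) c + winding (turn (4 * k)) c"
    unfolding winding_chain_map
    using winding_mult[OF c turn_circle_valued[OF l(2)] turn_circle_valued[OF l(1)] w(1), of "turn (4 * k + 1) \<circ> T"] w(2) by simp
qed

text \<open>Read backwards, a handle has its two edge pairings exchanged, so the reflection respects
  the gluing. It reverses the order of the handles and exchanges the letters \<open>a\<close> and
  \<open>b\<close>.\<close>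

lemma reflection_exists:
  obtains C where "continuous_map X X C"
    "\<And>r t. (r, t) \<in> rect \<Longrightarrow> C (Q (r, t)) = Q (r, 4 * real g - t)"
proof -
  let ?f = "\<lambda>p. Q (fst p, 4 * real g - snd p)"
  have cont: "continuous_map (top_of_set rect) X ?f"
    by (rule continuous_map_Q) (auto simp: rect_def intro!: continuous_intros)
  have comp: "compatible ?f"
    unfolding compatible_def
  proof (intro conjI ballI allI impI)
    fix i s assume i: "i < g" and s: "s \<in> {0..1::real}"
    define i' where "i' = g - 1 - i"
    have i': "i' < g" "real g = real i + 1 + real i'" using i by (simp_all add: i'_def of_nat_diff)
    have e: "4 * real g - (4 * real i + s) = 4 * real i' + 4 - s" "4 * real g - (4 * real i + 3 - s) = 4 * real i' + 1 + s"
      "4 * real g - (4 * real i + 1 + s) = 4 * real i' + 3 - s" "4 * real g - (4 * real i + 4 - s) = 4 * real i' + s"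
      using i'(2) by simp_all
    show "?f (1, 4 * real i + s) = ?f (1, 4 * real i + 3 - s)"
      "?f (1, 4 * real i + 1 + s) = ?f (1, 4 * real i + 4 - s)"
      unfolding fst_conv snd_conv e using Q_glue[OF i'(1) s] by simp_all
  next
    fix r :: real assume "r \<in> {0..1}"
    show "?f (r, 4 * real g) = ?f (r, 0)" using Q_periodic[of r 0] by simp
  next
    fix t show "?f (0, t) = ?f (0, 0)" unfolding fst_conv by (rule Q_centre)
  qed
  show ?thesis
  proof (rule map_from_Q[OF cont comp])
    fix h assume "continuous_map X X h" "\<And>p. p \<in> rect \<Longrightarrow> h (Q p) = ?f p"
    then show thesis by (intro that[of h]) auto
  qed
qed

lemma ramp_reflect:
  assumes "i < g"
  shows "ramp (4 * i) (4 * real g - t) = ramp (4 * (g - 1 - i) + 1) t"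
    "ramp (4 * i + 1) (4 * real g - t) = ramp (4 * (g - 1 - i)) t"
proof -
  have "real g = real i + 1 + real (g - 1 - i)" using assms by (simp add: of_nat_diff)
  then have e: "4 * real g - t - real (4 * i) = real (4 * (g - 1 - i) + 1) + 3 - t"
    "real (4 * i) + 3 - (4 * real g - t) = t - real (4 * (g - 1 - i) + 1)"
    "4 * real g - t - real (4 * i + 1) = real (4 * (g - 1 - i)) + 3 - t"
    "real (4 * i + 1) + 3 - (4 * real g - t) = t - real (4 * (g - 1 - i))"
    unfolding of_nat_add of_nat_mult of_nat_1 of_nat_numeral by linarith+
  show "ramp (4 * i) (4 * real g - t) = ramp (4 * (g - 1 - i) + 1) t"
    "ramp (4 * i + 1) (4 * real g - t) = ramp (4 * (g - 1 - i)) t"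
    unfolding ramp_def e by (metis min.commute)+
qed

lemma reflection_winding:
  assumes C: "\<And>r t. (r, t) \<in> rect \<Longrightarrow> C (Q (r, t)) = Q (r, 4 * real g - t)"
    and i: "i < g" and c: "singular_chain 1 X c"
  shows "winding (turn (4 * i)) (chain_map 1 C c) = winding (turn (4 * (g - 1 - i) + 1)) c"
    "winding (turn (4 * i + 1)) (chain_map 1 C c) = winding (turn (4 * (g - 1 - i))) c"
proof -
  let ?i = "g - 1 - i"
  have "?i < g" using i by simp
  then have l: "letter g (4 * i)" "letter g (4 * i + 1)" "letter g (4 * ?i)" "letter g (4 * ?i + 1)"
    using i unfolding letter_def by blast+
  have eq: "turn (4 * i) (C x) = turn (4 * ?i + 1) x" "turn (4 * i + 1) (C x) = turn (4 * ?i) x"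
    if "x \<in> topspace X" for x
  proof -
    from that obtain r t where x: "(r, t) \<in> rect" "x = Q (r, t)" by (rule topspace_rect)
    then have m: "(r, 4 * real g - t) \<in> rect" by (auto simp: rect_def)
    show "turn (4 * i) (C x) = turn (4 * ?i + 1) x" "turn (4 * i + 1) (C x) = turn (4 * ?i) x"
      unfolding x(2) C[OF x(1)] turn(2)[OF l(1) m] turn(2)[OF l(2) m] turn(2)[OF l(3) x(1)] turn(2)[OF l(4) x(1)]
      by (simp_all only: fst_conv snd_conv ramp_reflect[OF i])
  qed
  have path: "simplex_path \<sigma> s \<in> topspace X" if "\<sigma> \<in> Poly_Mapping.keys c" "s \<in> {0..1}" for \<sigma> s
    using c that by (intro simplex_path_in) (auto simp: singular_chain_def)
  show "winding (turn (4 * i)) (chain_map 1 C c) = winding (turn (4 * ?i + 1)) c"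
    "winding (turn (4 * i + 1)) (chain_map 1 C c) = winding (turn (4 * ?i)) c"
    unfolding winding_chain_map
    by (intro chain_eval_cong wind_cong, simp only: comp_apply eq path)+
qed

text \<open>On winding numbers \<open>F\<close> is the matrix ((1, 1), (1, 0)) combined with the
  reversal of the order of the handles, which cancels in the square. Near the centre
  \<open>F\<close> is the reflection alone, so its square is the identity there.\<close>

theorem fibonacci_homeomorphism:
  obtains F where "homeomorphic_map X X F" "orientation_preserving X (F \<circ> F)"
    "\<And>i c. i < g \<Longrightarrow> singular_relcycle 1 X {} c \<Longrightarrow> winding (turn (4 * i)) (chain_map 1 (F \<circ> F) c)
       = 2 * winding (turn (4 * i)) c + winding (turn (4 * i + 1)) c"
    "\<And>i c. i < g \<Longrightarrow> singular_relcycle 1 X {} c \<Longrightarrow> winding (turn (4 * i + 1)) (chain_map 1 (F \<circ> F) c)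
       = winding (turn (4 * i)) c + winding (turn (4 * i + 1)) c"
proof -
  obtain T where T: "continuous_map X X T"
    "\<And>i p. i < g \<Longrightarrow> p \<in> local_box \<Longrightarrow> T (Q (shift i p)) = Q (shift i (twist_loc p))"
    by (rule twist_exists) blast
  obtain U where U: "continuous_map X X U"
    "\<And>i p. i < g \<Longrightarrow> p \<in> local_box \<Longrightarrow> U (Q (shift i p)) = Q (shift i (untwist_loc p))"
    by (rule untwist_exists) blast
  obtain C where C: "continuous_map X X C"
    "\<And>r t. (r, t) \<in> rect \<Longrightarrow> C (Q (r, t)) = Q (r, 4 * real g - t)"
    by (rule reflection_exists) blast
  define F where "F = C \<circ> T"
  have contF: "continuous_map X X F" unfolding F_def by (rule continuous_map_compose[OF T(1) C(1)])
  have UT: "U (T x) = x" and TU: "T (U x) = x" if "x \<in> topspace X" for x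
  proof -
    from that obtain i p where x: "i < g" "p \<in> local_box" "x = Q (shift i p)" by (rule shift_cover)
    show "U (T x) = x"
      unfolding x(3) T(2)[OF x(1,2)] U(2)[OF x(1) twist_loc_box[OF x(2)]] by (rule untwist_twist[OF x(1,2)])
    show "T (U x) = x"
      unfolding x(3) U(2)[OF x(1,2)] T(2)[OF x(1) untwist_loc_box[OF x(2)]] by (rule twist_untwist[OF x(1,2)])
  qed
  have CC: "C (C x) = x" if "x \<in> topspace X" for x
  proof -
    from that obtain r t where x: "(r, t) \<in> rect" "x = Q (r, t)" by (rule topspace_rect)
    then have "(r, 4 * real g - t) \<in> rect" by (auto simp: rect_def)
    then show ?thesis using C(2) x by simp
  qed
  have inX: "T x \<in> topspace X" "U x \<in> topspace X" "C x \<in> topspace X" if "x \<in> topspace X" for x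
    using T(1) U(1) C(1) that by (auto simp: continuous_map)
  have hom: "homeomorphic_map X X F"
  proof -
    have "homeomorphic_maps X X F (U \<circ> C)"
      unfolding homeomorphic_maps_def F_def
      using UT TU CC inX continuous_map_compose[OF T(1) C(1)] continuous_map_compose[OF C(1) U(1)] by simp
    then show ?thesis using homeomorphic_map_maps by blast
  qed
  have ori: "orientation_preserving X (F \<circ> F)"
  proof (rule trivial_on_disc_imp_orientation_preserving)
    show "continuous_map X X (F \<circ> F)" by (rule continuous_map_compose[OF contF contF])
    show "(0::real) < 1/2" "(1/2::real) \<le> 1" by simp_all
    have T_id: "T (Q (r, t)) = Q (r, t)" if "(r, t) \<in> rect" "r < 1/2" for r t
    proof -
      have "Q (r, t) \<in> topspace X" using that(1) by (intro Q_in_topspace) (auto simp: rect_def)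
      then obtain i p where x: "i < g" "p \<in> local_box" "Q (r, t) = Q (shift i p)" by (rule shift_cover)
      have "fst (shift i p) < 1/2"
        using that x(3) open_disc_iff[of "1/2" "(r, t)"] open_disc_iff[of "1/2" "shift i p"] shift_in_rect[OF x(1,2)] by simp
      then have "twist_loc p = p"
        using twist_loc_sides(3)[of "fst p" "snd p"] x(2) by (cases p) (auto simp: shift_def local_box_def)
      then show ?thesis using T(2)[OF x(1,2)] x(3) by simp
    qed
    fix x assume "x \<in> open_disc (1/2)"
    then obtain r t where x: "(r, t) \<in> rect" "r < 1/2" "x = Q (r, t)" by (auto simp: open_disc_def)
    have m: "(r, 4 * real g - t) \<in> rect" using x(1) by (auto simp: rect_def)
    have "F x = Q (r, 4 * real g - t)" using T_id[OF x(1,2)] C(2)[OF x(1)] by (simp add: F_def x(3))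
    moreover have "F (Q (r, 4 * real g - t)) = x" using T_id[OF m x(2)] C(2)[OF m] by (simp add: F_def x(3))
    ultimately show "(F \<circ> F) x = x" by simp
  next
    have "F x \<in> punctured" if "x \<in> punctured" for x
    proof -
      have "x \<in> topspace X" using that openin_subset[OF punctured_open] by blast
      then obtain i p where x: "i < g" "p \<in> local_box" "x = Q (shift i p)" by (rule shift_cover)
      have pos: "Q p' \<in> punctured \<longleftrightarrow> 0 < fst p'" if "p' \<in> rect" for p'
        unfolding punctured_def Un_iff region_iff[OF slit_rule_round that] region_iff[OF slit_rule_edge that]
        using slit_Un that by (simp only: rectL_def mem_Collect_eq) blast
      have "0 < fst p" using that pos[OF shift_in_rect[OF x(1,2)]] by (simp add: x(3) shift_def)
      then have f: "0 < fst (shift i (twist_loc p))" using twist_loc_fst_pos[OF x(2)] by (simp add: shift_def)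
      have r: "shift i (twist_loc p) \<in> rect" using shift_in_rect[OF x(1) twist_loc_box[OF x(2)]] .
      obtain r' t' where e: "shift i (twist_loc p) = (r', t')" by (cases "shift i (twist_loc p)")
      then have m: "(r', 4 * real g - t') \<in> rect" using r by (auto simp: rect_def)
      have "F x = Q (r', 4 * real g - t')" using C(2) r T(2)[OF x(1,2)] by (simp add: F_def x(3) e)
      then show ?thesis using pos[OF m] f by (simp add: e)
    qed
    then show "(F \<circ> F) ` punctured \<subseteq> punctured" by auto
  qed
  have cycT: "singular_relcycle 1 X {} (chain_map 1 T c)" and cycF: "singular_relcycle 1 X {} (chain_map 1 F c)"
    if "singular_relcycle 1 X {} c" for c
    using singular_relcycle_chain_map[OF that T(1)] singular_relcycle_chain_map[OF that contF] by auto
  have comp: "chain_map 1 F c = chain_map 1 C (chain_map 1 T c)" "chain_map 1 (F \<circ> F) c = chain_map 1 F (chain_map 1 F c)" for c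
    by (simp_all add: F_def chain_map_compose)
  have W: "winding (turn (4 * i)) (chain_map 1 F c) = winding (turn (4 * (g - 1 - i))) c + winding (turn (4 * (g - 1 - i) + 1)) c"
    "winding (turn (4 * i + 1)) (chain_map 1 F c) = winding (turn (4 * (g - 1 - i))) c"
    if i: "i < g" and c: "singular_relcycle 1 X {} c" for i c
  proof -
    have i': "g - 1 - i < g" using i by simp
    have ch: "singular_chain 1 X (chain_map 1 T c)" using cycT[OF c] by (simp add: singular_cycle)
    have r: "winding (turn (4 * i)) (chain_map 1 C (chain_map 1 T c)) = winding (turn (4 * (g - 1 - i) + 1)) (chain_map 1 T c)"
      "winding (turn (4 * i + 1)) (chain_map 1 C (chain_map 1 T c)) = winding (turn (4 * (g - 1 - i))) (chain_map 1 T c)"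
      by (rule reflection_winding[OF _ i ch]; rule C(2); assumption)+
    have t: "winding (turn (4 * (g - 1 - i))) (chain_map 1 T c) = winding (turn (4 * (g - 1 - i))) c"
      "winding (turn (4 * (g - 1 - i) + 1)) (chain_map 1 T c)
        = winding (turn (4 * (g - 1 - i) + 1)) c + winding (turn (4 * (g - 1 - i))) c"
      by (rule twist_winding[OF T(1) _ i' c]; rule T(2); assumption)+
    show "winding (turn (4 * i)) (chain_map 1 F c) = winding (turn (4 * (g - 1 - i))) c + winding (turn (4 * (g - 1 - i) + 1)) c"
      "winding (turn (4 * i + 1)) (chain_map 1 F c) = winding (turn (4 * (g - 1 - i))) c"
      unfolding comp(1) r t by (rule add.commute, rule refl)
  qed
  show ?thesis
  proof (rule that[OF hom ori])
    fix i c assume i: "i < g" and c: "singular_relcycle 1 X {} c"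
    have i': "g - 1 - i < g" "g - 1 - (g - 1 - i) = i" using i by auto
    show "winding (turn (4 * i)) (chain_map 1 (F \<circ> F) c) = 2 * winding (turn (4 * i)) c + winding (turn (4 * i + 1)) c"
      "winding (turn (4 * i + 1)) (chain_map 1 (F \<circ> F) c) = winding (turn (4 * i)) c + winding (turn (4 * i + 1)) c"
      unfolding comp(2) W[OF i cycF[OF c]] W[OF i'(1) c] i'(2) by simp_all
  qed
qed

text \<open>The loop is edge number 1, the letter \<open>b\<close> of handle 0, closed because both
  ends are corners. Along it the ramp of \<open>b\<close> climbs from 0 to 1 while the ramp of
  \<open>a\<close> is on its plateau.\<close>

lemma edge_loop:
  obtains c where "singular_relcycle 1 X {} c" "winding (turn 0) c = 0" "winding (turn 1) c = 1"
proof -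
  define \<gamma> where "\<gamma> s = Q (1, 1 + s)" for s :: real
  have g0: "0 < g" using g by simp
  have "continuous_map (top_of_set {0..1}) X \<gamma>"
    unfolding \<gamma>_def by (rule continuous_map_Q) (auto intro!: continuous_intros)
  then have path: "pathin X \<gamma>" by (simp add: pathin_def)
  have "\<gamma> 0 = \<gamma> 1" using Q_corner[OF g0] by (simp add: \<gamma>_def)
  then have "chain_boundary 1 (frag_of (path_simplex \<gamma>)) = 0"
    by (simp only: chain_boundary_1_of face_path_simplex) simp
  then have cyc: "singular_relcycle 1 X {} (frag_of (path_simplex \<gamma>))"
    unfolding singular_cycle singular_chain_of using singular_simplex_path_simplex[OF path] by blast
  have l: "letter g 0" "letter g 1" using g0 by (auto simp: letter_def)
  have w: "wind (turn j) (path_simplex \<gamma>) = ramp j 2 - ramp j 1" if "letter g j" for j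
  proof -
    have "(1, 1 + s) \<in> rect" if "s \<in> {0..1}" for s :: real
    proof -
      have "1 \<le> real g" using g by simp
      then show ?thesis using that by (simp add: rect_def)
    qed
    then have "angle_lift (turn j) (simplex_path (path_simplex \<gamma>)) (\<lambda>s. ramp j (1 + s))"
      using turn(2)[OF that]
      by (auto simp: angle_lift_def simplex_path_path_simplex \<gamma>_def
          intro!: continuous_intros continuous_on_compose2[OF continuous_ramp[of UNIV j]])
    from wind_eq[OF this] show ?thesis by simp
  qed
  show ?thesis
    by (rule that[OF cyc]) (simp_all only: chain_eval_of w[OF l(1)] w[OF l(2)], simp_all add: ramp_def)
qed

end

section \<open>The subgroup of mapping classes acting by a sign modulo 3\<close>

lemma frag_cmul_right_diff: "frag_cmul k (a - b) = frag_cmul k a - frag_cmul k b"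
  by (rule poly_mapping_eqI) (simp add: lookup_minus right_diff_distrib)

lemma mod_boundary_add:
  assumes "mod_boundary m p X a" "mod_boundary m p X b"
  shows "mod_boundary m p X (a + b)"
proof -
  obtain d e d' e' where *: "singular_chain (Suc p) X d" "singular_chain p X e" "a = chain_boundary (Suc p) d + frag_cmul (int m) e"
    "singular_chain (Suc p) X d'" "singular_chain p X e'" "b = chain_boundary (Suc p) d' + frag_cmul (int m) e'"
    using assms by (auto simp: mod_boundary_def)
  have "a + b = chain_boundary (Suc p) (d + d') + frag_cmul (int m) (e + e')"
    unfolding *(3,6) by (simp add: chain_boundary_add frag_cmul_distrib2 algebra_simps)
  then show ?thesis
    using * singular_chain_add unfolding mod_boundary_def by blast
qed

lemma mod_boundary_cmul:
  assumes "mod_boundary m p X a"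
  shows "mod_boundary m p X (frag_cmul k a)"
proof -
  obtain d e where *: "singular_chain (Suc p) X d" "singular_chain p X e" "a = chain_boundary (Suc p) d + frag_cmul (int m) e"
    using assms by (auto simp: mod_boundary_def)
  have "frag_cmul k a = chain_boundary (Suc p) (frag_cmul k d) + frag_cmul (int m) (frag_cmul k e)"
    unfolding *(3) by (simp add: chain_boundary_cmul frag_cmul_distrib2 mult.commute)
  then show ?thesis
    using * singular_chain_cmul unfolding mod_boundary_def by blast
qed

lemma mod_boundary_chain_map:
  assumes "mod_boundary m p X a" "continuous_map X Y f"
  shows "mod_boundary m p Y (chain_map p f a)"
proof -
  obtain d e where *: "singular_chain (Suc p) X d" "singular_chain p X e" "a = chain_boundary (Suc p) d + frag_cmul (int m) e"
    using assms by (auto simp: mod_boundary_def)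
  have "chain_map p f a = chain_boundary (Suc p) (chain_map (Suc p) f d) + frag_cmul (int m) (chain_map p f e)"
    unfolding *(3) using chain_boundary_chain_map[OF *(1), of f] by (simp add: chain_map_add)
  then show ?thesis
    using singular_chain_chain_map[OF *(1) assms(2)] singular_chain_chain_map[OF *(2) assms(2)]
    unfolding mod_boundary_def by blast
qed

text \<open>One sign serves for all cycles. Testing integral cycles is enough to describe the action
  on homology modulo 3: they represent all its classes, because the zeroth homology is free.\<close>

definition acts_by_sign :: "'a topology \<Rightarrow> ('a \<Rightarrow> 'a) \<Rightarrow> bool" where
  "acts_by_sign X f \<longleftrightarrow> (\<exists>\<epsilon>\<in>{1, -1}. \<forall>c. singular_relcycle 1 X {} c \<longrightarrow>
     mod_boundary 3 1 X (chain_map 1 f c - frag_cmul \<epsilon> c))"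

lemma acts_by_signE:
  assumes "acts_by_sign X f"
  obtains \<epsilon> where "\<epsilon> \<in> {1, -1}"
    "\<And>c. singular_relcycle 1 X {} c \<Longrightarrow> mod_boundary 3 1 X (chain_map 1 f c - frag_cmul \<epsilon> c)"
  using assms unfolding acts_by_sign_def by blast

lemma chain_map_compose_restrict:
  assumes "singular_chain p X c"
  shows "chain_map p (compose (topspace X) f h) c = chain_map p f (chain_map p h c)"
proof -
  have "chain_map p (compose (topspace X) f h) c = chain_map p (f \<circ> h) c"
    using assms by (intro chain_map_eq) (auto simp: compose_def)
  then show ?thesis by (simp add: chain_map_compose)
qed

lemma homeos_cycle:
  "f \<in> homeos X \<Longrightarrow> singular_relcycle 1 X {} c \<Longrightarrow> singular_relcycle 1 X {} (chain_map 1 f c)"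
  using singular_relcycle_chain_map[of 1 X "{}" c X f "{}"] homeos_imp_continuous by auto

lemma acts_by_sign_compose:
  assumes f: "f \<in> homeos X" "acts_by_sign X f" and h: "h \<in> homeos X" "acts_by_sign X h"
  shows "acts_by_sign X (compose (topspace X) f h)"
proof -
  obtain e where e: "e \<in> {1, -1}" "\<And>c. singular_relcycle 1 X {} c \<Longrightarrow> mod_boundary 3 1 X (chain_map 1 f c - frag_cmul e c)"
    by (rule acts_by_signE[OF f(2)]) blast
  obtain e' where e': "e' \<in> {1, -1}" "\<And>c. singular_relcycle 1 X {} c \<Longrightarrow> mod_boundary 3 1 X (chain_map 1 h c - frag_cmul e' c)"
    by (rule acts_by_signE[OF h(2)]) blast
  show ?thesis
    unfolding acts_by_sign_def
  proof (intro bexI allI impI)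
    show "e * e' \<in> {1, -1}" using e(1) e'(1) by auto
    fix c assume c: "singular_relcycle 1 X {} c"
    have "mod_boundary 3 1 X ((chain_map 1 f (chain_map 1 h c) - frag_cmul e (chain_map 1 h c))
        + frag_cmul e (chain_map 1 h c - frag_cmul e' c))"
      using e(2)[OF homeos_cycle[OF h(1) c]] mod_boundary_cmul[OF e'(2)[OF c]] by (rule mod_boundary_add)
    moreover have "frag_cmul e (chain_map 1 h c - frag_cmul e' c) = frag_cmul e (chain_map 1 h c) - frag_cmul (e * e') c"
      by (simp only: frag_cmul_right_diff frag_cmul_cmul)
    moreover have "chain_map 1 (compose (topspace X) f h) c = chain_map 1 f (chain_map 1 h c)"
      using c by (intro chain_map_compose_restrict) (simp add: singular_cycle)
    ultimately show "mod_boundary 3 1 X (chain_map 1 (compose (topspace X) f h) c - frag_cmul (e * e') c)"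
      by (simp only: add_diff_eq diff_add_cancel)
  qed
qed

lemma chain_map_left_inverse:
  assumes "compose (topspace X) f' f = (\<lambda>x\<in>topspace X. x)" "singular_chain p X c"
  shows "chain_map p f' (chain_map p f c) = c"
  unfolding chain_map_compose_restrict[OF assms(2), symmetric] assms(1)
  by (rule chain_map_id_gen[OF assms(2)]) simp

lemma acts_by_sign_left_inverse:
  assumes f: "f \<in> homeos X" "acts_by_sign X f"
    and f': "f' \<in> homeos X" "compose (topspace X) f' f = (\<lambda>x\<in>topspace X. x)"
  shows "acts_by_sign X f'"
proof -
  obtain e where e: "e \<in> {1, -1}" "\<And>c. singular_relcycle 1 X {} c \<Longrightarrow> mod_boundary 3 1 X (chain_map 1 f c - frag_cmul e c)"
    by (rule acts_by_signE[OF f(2)]) blast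
  show ?thesis
    unfolding acts_by_sign_def
  proof (intro bexI allI impI)
    fix c assume c: "singular_relcycle 1 X {} c"
    have "chain_map 1 f' (chain_map 1 f c) = c"
      using c by (intro chain_map_left_inverse[OF f'(2)]) (simp add: singular_cycle)
    then have "chain_map 1 f' (chain_map 1 f c - frag_cmul e c) = c - frag_cmul e (chain_map 1 f' c)"
      by (simp add: chain_map_diff)
    \<comment> \<open>Since \<open>e * e = 1\<close>, multiplication by \<open>- e\<close> turns the
      difference of \<open>c\<close> and \<open>e\<close> times the image of \<open>c\<close> into
      the required one.\<close>
    then have "mod_boundary 3 1 X (frag_cmul (- e) (c - frag_cmul e (chain_map 1 f' c)))"
      using mod_boundary_cmul[OF mod_boundary_chain_map[OF e(2)[OF c] homeos_imp_continuous[OF f'(1)]]] by simp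
    moreover have "frag_cmul (- e) (c - frag_cmul e (chain_map 1 f' c)) = chain_map 1 f' c - frag_cmul e c"
      using e(1) by (auto simp: frag_cmul_right_diff)
    ultimately show "mod_boundary 3 1 X (chain_map 1 f' c - frag_cmul e c)" by simp
  qed (rule e(1))
qed

text \<open>A sign commutes with the map induced by \<open>k\<close>, so conjugation leaves it
  unchanged; this is the source of normality.\<close>

lemma acts_by_sign_conjugate:
  assumes f: "f \<in> homeos X" "acts_by_sign X f" and k: "k \<in> homeos X"
    and k': "k' \<in> homeos X" "compose (topspace X) k' k = (\<lambda>x\<in>topspace X. x)"
  shows "acts_by_sign X (compose (topspace X) (compose (topspace X) k' f) k)"
proof -
  obtain e where e: "e \<in> {1, -1}" "\<And>c. singular_relcycle 1 X {} c \<Longrightarrow> mod_boundary 3 1 X (chain_map 1 f c - frag_cmul e c)"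
    by (rule acts_by_signE[OF f(2)]) blast
  show ?thesis
    unfolding acts_by_sign_def
  proof (intro bexI allI impI)
    fix c assume c: "singular_relcycle 1 X {} c"
    have ch: "singular_chain 1 X c" "singular_chain 1 X (chain_map 1 k c)"
      using c homeos_cycle[OF k c] by (simp_all add: singular_cycle)
    have "chain_map 1 (compose (topspace X) (compose (topspace X) k' f) k) c = chain_map 1 k' (chain_map 1 f (chain_map 1 k c))"
      by (simp only: chain_map_compose_restrict ch)
    moreover have "chain_map 1 k' (chain_map 1 k c) = c"
      by (rule chain_map_left_inverse[OF k'(2) ch(1)])
    ultimately have "chain_map 1 (compose (topspace X) (compose (topspace X) k' f) k) c - frag_cmul e c
        = chain_map 1 k' (chain_map 1 f (chain_map 1 k c) - frag_cmul e (chain_map 1 k c))"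
      by (simp add: chain_map_diff)
    then show "mod_boundary 3 1 X (chain_map 1 (compose (topspace X) (compose (topspace X) k' f) k) c - frag_cmul e c)"
      using mod_boundary_chain_map[OF e(2)[OF homeos_cycle[OF k c]] homeos_imp_continuous[OF k'(1)]] by simp
  qed (rule e(1))
qed

definition sign_subgroup :: "'a topology \<Rightarrow> ('a \<Rightarrow> 'a) set set" where
  "sign_subgroup X = {isotopy X `` {f} | f. f \<in> homeos X \<and> acts_by_sign X f}"

lemma mapping_class_carrier: "A \<in> carrier (mapping_class_group X) \<longleftrightarrow> (\<exists>f\<in>homeos X. A = isotopy X `` {f})"
  by (auto simp: mapping_class_group_def quotient_def)

lemma mapping_class_inv:
  assumes "f \<in> homeos X" "f' \<in> homeos X" "compose (topspace X) f' f = (\<lambda>x\<in>topspace X. x)"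
  shows "inv\<^bsub>mapping_class_group X\<^esub> (isotopy X `` {f}) = isotopy X `` {f'}"
proof (rule group.inv_equality[OF group_mapping_class_group])
  show "isotopy X `` {f'} \<otimes>\<^bsub>mapping_class_group X\<^esub> isotopy X `` {f} = \<one>\<^bsub>mapping_class_group X\<^esub>"
    unfolding mapping_class_mult[OF assms(2,1)] assms(3) by (simp add: mapping_class_group_def)
qed (use assms mapping_class_carrier in blast)+

lemma sign_subgroup_normal: "sign_subgroup X \<lhd> mapping_class_group X"
proof (rule group.normal_invI[OF group_mapping_class_group])
  let ?M = "mapping_class_group X"
  show "subgroup (sign_subgroup X) ?M"
  proof (rule group.subgroupI[OF group_mapping_class_group])
    show "sign_subgroup X \<subseteq> carrier ?M"
      using mapping_class_carrier by (auto simp: sign_subgroup_def)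
    have "acts_by_sign X (\<lambda>x\<in>topspace X. x)"
      unfolding acts_by_sign_def
    proof (intro bexI[of _ 1] allI impI)
      fix c :: "'a chain" assume "singular_relcycle 1 X {} c"
      then have "chain_map 1 (\<lambda>x\<in>topspace X. x) c = c"
        by (intro chain_map_id_gen[of 1 X]) (simp_all add: singular_cycle)
      then show "mod_boundary 3 1 X (chain_map 1 (\<lambda>x\<in>topspace X. x) c - frag_cmul 1 c)"
        unfolding mod_boundary_def by (intro exI[of _ 0]) simp
    qed simp
    then show "sign_subgroup X \<noteq> {}" using homeos_id by (auto simp: sign_subgroup_def)
  next
    fix A assume "A \<in> sign_subgroup X"
    then obtain f where f: "f \<in> homeos X" "acts_by_sign X f" "A = isotopy X `` {f}"
      by (auto simp: sign_subgroup_def)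
    obtain f' where f': "f' \<in> homeos X" "compose (topspace X) f' f = (\<lambda>x\<in>topspace X. x)"
      using homeos_inverse[OF f(1)] .
    show "inv\<^bsub>?M\<^esub> A \<in> sign_subgroup X"
      unfolding f(3) mapping_class_inv[OF f(1) f'] sign_subgroup_def
      using f'(1) acts_by_sign_left_inverse[OF f(1,2) f'] by blast
    fix B assume "B \<in> sign_subgroup X"
    then obtain h where h: "h \<in> homeos X" "acts_by_sign X h" "B = isotopy X `` {h}"
      by (auto simp: sign_subgroup_def)
    show "A \<otimes>\<^bsub>?M\<^esub> B \<in> sign_subgroup X"
      unfolding f(3) h(3) mapping_class_mult[OF f(1) h(1)] sign_subgroup_def
      using homeos_compose[OF f(1) h(1)] acts_by_sign_compose[OF f(1,2) h(1,2)] by blast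
  qed
  fix A N assume A: "A \<in> carrier ?M" and N: "N \<in> sign_subgroup X"
  have "inv\<^bsub>?M\<^esub> A \<in> carrier ?M" using group.inv_closed[OF group_mapping_class_group A] .
  \<comment> \<open>The representative is chosen for the inverse of \<open>A\<close>: then the left
    inverse \<open>k'\<close> from \<open>homeos_inverse\<close> represents \<open>A\<close>
    itself.\<close>
  then obtain k where k: "k \<in> homeos X" "inv\<^bsub>?M\<^esub> A = isotopy X `` {k}" using mapping_class_carrier by blast
  obtain k' where k': "k' \<in> homeos X" "compose (topspace X) k' k = (\<lambda>x\<in>topspace X. x)"
    using homeos_inverse[OF k(1)] .
  have A': "A = isotopy X `` {k'}"
    using mapping_class_inv[OF k(1) k'] group.inv_inv[OF group_mapping_class_group A] k(2) by simp
  obtain f where f: "f \<in> homeos X" "acts_by_sign X f" "N = isotopy X `` {f}"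
    using N by (auto simp: sign_subgroup_def)
  show "A \<otimes>\<^bsub>?M\<^esub> N \<otimes>\<^bsub>?M\<^esub> inv\<^bsub>?M\<^esub> A \<in> sign_subgroup X"
    unfolding k(2) unfolding A' f(3) mapping_class_mult[OF k'(1) f(1)]
      mapping_class_mult[OF homeos_compose[OF k'(1) f(1)] k(1)] sign_subgroup_def
    using homeos_compose[OF homeos_compose[OF k'(1) f(1)] k(1)] acts_by_sign_conjugate[OF f(1,2) k(1) k'] by blast
qed

section \<open>Congruence subgroups\<close>

lemma one_AutoGroup: "\<one>\<^bsub>AutoGroup G\<^esub> = (\<lambda>x\<in>carrier G. x)"
  by (simp add: AutoGroup_def BijGroup_def)

lemma mod_cycle_group_mult: "a \<otimes>\<^bsub>mod_cycle_group m p X\<^esub> b = a + b"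
  by (simp add: mod_cycle_group_def)

lemma mod_boundary_0: "mod_boundary m p X 0"
  unfolding mod_boundary_def by (intro exI[of _ 0]) simp

text \<open>The unions that define the action contain the term of the representatives
  \<open>h\<close> and \<open>c\<close>. So the coset of the image of \<open>c\<close> is contained
  in the coset of \<open>c\<close>, and the two chains differ by a boundary modulo
  \<open>m\<close>.\<close>

lemma congruence_fixes_cycle:
  assumes A: "isotopy X `` {h} \<in> congruence_subgroup m X" and h: "h \<in> homeos X"
    and c: "singular_relcycle 1 X {} c"
  shows "mod_boundary m 1 X (chain_map 1 h c - c)"
proof -
  let ?G = "mod_cycle_group m 1 X" and ?B = "Collect (mod_boundary m 1 X)"
  let ?z = "?B #>\<^bsub>?G\<^esub> c"
  have mc: "mod_cycle m 1 X c"
    using c unfolding mod_cycle_def singular_cycle by (auto intro!: exI[of _ 0])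
  then have "c \<in> carrier ?G"
    unfolding mod_cycle_group_def subgroup_generated_def
    by (auto simp: mod_cycle_def intro!: generate.incl)
  then have z: "?z \<in> carrier (homology_mod m 1 X)"
    by (auto simp: homology_mod_def FactGroup_def RCOSETS_def)
  have "homology_action m X (isotopy X `` {h}) = (\<lambda>x\<in>carrier (homology_mod m 1 X). x)"
    using A by (simp add: congruence_subgroup_def kernel_def one_AutoGroup)
  then have "homology_action m X (isotopy X `` {h}) ?z = ?z" using z by simp
  moreover have "h \<in> isotopy X `` {h}" using h equiv_class_self[OF equiv_isotopy] by blast
  ultimately have "hom_induced_mod m 1 X X h ?z \<subseteq> ?z"
    using z unfolding homology_action_def by auto
  moreover have "c \<in> ?z"
    unfolding r_coset_def mod_cycle_group_mult using mod_boundary_0[of m 1 X] by force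
  ultimately have "?B #>\<^bsub>?G\<^esub> chain_map 1 h c \<subseteq> ?z"
    using z unfolding hom_induced_mod_def by auto
  moreover have "chain_map 1 h c \<in> ?B #>\<^bsub>?G\<^esub> chain_map 1 h c"
    unfolding r_coset_def mod_cycle_group_mult using mod_boundary_0[of m 1 X] by force
  ultimately have "chain_map 1 h c \<in> ?z" by blast
  then obtain b where "mod_boundary m 1 X b" "chain_map 1 h c = b + c"
    unfolding r_coset_def mod_cycle_group_mult by auto
  then show ?thesis by simp
qed

text \<open>Modulo 1 every chain is a boundary, so the homology group has a single element and every
  mapping class acts on it as the identity. This settles the only level that the final divisibility
  argument leaves open.\<close>

lemma congruence_subgroup_1: "congruence_subgroup 1 X = carrier (mapping_class_group X)"
proof
  show "congruence_subgroup 1 X \<subseteq> carrier (mapping_class_group X)"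
    by (auto simp: congruence_subgroup_def kernel_def)
  let ?G = "mod_cycle_group 1 1 X" and ?B = "Collect (mod_boundary 1 1 X)"
  have B: "mod_boundary 1 1 X c \<longleftrightarrow> singular_chain 1 X c" for c :: "'a chain"
  proof
    assume "singular_chain 1 X c"
    then show "mod_boundary 1 1 X c" unfolding mod_boundary_def by (intro exI[of _ 0] exI[of _ c]) simp
  next
    assume "mod_boundary 1 1 X c"
    then show "singular_chain 1 X c"
      unfolding mod_boundary_def using singular_chain_add singular_chain_boundary_alt by fastforce
  qed
  have coset: "?B #>\<^bsub>?G\<^esub> c = ?B" if c: "singular_chain 1 X c" for c
  proof
    show "?B #>\<^bsub>?G\<^esub> c \<subseteq> ?B"
      unfolding r_coset_def mod_cycle_group_mult using c singular_chain_add by (auto simp: B simp del: One_nat_def)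
    show "?B \<subseteq> ?B #>\<^bsub>?G\<^esub> c"
    proof
      fix b assume "b \<in> ?B"
      then have "b - c \<in> ?B" "b = (b - c) + c" using c singular_chain_diff by (auto simp: B simp del: One_nat_def)
      then show "b \<in> ?B #>\<^bsub>?G\<^esub> c" unfolding r_coset_def mod_cycle_group_mult by blast
    qed
  qed
  have chains: "singular_chain 1 X c" if "c \<in> carrier ?G" for c
    using that by (auto simp: mod_cycle_group_def subgroup_generated_def dest: group.generate_in_carrier[OF group_chain_group, rotated])
  have z_eq: "z = ?B" if "z \<in> carrier (homology_mod 1 1 X)" for z
    using that coset chains by (auto simp: homology_mod_def FactGroup_def RCOSETS_def)
  show "carrier (mapping_class_group X) \<subseteq> congruence_subgroup 1 X"
  proof
    fix A assume A: "A \<in> carrier (mapping_class_group X)"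
    then obtain f where f: "f \<in> homeos X" "A = isotopy X `` {f}" using mapping_class_carrier by blast
    have "f \<in> A" using f equiv_class_self[OF equiv_isotopy] by blast
    have ind: "hom_induced_mod 1 1 X X k z = ?B" if k: "k \<in> A" and z: "z \<in> carrier (homology_mod 1 1 X)" for k z
    proof -
      have "k \<in> homeos X" using k f by (auto simp: isotopy_def)
      then have "singular_chain 1 X (chain_map 1 k c)" if "singular_chain 1 X c" for c
        using singular_chain_chain_map[OF that homeos_imp_continuous] by blast
      then have "(\<Union>c\<in>?B. ?B #>\<^bsub>?G\<^esub> chain_map 1 k c) = (\<Union>c\<in>?B. ?B)"
        by (intro SUP_cong[OF refl] coset) (simp only: mem_Collect_eq B)
      also have "\<dots> = ?B" using mod_boundary_0[of 1 1 X] by blast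
      finally show ?thesis using z z_eq[OF z] by (simp add: hom_induced_mod_def)
    qed
    have "homology_action 1 X A = (\<lambda>z\<in>carrier (homology_mod 1 1 X). z)"
      unfolding homology_action_def
    proof (rule restrict_ext)
      fix z assume z: "z \<in> carrier (homology_mod 1 1 X)"
      have "(\<Union>k\<in>A. hom_induced_mod 1 1 X X k z) = (\<Union>k\<in>A. ?B)" using ind z by (intro SUP_cong) auto
      also have "\<dots> = z" using \<open>f \<in> A\<close> z_eq[OF z] by auto
      finally show "(\<Union>k\<in>A. hom_induced_mod 1 1 X X k z) = z" .
    qed
    then show "A \<in> congruence_subgroup 1 X"
      using A by (simp add: congruence_subgroup_def kernel_def one_AutoGroup)
  qed
qed

lemma isotopic_winding:
  assumes "(f, h) \<in> isotopy X" "circle_valued X \<alpha>" "singular_relcycle 1 X {} c"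
  shows "winding \<alpha> (chain_map 1 f c) = winding \<alpha> (chain_map 1 h c)"
proof -
  have "homotopic_with (\<lambda>_. True) X X f h"
    using assms(1) by (auto simp: isotopy_def intro: homotopic_with_mono)
  from winding_homologous[OF assms(2) homotopic_chain_maps[OF this assms(3)]] show ?thesis .
qed

theorem theorem1p2:
  fixes g :: nat and X :: "'a topology"
  assumes "g \<ge> 2"
    and "genus_surface g X"
  shows "\<exists>N. N \<lhd> mapping_class_group X \<and>
             N \<noteq> carrier (mapping_class_group X) \<and>
             (\<forall>m::nat. m \<ge> 1 \<longrightarrow>
                congruence_subgroup m X \<noteq> carrier (mapping_class_group X) \<longrightarrow>
                \<not> N \<subseteq> congruence_subgroup m X)"
proof -
  obtain q where q: "quotient_map (top_of_set (cball (0::complex) 1)) X q"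
    "\<forall>x\<in>cball 0 1. \<forall>y\<in>cball 0 1. q x = q y \<longleftrightarrow> (x, y) \<in> glued g"
    using assms(2) unfolding genus_surface_def by blast
  interpret polygon_surface g X q
    using assms(1) q by unfold_locales auto
  obtain F where F: "homeomorphic_map X X F" "orientation_preserving X (F \<circ> F)"
    and W: "\<And>i c. i < g \<Longrightarrow> singular_relcycle 1 X {} c \<Longrightarrow> winding (turn (4 * i)) (chain_map 1 (F \<circ> F) c)
       = 2 * winding (turn (4 * i)) c + winding (turn (4 * i + 1)) c"
    "\<And>i c. i < g \<Longrightarrow> singular_relcycle 1 X {} c \<Longrightarrow> winding (turn (4 * i + 1)) (chain_map 1 (F \<circ> F) c)
       = winding (turn (4 * i)) c + winding (turn (4 * i + 1)) c"
    by (rule fibonacci_homeomorphism) blast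
  \<comment> \<open>The map \<open>F\<close> contains a reflection, so it is its square, restricted
    to be extensional, that represents a mapping class.\<close>
  define f where "f = compose (topspace X) F F"
  have f_eq: "f x = (F \<circ> F) x" if "x \<in> topspace X" for x using that by (simp add: f_def compose_def)
  have f: "f \<in> homeos X"
  proof -
    have "hom_induced 2 X {} X {} f = hom_induced 2 X {} X {} (F \<circ> F)"
      by (rule hom_induced_eq) (rule f_eq)
    then have "orientation_preserving X f" using F(2) by (simp add: orientation_preserving_def)
    then show ?thesis
      unfolding homeos_def using homeomorphic_map_compose_restrict[OF F(1) F(1)]
      by (simp add: f_def compose_extensional)
  qed
  have map_f: "chain_map 1 f c = chain_map 1 (F \<circ> F) c" if "singular_relcycle 1 X {} c" for c
    using that f_eq by (intro chain_map_eq[of 1 X]) (simp_all add: singular_cycle)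
  have Wf: "winding (turn (4 * i)) (chain_map 1 f c) = 2 * winding (turn (4 * i)) c + winding (turn (4 * i + 1)) c"
    "winding (turn (4 * i + 1)) (chain_map 1 f c) = winding (turn (4 * i)) c + winding (turn (4 * i + 1)) c"
    if "i < g" "singular_relcycle 1 X {} c" for i c
    unfolding map_f[OF that(2)] by (rule W[OF that])+
  define h where "h = compose (topspace X) f f"
  have h: "h \<in> homeos X" unfolding h_def by (rule homeos_compose[OF f f])
  have map_h: "chain_map 1 h c = chain_map 1 f (chain_map 1 f c)" if "singular_relcycle 1 X {} c" for c
    unfolding h_def using that by (intro chain_map_compose_restrict) (simp add: singular_cycle)
  have g0: "0 < g" using g by simp
  have l: "letter g 0" "letter g 1" using g0 by (auto simp: letter_def)
  \<comment> \<open>In the winding numbers of handle 0 this loop is the vector (0, 1). The matrix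
    \<open>P\<close> takes it to (1, 1), and \<open>P^2\<close> takes it to a vector with second
    entry 2.\<close>
  obtain c where c: "singular_relcycle 1 X {} c" "winding (turn 0) c = 0" "winding (turn 1) c = 1"
    by (rule edge_loop)
  have fc: "singular_relcycle 1 X {} (chain_map 1 f c)" by (rule homeos_cycle[OF f c(1)])
  have wf: "winding (turn 0) (chain_map 1 f c) = 1" "winding (turn 1) (chain_map 1 f c) = 1"
    using Wf[OF g0 c(1)] c(2,3) by simp_all
  have wh: "winding (turn 1) (chain_map 1 h c) = 2"
    unfolding map_h[OF c(1)] using Wf(2)[OF g0 fc] wf by simp

  \<comment> \<open>Cayley-Hamilton: the matrix \<open>((2, 1), (1, 1))\<close> has square \<open>3 P - 1\<close>, which is \<open>-1\<close> modulo 3.\<close>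
  have "acts_by_sign X h"
    unfolding acts_by_sign_def
  proof (intro bexI[of _ "-1"] allI impI)
    fix z assume z: "singular_relcycle 1 X {} z"
    define fz where "fz = chain_map 1 f z"
    have fz: "singular_relcycle 1 X {} fz" unfolding fz_def by (rule homeos_cycle[OF f z])
    have ffz: "singular_relcycle 1 X {} (chain_map 1 f fz)" by (rule homeos_cycle[OF f fz])
    have "singular_relboundary 1 X {} (chain_map 1 f fz - frag_cmul 3 fz + z)"
    proof (rule cycle_zero_winding_bounds)
      show "singular_relcycle 1 X {} (chain_map 1 f fz - frag_cmul 3 fz + z)"
        by (intro singular_relcycle_add singular_relcycle_diff singular_relcycle_cmul z fz ffz)
      fix j assume "letter g j"
      then obtain i where i: "i < g" "j = 4 * i \<or> j = 4 * i + 1" by (auto simp: letter_def)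
      show "winding (turn j) (chain_map 1 f fz - frag_cmul 3 fz + z) = 0"
        unfolding chain_eval_add chain_eval_diff chain_eval_cmul
        using i(2) Wf[OF i(1) fz] Wf[OF i(1) z, folded fz_def] by auto
    qed
    then obtain d where d: "singular_chain (Suc 1) X d" "chain_boundary (Suc 1) d = chain_map 1 f fz - frag_cmul 3 fz + z"
      unfolding singular_boundary by blast
    have "chain_map 1 h z - frag_cmul (- 1) z = chain_boundary (Suc 1) d + frag_cmul (int 3) fz"
      unfolding d(2) map_h[OF z] fz_def by simp
    then show "mod_boundary 3 1 X (chain_map 1 h z - frag_cmul (- 1) z)"
      unfolding mod_boundary_def using d(1) fz by (auto simp: singular_cycle)
  qed simp
  then have h_in: "isotopy X `` {h} \<in> sign_subgroup X" using h by (auto simp: sign_subgroup_def)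

  have "isotopy X `` {f} \<notin> sign_subgroup X"
  proof
    assume "isotopy X `` {f} \<in> sign_subgroup X"
    \<comment> \<open>Membership supplies some representative \<open>k\<close> of the class of
      \<open>f\<close>, possibly not \<open>f\<close> itself; winding numbers carry over because
      they are invariant under isotopy.\<close>
    then obtain k where k: "k \<in> homeos X" "acts_by_sign X k" "isotopy X `` {f} = isotopy X `` {k}"
      by (auto simp: sign_subgroup_def)
    then have iso: "(k, f) \<in> isotopy X"
      using f equiv_class_self[OF equiv_isotopy] by blast
    obtain e :: int where "mod_boundary 3 1 X (chain_map 1 k c - frag_cmul e c)"
      using acts_by_signE[OF k(2)] c(1) by metis
    moreover have "singular_relcycle 1 X {} (chain_map 1 k c - frag_cmul e c)"
      by (intro singular_relcycle_diff singular_relcycle_cmul homeos_cycle[OF k(1)] c(1))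
    ultimately obtain n :: int where "winding (turn 0) (chain_map 1 k c - frag_cmul e c) = of_int (int 3 * n)"
      using winding_mod_boundary[OF turn_circle_valued[OF l(1)]] by blast
    \<comment> \<open>The winding number of \<open>turn 0\<close> is 0 on \<open>c\<close>, so the
      term with the sign \<open>e\<close> drops out for either sign.\<close>
    then have "real_of_int (3 * n) = 1"
      using isotopic_winding[OF iso turn_circle_valued[OF l(1)] c(1)] wf(1) c(2)
      by (simp add: chain_eval_diff chain_eval_cmul)
    then have "3 * n = 1" by linarith
    then show False by presburger
  qed
  moreover have "isotopy X `` {f} \<in> carrier (mapping_class_group X)" using f mapping_class_carrier by blast
  ultimately have proper: "sign_subgroup X \<noteq> carrier (mapping_class_group X)" by blast

  have "\<not> sign_subgroup X \<subseteq> congruence_subgroup m X"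
    if m: "m \<ge> 1" "congruence_subgroup m X \<noteq> carrier (mapping_class_group X)" for m
  proof
    assume "sign_subgroup X \<subseteq> congruence_subgroup m X"
    then have "isotopy X `` {h} \<in> congruence_subgroup m X" using h_in by blast
    from congruence_fixes_cycle[OF this h c(1)]
    have "mod_boundary m 1 X (chain_map 1 h c - c)" .
    moreover have "singular_relcycle 1 X {} (chain_map 1 h c - c)"
      by (intro singular_relcycle_diff homeos_cycle[OF h] c(1))
    ultimately obtain n :: int where "winding (turn 1) (chain_map 1 h c - c) = of_int (int m * n)"
      using winding_mod_boundary[OF turn_circle_valued[OF l(2)]] by blast
    \<comment> \<open>The winding number of the difference is \<open>2 - 1\<close>, and only
      \<open>m = 1\<close> divides it.\<close>
    then have "real_of_int (int m * n) = 1" using wh c(3) by (simp add: chain_eval_diff)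
    then have "int m * n = 1" by linarith
    then have "m = 1" by (simp add: zmult_eq_1_iff)
    then show False using m congruence_subgroup_1 by blast
  qed
  then show ?thesis using sign_subgroup_normal proper by blast
qed

end
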